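(* Let $q\ge0$, $r\ge1$, $1\le s\le\infty$, and let $\|\!|\cdot|\!\|$ be a norm on $V_h$ such that for some $\gamma\in(0,\pi/2)$ and a constant $M_h$ independent of $z$, $$\|\!|(z+\Delta_h)^{-1}\chi|\!\|\le\frac{M_h}{|z|}\|\!|\chi|\!\|\quad\text{for all }\chi\in V_h,\ z\in\mathbb{C}\setminus\Sigma_\gamma,$$ where $\Sigma_\gamma=\{z\in\mathbb{C}:|\arg z|\le\gamma\}$. Let $u_{kh}\in X^{q,r}_{k,h}$ satisfy $B(u_{kh},\varphi_{kh})=(f,\varphi_{kh})_{I\times\Omega}$ for all $\varphi_{kh}\in X^{q,r}_{k,h}$. Then there is a constant $C$ independent of $k$ and $h$ such that $$\Big(\sum_{m=1}^M\int_{I_m}\|\!|\partial_tu_{kh}(t)|\!\|^s dt\Big)^{1/s}+\Big(\sum_{m=1}^M\int_{I_m}\|\!|\Delta_hu_{kh}(t)|\!\|^s dt\Big)^{1/s}+\Big(\sum_{m=1}^Mk_m\|\!|k_m^{-1}[u_{kh}]_{m-1}|\!\|^s\Big)^{1/s}\le CM_h\ln\frac{T}{k}\Big(\int_I\|\!|P_hf(t)|\!\|^sdt\Big)^{1/s},$$ with the usual modification (suprema/maxima) for $s=\infty$, where $[u_{kh}]_0:=u_{kh,0}^+$.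
   Context: $\Omega\subset\mathbb{R}^d$ is a Lipschitz domain; $\mathcal{T}$ is an arbitrary (not necessarily quasi-uniform) partition of $\Omega$ into cells (triangles, tetrahedra, quadrilaterals or hexahedra), and $V_h\subset H^1_0(\Omega)$ consists of functions belonging to a fixed polynomial space ($P_r$ or $Q_r$) on each cell. $T>0$, $I=(0,T)$ partitioned by $0=t_0<\dots<t_M=T$, $I_m=(t_{m-1},t_m]$, $k_m=t_m-t_{m-1}$, $k=\max_mk_m$, $k_{\min}=\min_mk_m$, with (i) $k_{\min}\ge ck^\beta$ for constants $c,\beta>0$ independent of $k$; (ii) $\kappa^{-1}\le k_m/k_{m+1}\le\kappa$; (iii) $k\le T/4$. $X^{q,r}_{k,h}=\{v:v|_{I_m}\text{ polynomial of degree}\le q\text{ in }t\text{ with values in }V_h\}$; $v_m^\pm=\lim_{\varepsilon\to0^+}v(t_m\pm\varepsilon)$, $[v]_m=v_m^+-v_m^-$; $$B(u,\varphi)=\sum_{m=1}^M(\partial_tu,\varphi)_{I_m\times\Omega}+(\nabla u,\nabla\varphi)_{I\times\Omega}+\sum_{m=2}^M([u]_{m-1},\varphi_{m-1}^+)_\Omega+(u_0^+,\varphi_0^+)_\Omega.$$ $\Delta_h:V_h\to V_h$: $(-\Delta_hv_h,\chi)_\Omega=(\nabla v_h,\nabla\chi)_\Omega$ for all $\chi\in V_h$; $P_h:L^2(\Omega)\to V_h$ is the $L^2$-orthogonal projection. *)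

theory Defs
  imports "HOL-Analysis.Analysis"
begin

definition lipschitz_domain :: "'a::euclidean_space set \<Rightarrow> bool" where
  "lipschitz_domain \<Omega> \<longleftrightarrow> open \<Omega> \<and> connected \<Omega> \<and> bounded \<Omega> \<and> \<Omega> \<noteq> {} \<and>
     (\<forall>x\<in>frontier \<Omega>. \<exists>(e::'a) (\<delta>::real) (L::real) (g::'a \<Rightarrow> real).
        norm e = 1 \<and> \<delta> > 0 \<and> L-lipschitz_on UNIV g \<and>
        (\<forall>y. dist y x < \<delta> \<longrightarrow>
              (y \<in> \<Omega> \<longleftrightarrow> (y - x) \<bullet> e < g ((y - x) - ((y - x) \<bullet> e) *\<^sub>R e))))"

definition monom :: "('a::euclidean_space \<Rightarrow> nat) \<Rightarrow> 'a \<Rightarrow> real" where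
  "monom \<alpha> x = (\<Prod>b\<in>Basis. (x \<bullet> b) ^ \<alpha> b)"

definition multi_indices :: "bool \<Rightarrow> nat \<Rightarrow> ('a::euclidean_space \<Rightarrow> nat) set" where
  "multi_indices simp r = {\<alpha>. (\<forall>b. b \<notin> Basis \<longrightarrow> \<alpha> b = 0) \<and>
      (if simp then sum \<alpha> Basis \<le> r else (\<forall>b\<in>Basis. \<alpha> b \<le> r))}"

definition poly_space :: "bool \<Rightarrow> nat \<Rightarrow> ('a::euclidean_space \<Rightarrow> real) set" where
  "poly_space simp r = {p. \<exists>coef. p = (\<lambda>x. \<Sum>\<alpha>\<in>multi_indices simp r. coef \<alpha> * monom \<alpha> x)}"

definition ref_cell :: "bool \<Rightarrow> 'a::euclidean_space set" where
  "ref_cell simp = (if simp then {x. (\<forall>b\<in>Basis. 0 \<le> x \<bullet> b) \<and> (\<Sum>b\<in>Basis. x \<bullet> b) \<le> 1}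
                    else cbox 0 One)"

definition admissible_map :: "bool \<Rightarrow> ('a::euclidean_space \<Rightarrow> 'a) \<Rightarrow> bool" where
  "admissible_map simp F \<longleftrightarrow>
     (if simp then (\<exists>A c. linear A \<and> bij A \<and> F = (\<lambda>x. A x + c))
      else ((\<forall>b\<in>Basis. (\<lambda>x. F x \<bullet> b) \<in> poly_space False 1) \<and>
            inj_on F (ref_cell False) \<and>
            (\<forall>x\<in>ref_cell False. bij (frechet_derivative F (at x)))))"

text \<open>An arbitrary (not necessarily conforming or quasi-uniform) partition of Omega.\<close>
definition cell_mesh :: "bool \<Rightarrow> 'a::euclidean_space set \<Rightarrow> ('a \<Rightarrow> 'a) set \<Rightarrow> bool" where
  "cell_mesh simp \<Omega> Th \<longleftrightarrow> finite Th \<and> (\<forall>F\<in>Th. admissible_map simp F) \<and>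
     (\<Union>F\<in>Th. F ` ref_cell simp) = closure \<Omega> \<and>
     (\<forall>F\<in>Th. \<forall>G\<in>Th. F \<noteq> G \<longrightarrow>
        interior (F ` ref_cell simp) \<inter> interior (G ` ref_cell simp) = {})"

text \<open>V_h: the functions in H^1_0 which are piecewise in the polynomial space; these are
  exactly the continuous piecewise polynomials vanishing outside Omega.\<close>
definition fe_space :: "bool \<Rightarrow> nat \<Rightarrow> 'a::euclidean_space set \<Rightarrow> ('a \<Rightarrow> 'a) set \<Rightarrow> ('a \<Rightarrow> real) set" where
  "fe_space simp r \<Omega> Th = {v. continuous_on UNIV v \<and> (\<forall>x. x \<notin> \<Omega> \<longrightarrow> v x = 0) \<and>
      (\<forall>F\<in>Th. \<exists>p\<in>poly_space simp r. \<forall>y\<in>ref_cell simp. v (F y) = p y)}"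

definition L2ip :: "'a::euclidean_space set \<Rightarrow> ('a \<Rightarrow> real) \<Rightarrow> ('a \<Rightarrow> real) \<Rightarrow> real" where
  "L2ip \<Omega> u v = (LINT x:\<Omega>|lebesgue. u x * v x)"

definition grad_ip :: "'a::euclidean_space set \<Rightarrow> ('a \<Rightarrow> real) \<Rightarrow> ('a \<Rightarrow> real) \<Rightarrow> real" where
  "grad_ip \<Omega> u v = (LINT x:\<Omega>|lebesgue.
      \<Sum>b\<in>Basis. frechet_derivative u (at x) b * frechet_derivative v (at x) b)"

definition is_discrete_laplacian ::
  "'a::euclidean_space set \<Rightarrow> ('a \<Rightarrow> real) set \<Rightarrow> (('a \<Rightarrow> real) \<Rightarrow> ('a \<Rightarrow> real)) \<Rightarrow> bool" where
  "is_discrete_laplacian \<Omega> V L \<longleftrightarrow>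
     (\<forall>v\<in>V. L v \<in> V \<and> (\<forall>\<psi>\<in>V. L2ip \<Omega> (\<lambda>x. - L v x) \<psi> = grad_ip \<Omega> v \<psi>))"

definition L2_fun :: "'a::euclidean_space set \<Rightarrow> ('a \<Rightarrow> real) \<Rightarrow> bool" where
  "L2_fun \<Omega> g \<longleftrightarrow> (\<lambda>x. indicator \<Omega> x * g x) \<in> borel_measurable lebesgue \<and>
      set_integrable lebesgue \<Omega> (\<lambda>x. (g x)\<^sup>2)"

definition is_L2_projection ::
  "'a::euclidean_space set \<Rightarrow> ('a \<Rightarrow> real) set \<Rightarrow> ('a \<Rightarrow> real) \<Rightarrow> ('a \<Rightarrow> real) \<Rightarrow> bool" where
  "is_L2_projection \<Omega> V g p \<longleftrightarrow> p \<in> V \<and> (\<forall>\<psi>\<in>V. L2ip \<Omega> p \<psi> = L2ip \<Omega> g \<psi>)"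

definition cfe_space :: "('a \<Rightarrow> real) set \<Rightarrow> ('a \<Rightarrow> complex) set" where
  "cfe_space V = {w. (\<lambda>x. Re (w x)) \<in> V \<and> (\<lambda>x. Im (w x)) \<in> V}"

definition cplx :: "('a \<Rightarrow> real) \<Rightarrow> 'a \<Rightarrow> complex" where
  "cplx v = (\<lambda>x. complex_of_real (v x))"

definition cext :: "(('a \<Rightarrow> real) \<Rightarrow> ('a \<Rightarrow> real)) \<Rightarrow> ('a \<Rightarrow> complex) \<Rightarrow> 'a \<Rightarrow> complex" where
  "cext L w = (\<lambda>x. complex_of_real (L (\<lambda>y. Re (w y)) x) + \<i> * complex_of_real (L (\<lambda>y. Im (w y)) x))"

definition is_cnorm_on :: "('a \<Rightarrow> complex) set \<Rightarrow> (('a \<Rightarrow> complex) \<Rightarrow> real) \<Rightarrow> bool" where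
  "is_cnorm_on S N \<longleftrightarrow> (\<forall>v\<in>S. 0 \<le> N v \<and> (N v = 0 \<longleftrightarrow> v = (\<lambda>x. 0))) \<and>
     (\<forall>v\<in>S. \<forall>a. N (\<lambda>x. a * v x) = cmod a * N v) \<and>
     (\<forall>v\<in>S. \<forall>w\<in>S. N (\<lambda>x. v x + w x) \<le> N v + N w)"

definition sector :: "real \<Rightarrow> complex set" where
  "sector \<gamma> = {z. \<bar>Arg z\<bar> \<le> \<gamma>}"

definition kstep :: "(nat \<Rightarrow> real) \<Rightarrow> nat \<Rightarrow> real" where
  "kstep tt m = tt m - tt (m - 1)"

definition kmax :: "(nat \<Rightarrow> real) \<Rightarrow> nat \<Rightarrow> real" where
  "kmax tt M = Max (kstep tt ` {1..M})"

definition kmin :: "(nat \<Rightarrow> real) \<Rightarrow> nat \<Rightarrow> real" where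
  "kmin tt M = Min (kstep tt ` {1..M})"

definition time_mesh :: "real \<Rightarrow> real \<Rightarrow> real \<Rightarrow> real \<Rightarrow> nat \<Rightarrow> (nat \<Rightarrow> real) \<Rightarrow> bool" where
  "time_mesh T c \<beta> \<kappa> M tt \<longleftrightarrow> 1 \<le> M \<and> tt 0 = 0 \<and> tt M = T \<and>
     (\<forall>m\<in>{1..M}. tt (m - 1) < tt m) \<and>
     kmin tt M \<ge> c * kmax tt M powr \<beta> \<and>
     (\<forall>m\<in>{1..<M}. 1 / \<kappa> \<le> kstep tt m / kstep tt (m + 1) \<and> kstep tt m / kstep tt (m + 1) \<le> \<kappa>) \<and>
     kmax tt M \<le> T / 4"

definition dG_space :: "nat \<Rightarrow> ('a \<Rightarrow> real) set \<Rightarrow> nat \<Rightarrow> (nat \<Rightarrow> real) \<Rightarrow> (real \<Rightarrow> 'a \<Rightarrow> real) set" where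
  "dG_space q V M tt = {v. \<forall>m\<in>{1..M}. \<exists>\<psi>. (\<forall>j\<le>q. \<psi> j \<in> V) \<and>
       (\<forall>t\<in>{tt (m - 1)<..tt m}. v t = (\<lambda>x. \<Sum>j\<le>q. t ^ j * \<psi> j x))}"

definition tplus :: "(nat \<Rightarrow> real) \<Rightarrow> nat \<Rightarrow> (real \<Rightarrow> 'a \<Rightarrow> real) \<Rightarrow> 'a \<Rightarrow> real" where
  "tplus tt m v = (\<lambda>x. Lim (at_right (tt m)) (\<lambda>t. v t x))"

definition tminus :: "(nat \<Rightarrow> real) \<Rightarrow> nat \<Rightarrow> (real \<Rightarrow> 'a \<Rightarrow> real) \<Rightarrow> 'a \<Rightarrow> real" where
  "tminus tt m v = (\<lambda>x. Lim (at_left (tt m)) (\<lambda>t. v t x))"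

definition tjump :: "(nat \<Rightarrow> real) \<Rightarrow> nat \<Rightarrow> (real \<Rightarrow> 'a \<Rightarrow> real) \<Rightarrow> 'a \<Rightarrow> real" where
  "tjump tt m v = (\<lambda>x. tplus tt m v x - tminus tt m v x)"

definition jump_prev :: "(nat \<Rightarrow> real) \<Rightarrow> nat \<Rightarrow> (real \<Rightarrow> 'a \<Rightarrow> real) \<Rightarrow> 'a \<Rightarrow> real" where
  "jump_prev tt m v = (if m = 1 then tplus tt 0 v else tjump tt (m - 1) v)"

definition dt :: "(real \<Rightarrow> 'a \<Rightarrow> real) \<Rightarrow> real \<Rightarrow> 'a \<Rightarrow> real" where
  "dt v t = (\<lambda>x. deriv (\<lambda>s. v s x) t)"

definition bilinB :: "'a::euclidean_space set \<Rightarrow> nat \<Rightarrow> (nat \<Rightarrow> real) \<Rightarrow>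
    (real \<Rightarrow> 'a \<Rightarrow> real) \<Rightarrow> (real \<Rightarrow> 'a \<Rightarrow> real) \<Rightarrow> real" where
  "bilinB \<Omega> M tt u \<phi> =
     (\<Sum>m=1..M. LINT t:{tt (m - 1)<..tt m}|lborel. L2ip \<Omega> (dt u t) (\<phi> t))
     + (LINT t:{tt 0<..<tt M}|lborel. grad_ip \<Omega> (u t) (\<phi> t))
     + (\<Sum>m=2..M. L2ip \<Omega> (tjump tt (m - 1) u) (tplus tt (m - 1) \<phi>))
     + L2ip \<Omega> (tplus tt 0 u) (tplus tt 0 \<phi>)"

definition rhsF :: "'a::euclidean_space set \<Rightarrow> real \<Rightarrow> (real \<Rightarrow> 'a \<Rightarrow> real) \<Rightarrow> (real \<Rightarrow> 'a \<Rightarrow> real) \<Rightarrow> real" where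
  "rhsF \<Omega> T f \<phi> = (LINT t:{0<..<T}|lborel. L2ip \<Omega> (f t) (\<phi> t))"

definition root_enn :: "real \<Rightarrow> ennreal \<Rightarrow> ennreal" where
  "root_enn p X = (if X = top then top else ennreal (enn2real X powr (1 / p)))"

definition ess_sup_on :: "real set \<Rightarrow> (real \<Rightarrow> real) \<Rightarrow> ennreal" where
  "ess_sup_on A g = Inf {z. AE t in lborel. t \<in> A \<longrightarrow> ennreal (g t) \<le> z}"

definition time_norm :: "ennreal \<Rightarrow> real set \<Rightarrow> (real \<Rightarrow> real) \<Rightarrow> ennreal" where
  "time_norm s A g = (if s = top then ess_sup_on A g
     else root_enn (enn2real s) (\<integral>\<^sup>+ t. indicator A t * ennreal (g t powr enn2real s) \<partial>lebesgue))"

definition piece_norm :: "ennreal \<Rightarrow> nat \<Rightarrow> (nat \<Rightarrow> real set) \<Rightarrow> (real \<Rightarrow> real) \<Rightarrow> ennreal" where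
  "piece_norm s M J g = (if s = top then (SUP m\<in>{1..M}. ess_sup_on (J m) g)
     else root_enn (enn2real s)
       (\<Sum>m\<in>{1..M}. \<integral>\<^sup>+ t. indicator (J m) t * ennreal (g t powr enn2real s) \<partial>lebesgue))"

definition disc_norm :: "ennreal \<Rightarrow> nat \<Rightarrow> (nat \<Rightarrow> real) \<Rightarrow> (nat \<Rightarrow> real) \<Rightarrow> ennreal" where
  "disc_norm s M w a = (if s = top then (SUP m\<in>{1..M}. ennreal (a m))
     else root_enn (enn2real s) (\<Sum>m\<in>{1..M}. ennreal (w m * a m powr enn2real s)))"

end

(*
  Diagonalising the discrete Laplacian splits the dG equation into scalar problems u' + lambda u = f,
  whose solution operator is a kernel rational in lambda.  A Cauchy integral along the boundary
  of a sector of half-angle theta, with gamma < theta < pi/2, expresses lambda times this kernel,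
  evaluated at -Delta_h, through a single resolvent; hence the bounds are linear in M_h.
  The energy identity of the dG step gives |r(z)| <= 1/(1 + c|z|) for its stability function r in the sector.
  As neighbouring steps are comparable, the product of the factors between t_(l-1) and t_m
  decays like (1 + (t_m - t_(l-1))|z|)^-2, which bounds the kernel by k_l / (t_m - t_(l-1)).
  Its row and column sums are at most 1 + ln (T/k_min) <= C ln (T/k), and Schur's test yields all exponents s.
*)
theory Submission
  imports Defs "HOL-Complex_Analysis.Complex_Analysis"
    "HOL-Computational_Algebra.Fundamental_Theorem_Algebra"
begin

section \<open>The dG step on the reference interval\<close>

text \<open>The norm on the discrete space is arbitrary: nothing is known about it but the resolvent
  estimate. Bounding each step as an operator and multiplying would give a power of
  \<open>Mh\<close> growing with the number of steps, so all products are formed as scalar functions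
  on the sector and only their final decay meets the resolvent. Second-order decay is exactly what
  closes the argument: the factor \<lambda> becomes |z| on the ray and cancels the 1/|z| of the
  resolvent, and the integral of (1 + a|z|)^-2 along the ray is at most 1/a. The same factor lets
  the contour pass through the origin even if 0 is an eigenvalue. Within a single step there is only
  one factor, of order 1/|z|, and the integral would diverge; its leading part R/(1 + z) is split
  off and amounts to the resolvent at one negative real point. The time derivative and the jumps
  require no contour: solving the step equation at z = 0 expresses them through the source and
  \<lambda> times the solution. Additive constants can be absorbed because the resolvent estimate
  itself forces \<open>Mh\<close> >= 1/2 on a nonzero space, and k <= T/4 forces ln(T/k) >=
  1.\<close>

lemma linear_dependence:
  fixes a :: "'i \<Rightarrow> 'j \<Rightarrow> 'k::field"
  assumes "finite J" "finite I" "card J < card I"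
  shows "\<exists>c. (\<exists>i\<in>I. c i \<noteq> 0) \<and> (\<forall>j\<in>J. (\<Sum>i\<in>I. c i * a i j) = 0)"
  using assms
proof (induction J arbitrary: I a rule: finite_induct)
  case empty
  then obtain i where "i \<in> I" by fastforce
  then show ?case by (intro exI[of _ "\<lambda>_. 1"]) auto
next
  case (insert j J)
  show ?case
  proof (cases "\<forall>i\<in>I. a i j = 0")
    case True
    have "card J < card I" using insert by simp
    from insert.IH[OF \<open>finite I\<close> this, of a] obtain c where
      c: "\<exists>i\<in>I. c i \<noteq> 0" "\<forall>j\<in>J. (\<Sum>i\<in>I. c i * a i j) = 0" by blast
    with True show ?thesis by (intro exI[of _ c]) auto
  next
    case False
    then obtain p where p: "p \<in> I" "a p j \<noteq> 0" by blast
    define I' where "I' = I - {p}"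
    have I: "I = insert p I'" "p \<notin> I'" "finite I'" using p insert.prems by (auto simp: I'_def)
    have "card J < card I'" using insert I by simp
    from insert.IH[OF \<open>finite I'\<close> this, of "\<lambda>i l. a i l - a i j / a p j * a p l"] obtain c where
      c: "\<exists>i\<in>I'. c i \<noteq> 0"
        "\<forall>l\<in>J. (\<Sum>i\<in>I'. c i * (a i l - a i j / a p j * a p l)) = 0" by blast
    \<comment> \<open>Back substitution: column j was eliminated with the pivot
      \<open>a p j\<close>, and the coefficient at p is chosen so that the relation also holds in
      column j.\<close>
    define d where "d = c(p := - (\<Sum>i\<in>I'. c i * a i j) / a p j)"
    have sum_d: "(\<Sum>i\<in>I. d i * a i l) = (\<Sum>i\<in>I'. c i * (a i l - a i j / a p j * a p l))" for l
    proof -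
      have "(\<Sum>i\<in>I. d i * a i l) = d p * a p l + (\<Sum>i\<in>I'. d i * a i l)"
        using I by simp
      also have "(\<Sum>i\<in>I'. d i * a i l) = (\<Sum>i\<in>I'. c i * a i l)"
        using I by (intro sum.cong) (auto simp: d_def)
      also have "d p * a p l = (\<Sum>i\<in>I'. - (c i * (a i j / a p j * a p l)))"
      proof -
        have "(\<Sum>i\<in>I'. c i * (a i j / a p j * a p l)) = (\<Sum>i\<in>I'. c i * a i j) * (a p l / a p j)"
          unfolding sum_distrib_right by (intro sum.cong) auto
        then show ?thesis by (simp add: d_def sum_negf)
      qed
      finally show ?thesis by (simp add: sum.distrib[symmetric] algebra_simps)
    qed
    have "(\<Sum>i\<in>I. d i * a i l) = 0" if "l \<in> insert j J" for l
      using that c(2) p unfolding sum_d by auto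
    moreover have "\<exists>i\<in>I. d i \<noteq> 0" using c(1) I by (auto simp: d_def)
    ultimately show ?thesis by blast
  qed
qed

text \<open>Matrices are functions of indices because the size q + 1 is a variable. The q + 1
  columns and the l-th unit vector are q + 2 vectors with q + 1 entries, hence dependent;
  injectivity makes the coefficient of the unit vector nonzero, so that vector lies in the column
  span.\<close>

lemma right_inverse_exists:
  fixes B :: "nat \<Rightarrow> nat \<Rightarrow> 'k::field"
  assumes inj: "\<And>Y. (\<And>i. i \<le> q \<Longrightarrow> (\<Sum>j\<le>q. B i j * Y j) = 0) \<Longrightarrow> \<forall>j\<le>q. Y j = 0"
  shows "\<exists>S. \<forall>i\<le>q. \<forall>l\<le>q. (\<Sum>j\<le>q. B i j * S j l) = (if i = l then 1 else 0)"
proof -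
  have "\<exists>Y. \<forall>i\<le>q. (\<Sum>j\<le>q. B i j * Y j) = (if i = l then 1 else 0)" if "l \<le> q" for l
  proof -
    let ?a = "\<lambda>j i. if j \<le> q then B i j else if i = l then 1 else 0"
    obtain c where c: "\<exists>j\<in>{..Suc q}. c j \<noteq> 0"
      "\<forall>i\<in>{..q}. (\<Sum>j\<in>{..Suc q}. c j * ?a j i) = 0"
      using linear_dependence[of "{..q}" "{..Suc q}" ?a] by auto
    have eq: "(\<Sum>j\<le>q. B i j * c j) = - c (Suc q) * (if i = l then 1 else 0)" if "i \<le> q" for i
    proof -
      have "0 = (\<Sum>j\<in>{..Suc q}. c j * ?a j i)" using c(2) that by auto
      also have "\<dots> = (\<Sum>j\<le>q. c j * ?a j i) + c (Suc q) * (if i = l then 1 else 0)" by simp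
      also have "(\<Sum>j\<le>q. c j * ?a j i) = (\<Sum>j\<le>q. B i j * c j)"
        by (intro sum.cong) (auto simp: mult.commute)
      finally show ?thesis by (simp add: eq_neg_iff_add_eq_0)
    qed
    have nz: "c (Suc q) \<noteq> 0"
    proof
      assume z: "c (Suc q) = 0"
      then have "\<forall>j\<le>q. c j = 0" by (intro inj) (simp add: eq)
      with z c(1) show False by (auto simp: le_Suc_eq)
    qed
    show ?thesis
    proof (intro exI[of _ "\<lambda>j. - c j / c (Suc q)"] allI impI)
      fix i assume i: "i \<le> q"
      have "(\<Sum>j\<le>q. B i j * (- c j / c (Suc q))) = - (\<Sum>j\<le>q. B i j * c j) / c (Suc q)"
        unfolding sum_negf[symmetric] sum_divide_distrib by (intro sum.cong) simp_all
      then show "(\<Sum>j\<le>q. B i j * (- c j / c (Suc q))) = (if i = l then 1 else 0)"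
        using eq[OF i] nz by auto
    qed
  qed
  then have "\<forall>l. \<exists>Y. l \<le> q \<longrightarrow> (\<forall>i\<le>q. (\<Sum>j\<le>q. B i j * Y j) = (if i = l then 1 else 0))"
    by blast
  from choice[OF this] obtain Y where
    "\<forall>l. l \<le> q \<longrightarrow> (\<forall>i\<le>q. (\<Sum>j\<le>q. B i j * Y l j) = (if i = l then 1 else 0))" ..
  then show ?thesis by (intro exI[of _ "\<lambda>j l. Y l j"]) simp
qed

text \<open>In the basis 1, t, ..., t^q of polynomials on the reference interval, refD is the matrix of
  (y', v) + y(0) v(0) and refH the mass matrix, so refB z is the dG step for y' + z y.\<close>
definition refD :: "nat \<Rightarrow> nat \<Rightarrow> real" where
  "refD i j = (if i = 0 \<and> j = 0 then 1 else real j / real (i + j))"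

definition refH :: "nat \<Rightarrow> nat \<Rightarrow> real" where
  "refH i j = 1 / real (i + j + 1)"

definition refB :: "complex \<Rightarrow> nat \<Rightarrow> nat \<Rightarrow> complex" where
  "refB z i j = of_real (refD i j) + z * of_real (refH i j)"

text \<open>The squared L2 norm on [0,1] of the polynomial with coefficients \<open>Y\<close>,
  written as a finite sum so that the energy identity becomes pure algebra.\<close>

definition massq :: "nat \<Rightarrow> (nat \<Rightarrow> complex) \<Rightarrow> real" where
  "massq q Y = (\<Sum>i\<le>q. \<Sum>j\<le>q. Re (cnj (Y i) * Y j) * refH i j)"

section \<open>Mass matrix and coercivity\<close>

lemma has_integral_monomial: "((\<lambda>t. t ^ n) has_integral 1 / real (n + 1)) {0..1::real}"
proof -
  have "((\<lambda>t. t ^ (n+1) / real (n+1)) has_real_derivative t ^ n) (at t within {0..1})" for t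
    using DERIV_cdivide[OF DERIV_pow[of "n+1" t "{0..1}"], of "real (n+1)"] by simp
  then have "((\<lambda>t::real. t ^ n) has_integral (1 ^ (n+1) / real (n+1) - 0 ^ (n+1) / real (n+1))) {0..1}"
    by (intro fundamental_theorem_of_calculus)
       (auto simp: has_real_derivative_iff_has_vector_derivative[symmetric])
  then show ?thesis by simp
qed

lemma cmod_poly_sq:
  "(cmod (\<Sum>i\<le>q. Y i * of_real (t ^ i)))\<^sup>2
     = (\<Sum>i\<le>q. \<Sum>j\<le>q. Re (cnj (Y i) * Y j) * t ^ (i + j))"
proof -
  let ?y = "\<Sum>i\<le>q. Y i * of_real (t ^ i)"
  have "(cmod ?y)\<^sup>2 = Re (cnj ?y * ?y)" 
    by (metis complex_norm_square Re_complex_of_real mult.commute)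
  also have "cnj ?y * ?y = (\<Sum>i\<le>q. \<Sum>j\<le>q. cnj (Y i) * Y j * of_real (t ^ (i + j)))"
    unfolding cnj_sum sum_product by (intro sum.cong refl) (simp add: power_add mult_ac)
  finally show ?thesis by simp
qed

lemma massq_has_integral:
  "((\<lambda>t. (cmod (\<Sum>i\<le>q. Y i * of_real (t ^ i)))\<^sup>2) has_integral massq q Y) {0..1}"
  unfolding cmod_poly_sq massq_def refH_def
  by (intro has_integral_sum finite_atMost has_integral_mult_right has_integral_monomial)

lemma massq_nonneg: "0 \<le> massq q Y"
  by (rule has_integral_nonneg[OF massq_has_integral]) auto

lemma cmod_diff_sq: "(cmod (u - v))\<^sup>2 = (cmod u)\<^sup>2 - 2 * Re (cnj v * u) + (cmod v)\<^sup>2"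
  by (simp only: cmod_power2) (simp add: power2_eq_square algebra_simps)

text \<open>Integrating |y - m t^l|^2 >= 0 with m the l-th moment of y gives 2|m|^2 - |m|^2/(2l + 1)
  <= \<open>massq q Y\<close>, and 1/(2l + 1) <= 1.\<close>

lemma moment_le_massq:
  assumes "l \<le> q"
  shows "(cmod (\<Sum>j\<le>q. of_real (refH l j) * Y j))\<^sup>2 \<le> massq q Y"
proof -
  define m where "m = (\<Sum>j\<le>q. of_real (refH l j) * Y j)"
  let ?y = "\<lambda>t. \<Sum>i\<le>q. Y i * of_real (t ^ i)"
  let ?w = "\<lambda>t::real. 2 * (\<Sum>j\<le>q. Re (cnj m * Y j) * t ^ (l + j)) - (cmod m)\<^sup>2 * t ^ (l + l)"
  have "(?w has_integral (2 * (\<Sum>j\<le>q. Re (cnj m * Y j) * (1 / real (l + j + 1)))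
            - (cmod m)\<^sup>2 * (1 / real (l + l + 1)))) {0..1}"
    by (intro has_integral_sum finite_atMost has_integral_mult_right has_integral_monomial
        has_integral_diff)
  moreover have "?w t \<le> (cmod (?y t))\<^sup>2" for t
  proof -
    have "0 \<le> (cmod (?y t - m * of_real (t ^ l)))\<^sup>2" by simp
    also have "\<dots> = (cmod (?y t))\<^sup>2 - 2 * Re (cnj (m * of_real (t ^ l)) * ?y t) + (cmod (m * of_real (t ^ l)))\<^sup>2"
      by (rule cmod_diff_sq)
    also have "cnj (m * of_real (t ^ l)) * ?y t = (\<Sum>j\<le>q. (cnj m * Y j) * of_real (t ^ (l + j)))"
      unfolding sum_distrib_left complex_cnj_mult
      by (intro sum.cong refl) (simp add: power_add mult_ac)
    also have "Re \<dots> = (\<Sum>j\<le>q. Re (cnj m * Y j) * t ^ (l + j))" by simp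
    also have "(cmod (m * of_real (t ^ l)))\<^sup>2 = (cmod m)\<^sup>2 * t ^ (l + l)"
      by (simp add: norm_mult power_mult_distrib power_add power2_eq_square norm_power)
         (simp add: power_mult_distrib[symmetric] abs_mult_self_eq)
    finally show ?thesis by simp
  qed
  ultimately have le: "2 * (\<Sum>j\<le>q. Re (cnj m * Y j) * (1 / real (l + j + 1)))
            - (cmod m)\<^sup>2 * (1 / real (l + l + 1)) \<le> massq q Y"
    by (intro has_integral_le[OF _ massq_has_integral]) auto
  have "(\<Sum>j\<le>q. Re (cnj m * Y j) * (1 / real (l + j + 1))) = Re (cnj m * m)"
    unfolding sum_distrib_left[of "cnj m"] Re_sum m_def[symmetric]
    by (subst m_def, unfold sum_distrib_left Re_sum, intro sum.cong refl) (simp add: refH_def algebra_simps add_divide_distrib)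
  also have "\<dots> = (cmod m)\<^sup>2"
    by (metis complex_norm_square Re_complex_of_real mult.commute)
  finally have "2 * (cmod m)\<^sup>2 - (cmod m)\<^sup>2 * (1 / real (l + l + 1)) \<le> massq q Y"
    using le by simp
  moreover have "(cmod m)\<^sup>2 * (1 / real (l + l + 1)) \<le> (cmod m)\<^sup>2 * 1"
    by (intro mult_left_mono) auto
  ultimately show ?thesis unfolding m_def by linarith
qed

text \<open>A continuous nonnegative integrand with integral 0 vanishes, so the polynomial has all
  of [0,1] among its roots.\<close>

lemma massq_zero:
  assumes "massq q Y = 0" shows "\<forall>j\<le>q. Y j = 0"
proof -
  let ?f = "\<lambda>t. (cmod (\<Sum>i\<le>q. Y i * of_real (t ^ i)))\<^sup>2"
  have "(?f has_integral 0) (cbox 0 1)" using massq_has_integral[of Y q] assms by simp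
  moreover have "continuous_on (cbox 0 1) ?f" by (intro continuous_intros)
  ultimately have "?f t = 0" if "t \<in> {0..1}" for t
    using has_integral_0_cbox_imp_0[of 0 1 ?f t] that by auto
  then have "(\<Sum>i\<le>q. Y i * of_real t ^ i) = 0" if "t \<in> {0..1}" for t :: real
    using that by auto
  then have "complex_of_real ` {0..1} \<subseteq> {x. (\<Sum>i\<le>q. Y i * x ^ i) = 0}" by auto
  moreover have "infinite (complex_of_real ` {0..1})"
    by (subst finite_image_iff) (auto intro: inj_onI)
  ultimately have "infinite {x. (\<Sum>i\<le>q. Y i * x ^ i) = 0}" using finite_subset by blast
  then show ?thesis using polyfun_finite_roots[of Y q] by blast
qed

lemma refH_inj:
  assumes "\<And>i. i \<le> q \<Longrightarrow> (\<Sum>j\<le>q. complex_of_real (refH i j) * Y j) = 0"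
  shows "\<forall>j\<le>q. Y j = 0"
proof -
  have "massq q Y = (\<Sum>i\<le>q. Re (cnj (Y i) * (\<Sum>j\<le>q. complex_of_real (refH i j) * Y j)))"
    unfolding massq_def sum_distrib_left Re_sum
    by (intro sum.cong refl) (simp add: algebra_simps)
  also have "\<dots> = 0" using assms by simp
  finally show ?thesis by (rule massq_zero)
qed

text \<open>Norm equivalence without a compactness argument: the coefficients are recovered from the
  moments by the inverse of the mass matrix, and each moment is controlled by
  \<open>moment_le_massq\<close>.\<close>

lemma massq_coercive: "\<exists>C>0. \<forall>Y. \<forall>j\<le>q. (cmod (Y j))\<^sup>2 \<le> C * massq q Y"
proof -
  from right_inverse_exists[of q "\<lambda>i j. complex_of_real (refH i j)", OF refH_inj]
  obtain S where S: "\<forall>i\<le>q. \<forall>l\<le>q. (\<Sum>j\<le>q. complex_of_real (refH i j) * S j l) = (if i = l then 1 else 0)"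
    by blast
  define K where "K = (\<Sum>i\<le>q. \<Sum>j\<le>q. cmod (S i j))"
  have K0: "0 \<le> K" unfolding K_def by (intro sum_nonneg) auto
  have "(cmod (Y j))\<^sup>2 \<le> (1 + K\<^sup>2) * massq q Y" if j: "j \<le> q" for Y j
  proof -
    define m where "m i = (\<Sum>j\<le>q. of_real (refH i j) * Y j)" for i
    define Z where "Z j = Y j - (\<Sum>l\<le>q. S j l * m l)" for j
    have "(\<Sum>j\<le>q. complex_of_real (refH i j) * Z j) = 0" if i: "i \<le> q" for i
    proof -
      have "(\<Sum>j\<le>q. complex_of_real (refH i j) * (\<Sum>l\<le>q. S j l * m l))
          = (\<Sum>l\<le>q. (\<Sum>j\<le>q. complex_of_real (refH i j) * S j l) * m l)"
        unfolding sum_distrib_left sum_distrib_right by (subst sum.swap) (simp add: mult_ac)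
      also have "\<dots> = (\<Sum>l\<le>q. if i = l then m l else 0)" using S i by (intro sum.cong) auto
      also have "\<dots> = m i" using i by simp
      finally show ?thesis by (simp add: Z_def algebra_simps sum_subtractf m_def)
    qed
    then have "Z j = 0" using refH_inj[of q Z] j by blast
    then have "cmod (Y j) \<le> (\<Sum>l\<le>q. cmod (S j l) * cmod (m l))"
      by (simp add: Z_def) (metis (no_types, lifting) norm_mult norm_sum sum.cong)
    also have "\<dots> \<le> (\<Sum>l\<le>q. cmod (S j l) * sqrt (massq q Y))"
      by (intro sum_mono mult_left_mono) (use moment_le_massq in \<open>auto simp: m_def intro!: real_le_rsqrt\<close>)
    also have "\<dots> \<le> K * sqrt (massq q Y)"
      unfolding sum_distrib_right[symmetric] K_def
      using j by (intro mult_right_mono member_le_sum[of j "{..q}" "\<lambda>i. \<Sum>j\<le>q. cmod (S i j)"])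
         (auto intro: sum_nonneg simp: massq_nonneg)
    finally have "(cmod (Y j))\<^sup>2 \<le> (K * sqrt (massq q Y))\<^sup>2" by (intro power_mono) auto
    also have "\<dots> = K\<^sup>2 * massq q Y" by (simp add: power_mult_distrib massq_nonneg)
    also have "\<dots> \<le> (1 + K\<^sup>2) * massq q Y" by (intro mult_right_mono) (auto simp: massq_nonneg)
    finally show ?thesis .
  qed
  then show ?thesis by (intro exI[of _ "1 + K\<^sup>2"]) (auto simp: add_pos_nonneg)
qed

section \<open>Energy identity of the dG step\<close>

lemma cnj_fixed: "cnj s = s \<Longrightarrow> s = of_real (Re s)"
  by (simp add: complex_eq_iff)

lemma sum_refD_energy:
  "Re (\<Sum>i\<le>q. \<Sum>j\<le>q. of_real (refD i j) * (cnj (Y i) * Y j))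
     = (cmod (Y 0))\<^sup>2 / 2 + (cmod (\<Sum>j\<le>q. Y j))\<^sup>2 / 2"
proof -
  let ?R = "\<lambda>i j. Re (cnj (Y i) * Y j)"
  have sym: "?R i j = ?R j i" for i j by simp
  have "Re (\<Sum>i\<le>q. \<Sum>j\<le>q. of_real (refD i j) * (cnj (Y i) * Y j)) = (\<Sum>i\<le>q. \<Sum>j\<le>q. refD i j * ?R i j)"
    unfolding Re_sum by (intro sum.cong refl) simp
  moreover have "(\<Sum>i\<le>q. \<Sum>j\<le>q. refD i j * ?R i j) = (\<Sum>i\<le>q. \<Sum>j\<le>q. refD j i * ?R i j)"
    by (subst sum.swap) (simp add: sym[symmetric] mult_ac)
  ultimately have "2 * Re (\<Sum>i\<le>q. \<Sum>j\<le>q. of_real (refD i j) * (cnj (Y i) * Y j))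
      = (\<Sum>i\<le>q. \<Sum>j\<le>q. (refD i j + refD j i) * ?R i j)"
    by (simp add: distrib_right sum.distrib)
  also have "\<dots> = (\<Sum>i\<le>q. \<Sum>j\<le>q. ?R i j + (if i = 0 then if j = 0 then ?R 0 0 else 0 else 0))"
  proof (intro sum.cong refl)
    fix i j
    show "(refD i j + refD j i) * ?R i j = ?R i j + (if i = 0 then if j = 0 then ?R 0 0 else 0 else 0)"
    proof (cases "i = 0 \<and> j = 0")
      case False
      then have "refD i j + refD j i = 1"
        by (auto simp: refD_def add_divide_distrib[symmetric] add.commute)
      with False show ?thesis by auto
    qed (auto simp: refD_def)
  qed
  also have "\<dots> = (\<Sum>i\<le>q. \<Sum>j\<le>q. ?R i j) + ?R 0 0"
  proof -
    have "(\<Sum>i\<le>q. \<Sum>j\<le>q. if i = 0 then if j = 0 then ?R 0 0 else 0 else 0)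
       = (\<Sum>i\<le>q. if i = 0 then ?R 0 0 else 0)"
      by (intro sum.cong refl) (auto simp: sum.delta)
    then show ?thesis by (simp add: sum.distrib sum.delta)
  qed
  also have "(\<Sum>i\<le>q. \<Sum>j\<le>q. ?R i j) = (cmod (\<Sum>j\<le>q. Y j))\<^sup>2"
    using cmod_poly_sq[of Y 1 q] by simp
  also have "?R 0 0 = (cmod (Y 0))\<^sup>2"
    by (simp only: cmod_power2) (simp add: power2_eq_square)
  finally show ?thesis by simp
qed

text \<open>The matrix refD symmetrises to (all ones + unit at (0, 0)) / 2, so the first-order terms
  contribute only boundary values.\<close>
lemma refB_energy:
  "Re (\<Sum>i\<le>q. cnj (Y i) * (\<Sum>j\<le>q. refB z i j * Y j))
     = (cmod (Y 0))\<^sup>2 / 2 + (cmod (\<Sum>j\<le>q. Y j))\<^sup>2 / 2 + Re z * massq q Y"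
proof -
  have im: "(\<Sum>i\<le>q. \<Sum>j\<le>q. of_real (refH i j) * (cnj (Y i) * Y j)) = of_real (massq q Y)"
  proof -
    let ?s = "\<Sum>i\<le>q. \<Sum>j\<le>q. of_real (refH i j) * (cnj (Y i) * Y j)"
    have "cnj ?s = (\<Sum>i\<le>q. \<Sum>j\<le>q. of_real (refH j i) * (cnj (Y j) * Y i))"
      by (simp add: refH_def add_ac mult_ac)
    also have "\<dots> = ?s" by (subst sum.swap) simp
    finally have "?s = of_real (Re ?s)"
      by (rule cnj_fixed)
    also have "Re ?s = massq q Y"
      unfolding massq_def Re_sum by (intro sum.cong refl) (simp add: algebra_simps)
    finally show ?thesis .
  qed
  have "(\<Sum>i\<le>q. cnj (Y i) * (\<Sum>j\<le>q. refB z i j * Y j))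
     = (\<Sum>i\<le>q. \<Sum>j\<le>q. of_real (refD i j) * (cnj (Y i) * Y j))
       + z * (\<Sum>i\<le>q. \<Sum>j\<le>q. of_real (refH i j) * (cnj (Y i) * Y j))"
    unfolding sum_distrib_left sum.distrib[symmetric]
    by (intro sum.cong refl) (simp add: refB_def algebra_simps)
  then have "Re (\<Sum>i\<le>q. cnj (Y i) * (\<Sum>j\<le>q. refB z i j * Y j))
     = Re (\<Sum>i\<le>q. \<Sum>j\<le>q. of_real (refD i j) * (cnj (Y i) * Y j)) + Re (z * of_real (massq q Y))"
    by (simp only: im plus_complex.sel)
  also have "Re (z * of_real (massq q Y)) = Re z * massq q Y" by simp
  finally show ?thesis unfolding sum_refD_energy .
qed

section \<open>Solution operator of one step on the sector\<close>

text \<open>For \<delta> = cos \<theta> this is the closed sector of half-angle \<theta>, origin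
  included; the algebraic form avoids \<open>Arg\<close> and makes convexity and scaling
  immediate.\<close>

definition wedge :: "real \<Rightarrow> complex set" where
  "wedge \<delta> = {z. \<delta> * cmod z \<le> Re z}"

text \<open>The inverse of the step matrix \<open>refB z\<close>, obtained without determinants; on
  the sector \<open>refS_unique\<close> shows that its entries up to index q do not depend on the
  choice.\<close>

definition refS :: "nat \<Rightarrow> complex \<Rightarrow> nat \<Rightarrow> nat \<Rightarrow> complex" where
  "refS q z = (SOME S. \<forall>i\<le>q. \<forall>l\<le>q. (\<Sum>j\<le>q. refB z i j * S j l) = (if i = l then 1 else 0))"

lemma wedge_Re_nonneg: "0 < \<delta> \<Longrightarrow> z \<in> wedge \<delta> \<Longrightarrow> 0 \<le> Re z"
  unfolding wedge_def mem_Collect_eq by (smt (verit) mult_nonneg_nonneg norm_ge_zero)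

lemma wedge_Re_pos: "0 < \<delta> \<Longrightarrow> z \<in> wedge \<delta> \<Longrightarrow> z \<noteq> 0 \<Longrightarrow> 0 < Re z"
  unfolding wedge_def mem_Collect_eq by (smt (verit) mult_pos_pos zero_less_norm_iff)

lemma zero_in_wedge [simp]: "0 \<in> wedge \<delta>" by (simp add: wedge_def)

text \<open>The energy identity forces y(0) = 0 and Re z times the mass to vanish, which settles z
  \<noteq> 0. At z = 0 the mass term is lost; there the equation says that y' is orthogonal to all
  polynomials of degree below q, among which it lies itself.\<close>

lemma refB_inj:
  assumes \<delta>: "0 < \<delta>" "z \<in> wedge \<delta>"
    and B: "\<And>i. i \<le> q \<Longrightarrow> (\<Sum>j\<le>q. refB z i j * Y j) = 0"
  shows "\<forall>j\<le>q. Y j = 0"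
proof -
  have "(cmod (Y 0))\<^sup>2 / 2 + (cmod (\<Sum>j\<le>q. Y j))\<^sup>2 / 2 + Re z * massq q Y = 0"
    unfolding refB_energy[symmetric] using B by simp
  moreover have "0 \<le> Re z * massq q Y"
    using wedge_Re_nonneg[OF \<delta>] massq_nonneg by (intro mult_nonneg_nonneg)
  ultimately have 0: "(cmod (Y 0))\<^sup>2 = 0" "Re z * massq q Y = 0"
    using zero_le_power2[of "cmod (Y 0)"] zero_le_power2[of "cmod (\<Sum>j\<le>q. Y j)"] by linarith+
  show ?thesis
  proof (cases "z = 0")
    case False
    with wedge_Re_pos[OF \<delta>] 0(2) show ?thesis using massq_zero by auto
  next
    case True
    have Y0: "Y 0 = 0" using 0 by simp
    show ?thesis
    proof (cases q)
      case (Suc p)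
      \<comment> \<open>At z = 0 the entry in column j + 1 is (j + 1)/(i + j + 1), so the
        coefficients of y' solve the homogeneous mass system of size p + 1.\<close>
      have "(\<Sum>j\<le>p. complex_of_real (refH i j) * (of_nat (Suc j) * Y (Suc j))) = 0" if "i \<le> p" for i
      proof -
        have "0 = (\<Sum>j\<le>Suc p. refB z i j * Y j)" using B that Suc by simp
        also have "\<dots> = (\<Sum>j\<le>p. refB z i (Suc j) * Y (Suc j))"
          by (simp add: sum.atMost_Suc_shift Y0 del: sum.atMost_Suc)
        also have "\<dots> = (\<Sum>j\<le>p. complex_of_real (refH i j) * (of_nat (Suc j) * Y (Suc j)))"
          by (intro sum.cong refl) (simp add: refB_def refD_def refH_def True del: of_nat_Suc)
        finally show ?thesis by simp
      qed
      from refH_inj[OF this] have "\<forall>j\<le>p. Y (Suc j) = 0" by (simp del: of_nat_Suc)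
      with Y0 have "Y j = 0" if "j \<le> q" for j using that Suc by (cases j) simp_all
      then show ?thesis by blast
    qed (simp add: Y0)
  qed
qed

lemma sum_mat_vec:
  fixes a :: "'i \<Rightarrow> 'k::comm_semiring_0"
  shows "(\<Sum>j\<in>J. a j * (\<Sum>l\<in>L. S j l * m l)) = (\<Sum>l\<in>L. (\<Sum>j\<in>J. a j * S j l) * m l)"
  unfolding sum_distrib_left sum_distrib_right by (subst sum.swap) (simp add: mult.assoc)

lemma refS_right:
  assumes "0 < \<delta>" "z \<in> wedge \<delta>" "i \<le> q" "l \<le> q"
  shows "(\<Sum>j\<le>q. refB z i j * refS q z j l) = (if i = l then 1 else 0)"
proof -
  from right_inverse_exists[of q "refB z", OF refB_inj[OF assms(1,2)]]
  have "\<forall>i\<le>q. \<forall>l\<le>q. (\<Sum>j\<le>q. refB z i j * refS q z j l) = (if i = l then 1 else 0)"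
    unfolding refS_def by (rule someI_ex)
  with assms show ?thesis by blast
qed

lemma refS_solves:
  assumes "0 < \<delta>" "z \<in> wedge \<delta>" "i \<le> q"
  shows "(\<Sum>j\<le>q. refB z i j * (\<Sum>l\<le>q. refS q z j l * E l)) = E i"
proof -
  have "(\<Sum>j\<le>q. refB z i j * (\<Sum>l\<le>q. refS q z j l * E l))
      = (\<Sum>l\<le>q. (\<Sum>j\<le>q. refB z i j * refS q z j l) * E l)"
    by (rule sum_mat_vec)
  also have "\<dots> = (\<Sum>l\<le>q. if i = l then E l else 0)"
    using refS_right[OF assms] by (intro sum.cong) auto
  finally show ?thesis using assms by simp
qed

lemma refS_unique:
  assumes "0 < \<delta>" "z \<in> wedge \<delta>"
    and "\<And>i. i \<le> q \<Longrightarrow> (\<Sum>j\<le>q. refB z i j * Y j) = E i" "j \<le> q"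
  shows "Y j = (\<Sum>l\<le>q. refS q z j l * E l)"
proof -
  have "\<forall>j\<le>q. Y j - (\<Sum>l\<le>q. refS q z j l * E l) = 0"
  proof (rule refB_inj[OF assms(1,2)])
    fix i assume "i \<le> q"
    then show "(\<Sum>j\<le>q. refB z i j * (Y j - (\<Sum>l\<le>q. refS q z j l * E l))) = 0"
      using assms(3) refS_solves[OF assms(1,2)] by (simp add: right_diff_distrib sum_subtractf)
  qed
  with \<open>j \<le> q\<close> show ?thesis by simp
qed

text \<open>Energy identity for the response to the l-th unit load: the right side is a single
  diagonal entry, to be bounded later by the mass or, for l = 0, by y(0).\<close>

lemma refS_energy:
  assumes "0 < \<delta>" "z \<in> wedge \<delta>" "l \<le> q"
  shows "(cmod (refS q z 0 l))\<^sup>2 / 2 + (cmod (\<Sum>j\<le>q. refS q z j l))\<^sup>2 / 2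
            + Re z * massq q (\<lambda>j. refS q z j l) = Re (refS q z l l)"
proof -
  have "(\<Sum>i\<le>q. cnj (refS q z i l) * (\<Sum>j\<le>q. refB z i j * refS q z j l))
      = (\<Sum>i\<le>q. if i = l then cnj (refS q z i l) else 0)"
    using refS_right[OF assms(1,2) _ assms(3)] by (intro sum.cong) auto
  also have "\<dots> = cnj (refS q z l l)" using assms by simp
  finally have eq: "(\<Sum>i\<le>q. cnj (refS q z i l) * (\<Sum>j\<le>q. refB z i j * refS q z j l)) = cnj (refS q z l l)" .
  show ?thesis using refB_energy[where Y="\<lambda>j. refS q z j l" and q=q and z=z] unfolding eq by simp
qed

text \<open>With a^2 = K times the mass, coercivity bounds all coefficients by a, while the energy
  identity bounds Re z times the mass by a. Hence a <= K / Re z, and Re z >= \<delta>|z| in the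
  sector.\<close>

lemma refS_bound_large:
  assumes "0 < \<delta>"
  shows "\<exists>C>0. \<forall>z\<in>wedge \<delta> - {0}. \<forall>j\<le>q. \<forall>l\<le>q. cmod (refS q z j l) \<le> C / cmod z"
proof -
  obtain K where K: "K > 0" "\<And>Y j. j \<le> q \<Longrightarrow> (cmod (Y j))\<^sup>2 \<le> K * massq q Y"
    using massq_coercive[of q] by blast
  have "cmod (refS q z j l) \<le> (K / \<delta>) / cmod z" if z: "z \<in> wedge \<delta> - {0}" and "j \<le> q" "l \<le> q" for z j l
  proof -
    let ?Y = "\<lambda>j. refS q z j l"
    define a where "a = sqrt (K * massq q ?Y)"
    have Y: "cmod (?Y j) \<le> a" if "j \<le> q" for j
      unfolding a_def using K(2)[OF that, of ?Y] by (intro real_le_rsqrt)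
    have a0: "0 \<le> a" using Y[of 0] norm_ge_zero order_trans by blast
    have a2: "a\<^sup>2 = K * massq q ?Y" using K massq_nonneg by (simp add: a_def)
    have Rz: "0 < Re z" using wedge_Re_pos assms z by auto
    have "Re z * massq q ?Y \<le> Re (?Y l)"
    proof -
      have "z \<in> wedge \<delta>" using z by simp
      from refS_energy[OF assms this \<open>l \<le> q\<close>] show ?thesis
        using zero_le_power2[of "cmod (?Y 0)"] zero_le_power2[of "cmod (\<Sum>j\<le>q. ?Y j)"] by linarith
    qed
    also have "\<dots> \<le> a" using Y[OF \<open>l \<le> q\<close>] complex_Re_le_cmod order_trans by blast
    finally have "Re z * a\<^sup>2 \<le> K * a" unfolding a2 using K(1) by (simp add: mult_left_mono mult.left_commute)
    then have "Re z * a \<le> K" using a0 K(1)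
      by (cases "a = 0") (auto simp: power2_eq_square mult.assoc[symmetric])
    moreover have "\<delta> * cmod z * a \<le> Re z * a" using z a0 by (intro mult_right_mono) (auto simp: wedge_def)
    ultimately have "a * (\<delta> * cmod z) \<le> K" by (simp add: mult_ac)
    then have "a \<le> K / (\<delta> * cmod z)" using assms z by (simp add: pos_le_divide_eq)
    then show ?thesis using Y[OF \<open>j \<le> q\<close>] by simp
  qed
  then show ?thesis using K assms by (intro exI[of _ "K / \<delta>"]) auto
qed

lemma abs_refH_le: "cmod (of_real (refH i j)) \<le> 1"
  unfolding norm_of_real by (simp add: refH_def)

text \<open>Perturbation from z = 0, a point of every sector: S(z) = S(0)(1 - z H S(z)), and for
  small |z| the last term is absorbed. This is why \<eta> and C precede \<delta>.\<close>

lemma refS_bound_small: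
  shows "\<exists>\<eta>>0. \<exists>C>0. \<forall>\<delta>>0. \<forall>z\<in>wedge \<delta>. cmod z \<le> \<eta> \<longrightarrow> (\<forall>j\<le>q. \<forall>l\<le>q. cmod (refS q z j l) \<le> C)"
proof -
  define K where "K = 1 + (\<Sum>j\<le>q. \<Sum>l\<le>q. cmod (refS q 0 j l))"
  have K1: "1 \<le> K" unfolding K_def by (auto intro!: sum_nonneg)
  have K: "cmod (refS q 0 j l) \<le> K" if "j \<le> q" "l \<le> q" for j l
  proof -
    have "cmod (refS q 0 j l) \<le> (\<Sum>l\<le>q. cmod (refS q 0 j l))"
      using that by (intro member_le_sum[where f="\<lambda>l. cmod (refS q 0 j l)"]) auto
    also have "\<dots> \<le> (\<Sum>j\<le>q. \<Sum>l\<le>q. cmod (refS q 0 j l))"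
      using that by (intro member_le_sum[where f="\<lambda>j. \<Sum>l\<le>q. cmod (refS q 0 j l)"]) (auto intro: sum_nonneg)
    finally show ?thesis by (simp add: K_def)
  qed
  define n where "n = real (q + 1)"
  have n: "1 \<le> n" by (simp add: n_def)
  \<comment> \<open>Makes n * n * K * \<eta> = 1/2: there are n coefficients to sum, each a sum over
    n entries of \<open>refS q 0\<close> of size at most K.\<close>
  define \<eta> where "\<eta> = 1 / (2 * n * n * K)"
  have "cmod (refS q z j l) \<le> 2 * n * K" if z: "0 < \<delta>" "z \<in> wedge \<delta>" "cmod z \<le> \<eta>" and "j \<le> q" "l \<le> q" for \<delta> z j l
  proof -
    let ?Y = "\<lambda>j. refS q z j l"
    define y where "y = (\<Sum>j\<le>q. cmod (?Y j))"
    have y0: "0 \<le> y" by (auto simp: y_def intro: sum_nonneg)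
    have Yy: "cmod (?Y j) \<le> y" if "j \<le> q" for j
      unfolding y_def using that by (intro member_le_sum[where f="\<lambda>j. cmod (?Y j)"]) auto
    let ?E = "\<lambda>i. (if i = l then 1 else 0) - z * (\<Sum>p\<le>q. of_real (refH i p) * ?Y p)"
    have BE: "(\<Sum>j\<le>q. refB 0 i j * ?Y j) = ?E i" if "i \<le> q" for i
    proof -
      have "(\<Sum>j\<le>q. refB 0 i j * ?Y j)
          = (\<Sum>j\<le>q. refB z i j * ?Y j) - z * (\<Sum>p\<le>q. of_real (refH i p) * ?Y p)"
        unfolding sum_distrib_left sum_subtractf[symmetric]
        by (intro sum.cong refl) (simp add: refB_def algebra_simps)
      then show ?thesis using refS_right[OF z(1,2) that \<open>l \<le> q\<close>] by simp
    qed
    have rep: "?Y j = (\<Sum>i\<le>q. refS q 0 j i * ?E i)" if "j \<le> q" for j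
      by (rule refS_unique[OF z(1) zero_in_wedge BE that])
    have HY: "cmod (z * (\<Sum>p\<le>q. of_real (refH i p) * ?Y p)) \<le> \<eta> * y" for i
    proof -
      have "cmod (\<Sum>p\<le>q. of_real (refH i p) * ?Y p) \<le> y"
        unfolding y_def by (rule sum_norm_le) (use abs_refH_le in \<open>auto simp only: norm_mult norm_ge_zero intro!: mult_left_le_one_le\<close>)
      then show ?thesis using z(3) unfolding norm_mult by (intro mult_mono) (auto intro: order_trans[OF norm_ge_zero])
    qed
    have "cmod (?Y j) \<le> K * (1 + n * (\<eta> * y))" if "j \<le> q" for j
    proof -
      have "cmod (?Y j) \<le> (\<Sum>i\<le>q. cmod (refS q 0 j i * ?E i))"
        by (subst rep[OF that]) (rule norm_sum)
      also have "\<dots> \<le> (\<Sum>i\<le>q. K * ((if i = l then 1 else 0) + \<eta> * y))"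
      proof (intro sum_mono)
        fix i assume "i \<in> {..q}"
        moreover have "cmod (?E i) \<le> (if i = l then 1 else 0) + \<eta> * y"
          by (rule order_trans[OF norm_triangle_ineq4]) (use HY[of i] in auto)
        ultimately show "cmod (refS q 0 j i * ?E i) \<le> K * ((if i = l then 1 else 0) + \<eta> * y)"
          unfolding norm_mult using K \<open>j \<le> q\<close> K1 by (intro mult_mono) auto
      qed
      also have "\<dots> = K * (1 + n * (\<eta> * y))"
        using \<open>l \<le> q\<close> unfolding sum_distrib_left[symmetric] by (simp add: sum.distrib n_def)
      finally show ?thesis .
    qed
    then have "y \<le> (\<Sum>j\<le>q. K * (1 + n * (\<eta> * y)))" unfolding y_def by (intro sum_mono) auto
    also have "\<dots> = n * K + (n * n * K * \<eta>) * y" by (simp add: n_def algebra_simps)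
    also have "n * n * K * \<eta> = 1 / 2" using n K1 by (simp add: \<eta>_def)
    finally have "y \<le> 2 * n * K" by simp
    with Yy[OF \<open>j \<le> q\<close>] show ?thesis by linarith
  qed
  moreover have "\<eta> > 0" "2 * n * K > 0" using n K1 by (auto simp: \<eta>_def)
  ultimately show ?thesis by blast
qed

lemma refS_bound:
  assumes "0 < \<delta>"
  shows "\<exists>C\<ge>1. \<forall>z\<in>wedge \<delta>. \<forall>j\<le>q. \<forall>l\<le>q. cmod (refS q z j l) \<le> C / (1 + cmod z)"
proof -
  obtain C1 where C1: "C1 > 0" "\<And>z j l. z \<in> wedge \<delta> - {0} \<Longrightarrow> j \<le> q \<Longrightarrow> l \<le> q \<Longrightarrow> cmod (refS q z j l) \<le> C1 / cmod z"
    using refS_bound_large[OF assms, of q] by blast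
  obtain \<eta> C2 where \<eta>: "\<eta> > 0" and C2: "C2 > 0"
    "\<And>z j l. z \<in> wedge \<delta> \<Longrightarrow> cmod z \<le> \<eta> \<Longrightarrow> j \<le> q \<Longrightarrow> l \<le> q \<Longrightarrow> cmod (refS q z j l) \<le> C2"
  proof -
    from refS_bound_small[of q] obtain \<eta> C2 where "\<eta> > 0" "C2 > 0" and
      "\<forall>\<delta>>0. \<forall>z\<in>wedge \<delta>. cmod z \<le> \<eta> \<longrightarrow> (\<forall>j\<le>q. \<forall>l\<le>q. cmod (refS q z j l) \<le> C2)"
      by metis
    with assms show thesis by (intro that[of \<eta> C2]) auto
  qed
  define C where "C = 1 + C1 * (1 + 1 / \<eta>) + C2 * (1 + \<eta>)"
  have "cmod (refS q z j l) \<le> C / (1 + cmod z)" if z: "z \<in> wedge \<delta>" "j \<le> q" "l \<le> q" for z j l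
  proof (cases "cmod z \<le> \<eta>")
    case True
    have "cmod (refS q z j l) * (1 + cmod z) \<le> C2 * (1 + \<eta>)"
      using C2 True z \<eta> by (intro mult_mono) auto
    also have "\<dots> \<le> C" using C1(1) \<eta> by (auto simp: C_def add_nonneg_nonneg)
    finally show ?thesis by (subst pos_le_divide_eq) (auto simp: add_pos_nonneg)
  next
    case False
    then have nz: "z \<noteq> 0" "0 < cmod z" using \<eta> by auto
    have "cmod (refS q z j l) * (1 + cmod z) \<le> C1 / cmod z * (1 + cmod z)"
      using C1(2)[of z j l] nz z by (intro mult_right_mono) auto
    also have "\<dots> = C1 * (1 + 1 / cmod z)" using nz by (simp add: field_simps)
    also have "\<dots> \<le> C1 * (1 + 1 / \<eta>)" using False \<eta> C1(1) nz(2) by (intro mult_left_mono add_left_mono divide_left_mono mult_pos_pos) auto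
    also have "\<dots> \<le> C" using C2(1) \<eta> by (auto simp: C_def add_nonneg_nonneg)
    finally show ?thesis by (subst pos_le_divide_eq) (auto simp: add_pos_nonneg)
  qed
  moreover have "C \<ge> 1" using C1(1) C2(1) \<eta> by (auto simp: C_def add_nonneg_nonneg)
  ultimately show ?thesis by blast
qed

text \<open>The resolvent identity of the pencil D + zH, S(w) - S(z) = (z - w) S(w) H S(z). It
  yields continuity and then the complex derivative -S(z) H S(z) without writing the entries as
  rational functions.\<close>

lemma refS_resolvent:
  assumes "0 < \<delta>" "z \<in> wedge \<delta>" "w \<in> wedge \<delta>" "j \<le> q" "l \<le> q"
  shows "refS q w j l - refS q z j l
    = (z - w) * (\<Sum>k\<le>q. refS q w j k * (\<Sum>p\<le>q. of_real (refH k p) * refS q z p l))"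
proof -
  have "refS q w j l - refS q z j l
      = (\<Sum>k\<le>q. refS q w j k * ((z - w) * (\<Sum>p\<le>q. of_real (refH k p) * refS q z p l)))"
  proof (rule refS_unique[OF assms(1,3) _ assms(4)])
    fix i assume i: "i \<le> q"
    have "(\<Sum>j\<le>q. refB w i j * (refS q w j l - refS q z j l))
        = (\<Sum>j\<le>q. refB w i j * refS q w j l) - (\<Sum>j\<le>q. refB z i j * refS q z j l)
          + (z - w) * (\<Sum>p\<le>q. of_real (refH i p) * refS q z p l)"
      unfolding sum_distrib_left sum_subtractf[symmetric] sum.distrib[symmetric]
      by (intro sum.cong refl) (simp add: refB_def algebra_simps)
    then show "(\<Sum>j\<le>q. refB w i j * (refS q w j l - refS q z j l))
        = (z - w) * (\<Sum>p\<le>q. of_real (refH i p) * refS q z p l)"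
      using refS_right[OF assms(1,2) i assms(5)] refS_right[OF assms(1,3) i assms(5)] by simp
  qed
  also have "\<dots> = (z - w) * (\<Sum>k\<le>q. refS q w j k * (\<Sum>p\<le>q. of_real (refH k p) * refS q z p l))"
    unfolding sum_distrib_left by (intro sum.cong refl) (simp add: mult_ac)
  finally show ?thesis .
qed

lemma refS_tendsto:
  assumes "0 < \<delta>" "z \<in> wedge \<delta>" "j \<le> q" "l \<le> q"
  shows "((\<lambda>w. refS q w j l) \<longlongrightarrow> refS q z j l) (at z within wedge \<delta>)"
proof -
  obtain C where C: "C \<ge> 1" "\<And>z j l. z \<in> wedge \<delta> \<Longrightarrow> j \<le> q \<Longrightarrow> l \<le> q \<Longrightarrow> cmod (refS q z j l) \<le> C / (1 + cmod z)"
    using refS_bound[OF assms(1), of q] by blast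
  have C': "cmod (refS q w k i) \<le> C" if "w \<in> wedge \<delta>" "k \<le> q" "i \<le> q" for w k i
  proof -
    have "C / (1 + cmod w) \<le> C / 1" using C(1) by (intro divide_left_mono) (auto simp: add_pos_nonneg)
    with C(2)[OF that] show ?thesis by simp
  qed
  define G where "G = (\<Sum>k\<le>q. C * (\<Sum>p\<le>q. cmod (refS q z p l)))"
  have "cmod (refS q w j l - refS q z j l) \<le> cmod (w - z) * G" if w: "w \<in> wedge \<delta>" for w
    unfolding refS_resolvent[OF assms(1,2) w assms(3,4)] norm_mult G_def
    unfolding norm_minus_commute[of z w]
  proof (intro mult_left_mono sum_norm_le)
    fix k assume "k \<in> {..q}"
    have "cmod (\<Sum>p\<le>q. of_real (refH k p) * refS q z p l) \<le> (\<Sum>p\<le>q. cmod (refS q z p l))"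
      by (rule sum_norm_le) (use abs_refH_le in \<open>auto simp only: norm_mult norm_ge_zero intro!: mult_left_le_one_le\<close>)
    then show "cmod (refS q w j k * (\<Sum>p\<le>q. of_real (refH k p) * refS q z p l)) \<le> C * (\<Sum>p\<le>q. cmod (refS q z p l))"
      unfolding norm_mult using C' w assms \<open>k \<in> _\<close> C(1) by (intro mult_mono) auto
  qed auto
  then have "\<forall>\<^sub>F w in at z within wedge \<delta>. norm (refS q w j l - refS q z j l) \<le> cmod (w - z) * G"
    by (auto simp: eventually_at intro: zero_less_one exI)
  moreover have "((\<lambda>w. cmod (w - z) * G) \<longlongrightarrow> 0) (at z within wedge \<delta>)"
    by (rule tendsto_eq_intros refl | simp)+
  ultimately have "((\<lambda>w. refS q w j l - refS q z j l) \<longlongrightarrow> 0) (at z within wedge \<delta>)"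
    by (rule Lim_null_comparison)
  then show ?thesis by (simp add: LIM_zero_iff)
qed

text \<open>On a closed set this means differentiability within the set, boundary included; the
  contour will run along that boundary.\<close>

lemma refS_holomorphic:
  assumes "0 < \<delta>" "j \<le> q" "l \<le> q"
  shows "(\<lambda>z. refS q z j l) holomorphic_on wedge \<delta>"
proof (rule holomorphic_onI)
  fix z assume z: "z \<in> wedge \<delta>"
  let ?F = "\<lambda>w. - (\<Sum>k\<le>q. refS q w j k * (\<Sum>p\<le>q. of_real (refH k p) * refS q z p l))"
  have "(?F \<longlongrightarrow> ?F z) (at z within wedge \<delta>)"
    by (intro tendsto_intros refS_tendsto assms z) auto
  moreover have "\<forall>\<^sub>F w in at z within wedge \<delta>. (refS q w j l - refS q z j l) / (w - z) = ?F w"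
    unfolding eventually_at
  proof (intro exI[of _ 1] conjI ballI impI)
    fix w assume "w \<in> wedge \<delta>" "w \<noteq> z \<and> dist w z < 1"
    then show "(refS q w j l - refS q z j l) / (w - z) = ?F w"
      using refS_resolvent[OF assms(1) z _ assms(2,3), of w] by (simp add: field_simps)
  qed auto
  ultimately have "((\<lambda>w. (refS q w j l - refS q z j l) / (w - z)) \<longlongrightarrow> ?F z) (at z within wedge \<delta>)"
    by (subst tendsto_cong)
  then show "(\<lambda>z. refS q z j l) field_differentiable at z within wedge \<delta>"
    unfolding field_differentiable_def has_field_derivative_iff by blast
qed

section \<open>Stability function and its leading behaviour at infinity\<close>

text \<open>The end value of the step for initial value 1 and no source: a polynomial at 1 is the
  sum of its coefficients, and the initial value enters only row 0.\<close>

definition refr :: "nat \<Rightarrow> complex \<Rightarrow> complex" where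
  "refr q z = (\<Sum>j\<le>q. refS q z j 0)"

text \<open>The numerator 1 is essential, since the bound is multiplied over arbitrarily many steps.
  For large |z| the decay of \<open>refS\<close> suffices. Otherwise the energy identity gives
  |r|^2/2 + Re z * mass <= 1/2 and the mass dominates |r|^2, so |r|^2 (1 + b|z|) <= 1; on a bounded
  set the square root costs only a constant.\<close>

lemma refr_bound:
  assumes "0 < \<delta>"
  shows "\<exists>c>0. \<forall>z\<in>wedge \<delta>. cmod (refr q z) \<le> 1 / (1 + c * cmod z)"
proof -
  obtain K where K: "K > 0" "\<And>Y j. j \<le> q \<Longrightarrow> (cmod (Y j))\<^sup>2 \<le> K * massq q Y"
    using massq_coercive[of q] by blast
  obtain C where C: "C \<ge> 1" "\<And>z j l. z \<in> wedge \<delta> \<Longrightarrow> j \<le> q \<Longrightarrow> l \<le> q \<Longrightarrow> cmod (refS q z j l) \<le> C / (1 + cmod z)"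
    using refS_bound[OF assms(1), of q] by blast
  define n where "n = real (q + 1)"
  have n: "1 \<le> n" by (simp add: n_def)
  define b where "b = 2 * \<delta> / (n\<^sup>2 * K)"
  define A where "A = n * C"
  have A: "1 \<le> A" using n C(1) mult_mono[of 1 n 1 C] by (simp add: A_def)
  have b: "0 < b" using assms n K by (simp add: b_def)
  \<comment> \<open>With both bounds, (1 + c|z|)^2 <= 1 + b|z| holds for |z| <= 2A; beyond that, c
    <= 1/(2A) gives A (1 + c|z|) <= 1 + |z|.\<close>
  define c where "c = min (b / 4) (1 / (2 * A))"
  have c: "0 < c" "c \<le> b / 4" "c \<le> 1 / (2 * A)" using A b by (auto simp: c_def)
  have "cmod (refr q z) \<le> 1 / (1 + c * cmod z)" if z: "z \<in> wedge \<delta>" for z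
  proof (cases "cmod z \<le> 2 * A")
    case True
    let ?Y = "\<lambda>j. refS q z j 0"
    have "cmod (refr q z) \<le> (\<Sum>j\<le>q. sqrt (K * massq q ?Y))"
      unfolding refr_def by (intro sum_norm_le real_le_rsqrt K(2)) auto
    also have "\<dots> = n * sqrt (K * massq q ?Y)" by (simp add: n_def)
    finally have "(cmod (refr q z))\<^sup>2 \<le> (n * sqrt (K * massq q ?Y))\<^sup>2" by (intro power_mono) auto
    also have "\<dots> = n\<^sup>2 * K * massq q ?Y" using K massq_nonneg by (simp add: power_mult_distrib)
    finally have m: "(cmod (refr q z))\<^sup>2 / (n\<^sup>2 * K) \<le> massq q ?Y"
      using n K by (simp add: field_simps)
    have "(cmod (refr q z))\<^sup>2 / 2 + Re z * massq q ?Y \<le> 1 / 2"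
    proof -
      \<comment> \<open>Young's inequality with weight 1, so that |y(0)|^2/2 cancels the same term
        of the energy identity.\<close>
      have "Re (?Y 0) \<le> 1 / 2 + (cmod (?Y 0))\<^sup>2 / 2"
      proof -
        have "0 \<le> (1 - cmod (?Y 0))\<^sup>2" by simp
        then have "cmod (?Y 0) \<le> 1 / 2 + (cmod (?Y 0))\<^sup>2 / 2" by (simp add: power2_eq_square algebra_simps)
        then show ?thesis using complex_Re_le_cmod[of "?Y 0"] by linarith
      qed
      then show ?thesis using refS_energy[OF assms z, of 0 q] by (simp add: refr_def)
    qed
    moreover have "(\<delta> * cmod z) * ((cmod (refr q z))\<^sup>2 / (n\<^sup>2 * K)) \<le> Re z * massq q ?Y"
      using m z n K assms by (intro mult_mono wedge_Re_nonneg[OF assms z]) (auto simp: wedge_def)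
    ultimately have "(cmod (refr q z))\<^sup>2 * (1 + b * cmod z) \<le> 1"
    proof -
      assume 1: "(cmod (refr q z))\<^sup>2 / 2 + Re z * massq q ?Y \<le> 1 / 2"
        and 2: "(\<delta> * cmod z) * ((cmod (refr q z))\<^sup>2 / (n\<^sup>2 * K)) \<le> Re z * massq q ?Y"
      have "(cmod (refr q z))\<^sup>2 * (1 + b * cmod z)
          = (cmod (refr q z))\<^sup>2 + 2 * ((\<delta> * cmod z) * ((cmod (refr q z))\<^sup>2 / (n\<^sup>2 * K)))"
        by (simp add: b_def algebra_simps)
      with 1 2 show ?thesis by linarith
    qed
    moreover have "(1 + c * cmod z)\<^sup>2 \<le> 1 + b * cmod z"
    proof -
      have "c * c * cmod z \<le> c * (1 / (2 * A)) * (2 * A)"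
        using c True A by (intro mult_mono) auto
      also have "\<dots> = c" using A by simp
      finally have "c * c * cmod z \<le> b / 4" using c(2) by linarith
      then have "(2 * c + c * c * cmod z) * cmod z \<le> b * cmod z" using c by (intro mult_right_mono) auto
      then show ?thesis by (simp add: power2_eq_square algebra_simps)
    qed
    ultimately have "(cmod (refr q z))\<^sup>2 * (1 + c * cmod z)\<^sup>2 \<le> 1"
      by (meson mult_left_mono order_trans zero_le_power2)
    then have "(cmod (refr q z) * (1 + c * cmod z))\<^sup>2 \<le> 1\<^sup>2" by (simp add: power_mult_distrib)
    then have "cmod (refr q z) * (1 + c * cmod z) \<le> 1" by (rule power2_le_imp_le) simp
    then show ?thesis using c by (subst pos_le_divide_eq) (auto simp: add_pos_nonneg)
  next
    case False
    have "cmod (refr q z) \<le> (\<Sum>j\<le>q. C / (1 + cmod z))"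
      unfolding refr_def by (intro sum_norm_le C(2) z) auto
    also have "\<dots> = A / (1 + cmod z)" by (simp add: A_def n_def)
    also have "\<dots> \<le> 1 / (1 + c * cmod z)"
    proof -
      have "A * (c * cmod z) \<le> A * (1 / (2 * A) * cmod z)"
        using c A by (intro mult_left_mono mult_right_mono) auto
      also have "\<dots> = cmod z / 2" using A by simp
      finally have "A * (1 + c * cmod z) \<le> 1 + cmod z" using False A by (simp add: algebra_simps)
      then show ?thesis using c by (simp add: divide_simps add_pos_nonneg add_nonneg_eq_0_iff) 
    qed
    finally show ?thesis .
  qed
  with c(1) show ?thesis by blast
qed

text \<open>The matrix R is the inverse mass matrix, which is the coefficient of 1/z in refS at infinity.\<close>
lemma refS_split:
  assumes "0 < \<delta>"
  shows "\<exists>R K. 0 \<le> K \<and> (\<forall>z\<in>wedge \<delta>. \<forall>j\<le>q. \<forall>l\<le>q.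
           cmod (refS q z j l - R j l / (1 + z)) \<le> K / (1 + cmod z)\<^sup>2)"
proof -
  obtain C where C: "C \<ge> 1" "\<And>z j l. z \<in> wedge \<delta> \<Longrightarrow> j \<le> q \<Longrightarrow> l \<le> q \<Longrightarrow> cmod (refS q z j l) \<le> C / (1 + cmod z)"
    using refS_bound[OF assms(1), of q] by blast
  from right_inverse_exists[of q "\<lambda>i j. complex_of_real (refH i j)", OF refH_inj]
  obtain R where R: "\<And>i l. i\<le>q \<Longrightarrow> l\<le>q \<Longrightarrow> (\<Sum>j\<le>q. complex_of_real (refH i j) * R j l) = (if i = l then 1 else 0)"
    by blast
  \<comment> \<open>\<open>R\<close> is constructed as a right inverse of the mass matrix;
    injectivity makes it a left inverse as well.\<close>
  have Rinv: "(\<Sum>l\<le>q. R j l * (\<Sum>p\<le>q. of_real (refH l p) * Y p)) = Y j" if "j \<le> q" for Y j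
  proof -
    let ?m = "\<lambda>l. \<Sum>p\<le>q. of_real (refH l p) * Y p"
    have "\<forall>j\<le>q. (\<Sum>l\<le>q. R j l * ?m l) - Y j = 0"
    proof (rule refH_inj)
      fix i assume i: "i \<le> q"
      have "(\<Sum>j\<le>q. of_real (refH i j) * (\<Sum>l\<le>q. R j l * ?m l))
          = (\<Sum>l\<le>q. (\<Sum>j\<le>q. of_real (refH i j) * R j l) * ?m l)"
        by (rule sum_mat_vec)
      also have "\<dots> = (\<Sum>l\<le>q. if i = l then ?m l else 0)" using R i by (intro sum.cong) auto
      finally show "(\<Sum>j\<le>q. of_real (refH i j) * ((\<Sum>l\<le>q. R j l * ?m l) - Y j)) = 0"
        using i by (simp add: right_diff_distrib sum_subtractf)
    qed
    with that show ?thesis by simp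
  qed
  define G where "G = (\<Sum>j\<le>q. \<Sum>i\<le>q. cmod (R j i) * (\<Sum>p\<le>q. \<bar>refD i p\<bar> * C))"
  have G0: "0 \<le> G" unfolding G_def using C(1) by (intro sum_nonneg mult_nonneg_nonneg) auto
  have "cmod (refS q z j l - R j l / (1 + z)) \<le> (2 * (C + G)) / (1 + cmod z)\<^sup>2"
    if z: "z \<in> wedge \<delta>" "j \<le> q" "l \<le> q" for z j l
  proof -
    let ?Y = "\<lambda>j. refS q z j l"
    let ?DY = "\<lambda>i. \<Sum>p\<le>q. of_real (refD i p) * ?Y p"
    have id: "?DY i + (\<Sum>p\<le>q. of_real (refH i p) * (z * ?Y p)) = (if i = l then 1 else 0)" if "i \<le> q" for i
      using refS_right[OF assms z(1) that z(3)] unfolding sum.distrib[symmetric] refB_def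
      by (simp add: algebra_simps)
    \<comment> \<open>The step equation solved for its mass term: z Y = R (e_l - D Y).\<close>
    have "z * ?Y j = (\<Sum>i\<le>q. R j i * ((if i = l then 1 else 0) - ?DY i))"
      unfolding Rinv[OF z(2), of "\<lambda>p. z * ?Y p", symmetric]
      by (intro sum.cong refl) (use id in \<open>simp add: eq_diff_eq add.commute\<close>)
    also have "\<dots> = (\<Sum>i\<le>q. if i = l then R j i else 0) - (\<Sum>i\<le>q. R j i * ?DY i)"
      unfolding sum_subtractf[symmetric] by (intro sum.cong) (auto simp: algebra_simps)
    finally have zY: "z * ?Y j = R j l - (\<Sum>i\<le>q. R j i * ?DY i)" using z by simp
    have Rez: "0 \<le> Re z" using wedge_Re_nonneg assms z by auto
    have z1: "1 + z \<noteq> 0" using Rez by (auto simp: complex_eq_iff)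
    have big: "1 + cmod z \<le> 2 * cmod (1 + z)"
    proof -
      have "1 \<le> cmod (1 + z)" using complex_Re_le_cmod[of "1 + z"] Rez by simp
      moreover have "(cmod z)\<^sup>2 \<le> (cmod (1 + z))\<^sup>2"
        unfolding cmod_power2 using Rez by (simp add: power2_eq_square algebra_simps)
      then have "cmod z \<le> cmod (1 + z)" by (rule power2_le_imp_le) simp
      ultimately show ?thesis by simp
    qed
    have DY: "cmod (?DY i) \<le> (\<Sum>p\<le>q. \<bar>refD i p\<bar> * C) / (1 + cmod z)" for i
      unfolding sum_divide_distrib
    proof (intro sum_norm_le)
      fix p assume "p \<in> {..q}"
      then show "cmod (of_real (refD i p) * ?Y p) \<le> \<bar>refD i p\<bar> * C / (1 + cmod z)"
        using mult_left_mono[OF C(2)[OF z(1) _ z(3), of p], of "\<bar>refD i p\<bar>"] by (simp add: norm_mult)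
    qed
    have "cmod (\<Sum>i\<le>q. R j i * ?DY i) \<le> (\<Sum>i\<le>q. cmod (R j i) * ((\<Sum>p\<le>q. \<bar>refD i p\<bar> * C) / (1 + cmod z)))"
      by (intro sum_norm_le) (auto simp only: norm_mult norm_ge_zero intro!: mult_left_mono DY)
    also have "\<dots> = (\<Sum>i\<le>q. cmod (R j i) * (\<Sum>p\<le>q. \<bar>refD i p\<bar> * C)) / (1 + cmod z)"
      by (simp only: sum_divide_distrib[symmetric] times_divide_eq_right)
    also have "\<dots> \<le> G / (1 + cmod z)"
      unfolding G_def using z C(1)
      by (intro divide_right_mono member_le_sum[where f="\<lambda>j. \<Sum>i\<le>q. cmod (R j i) * (\<Sum>p\<le>q. \<bar>refD i p\<bar> * C)"])
         (auto intro!: sum_nonneg mult_nonneg_nonneg)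
    finally have RDY: "cmod (\<Sum>i\<le>q. R j i * ?DY i) \<le> G / (1 + cmod z)" .
    \<comment> \<open>Multiplying by 1 + z leaves Y - R D Y, which is O(1/(1 + |z|)); dividing by 1
      + z again gains the second power. The pole is placed at -1 to keep it out of the
      sector.\<close>
    have "?Y j - R j l / (1 + z) = (?Y j - (\<Sum>i\<le>q. R j i * ?DY i)) / (1 + z)"
      using z1 zY by (simp add: field_simps)
    then have "cmod (?Y j - R j l / (1 + z)) = cmod (?Y j - (\<Sum>i\<le>q. R j i * ?DY i)) / cmod (1 + z)"
      by (simp add: norm_divide)
    also have "\<dots> \<le> ((C + G) / (1 + cmod z)) / ((1 + cmod z) / 2)"
    proof (intro frac_le)
      show "cmod (?Y j - (\<Sum>i\<le>q. R j i * ?DY i)) \<le> (C + G) / (1 + cmod z)"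
        unfolding add_divide_distrib
        by (rule order_trans[OF norm_triangle_ineq4]) (intro add_mono RDY C(2) z)
      show "(1 + cmod z) / 2 \<le> cmod (1 + z)" using big by simp
      show "0 < (1 + cmod z) / 2" by (simp add: add_pos_nonneg)
      show "0 \<le> (C + G) / (1 + cmod z)" using C(1) G0 by (intro divide_nonneg_nonneg) auto
    qed
    also have "\<dots> = 2 * (C + G) / (1 + cmod z)\<^sup>2" by (simp add: power2_eq_square)
    finally show ?thesis .
  qed
  moreover have "0 \<le> 2 * (C + G)" using C(1) G0 by simp
  ultimately show ?thesis by blast
qed

section \<open>Functional calculus along a sector\<close>

text \<open>A seminorm that sees only the first n coordinates. It models the arbitrary norm on the
  discrete space after expansion in eigenfunctions, hence it is a parameter and not the norm of a
  type.\<close>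

locale coord_norm =
  fixes n :: nat and nr :: "(nat \<Rightarrow> complex) \<Rightarrow> real"
  assumes nr_nonneg: "0 \<le> nr c"
    and nr_scale: "nr (\<lambda>i. a * c i) = cmod a * nr c"
    and nr_add: "nr (\<lambda>i. c i + d i) \<le> nr c + nr d"
    and nr_cong: "(\<And>i. i < n \<Longrightarrow> c i = d i) \<Longrightarrow> nr c = nr d"
begin

lemma nr_zero [simp]: "nr (\<lambda>i. 0) = 0"
  using nr_scale[of 0 "\<lambda>i. 0"] by simp

lemma nr_sum: "finite P \<Longrightarrow> nr (\<lambda>i. \<Sum>p\<in>P. c p i) \<le> (\<Sum>p\<in>P. nr (c p))"
proof (induction P rule: finite_induct)
  case (insert x F)
  have "nr (\<lambda>i. \<Sum>p\<in>insert x F. c p i) = nr (\<lambda>i. c x i + (\<Sum>p\<in>F. c p i))" using insert by simp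
  also have "\<dots> \<le> nr (c x) + nr (\<lambda>i. \<Sum>p\<in>F. c p i)" by (rule nr_add)
  finally show ?case using insert by simp
qed simp

lemma nr_diff: "nr (\<lambda>i. c i - d i) \<le> nr c + nr d"
  using nr_add[of c "\<lambda>i. - d i"] nr_scale[of "-1" d] by simp

lemma nr_coord_le: "nr c \<le> (\<Sum>k<n. cmod (c k) * nr (\<lambda>i. if i = k then 1 else 0))"
proof -
  have "nr c = nr (\<lambda>i. \<Sum>k<n. c k * (if i = k then 1 else 0))"
  proof (rule nr_cong)
    fix i assume "i < n"
    have "(\<Sum>k<n. c k * (if i = k then 1 else 0)) = (\<Sum>k<n. if i = k then c k else 0)"
      by (intro sum.cong) auto
    with \<open>i < n\<close> show "c i = (\<Sum>k<n. c k * (if i = k then 1 else 0))" by simp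
  qed
  also have "\<dots> \<le> (\<Sum>k<n. nr (\<lambda>i. c k * (if i = k then 1 else 0)))" by (rule nr_sum) simp
  also have "\<dots> = (\<Sum>k<n. cmod (c k) * nr (\<lambda>i. if i = k then 1 else 0))" by (simp only: nr_scale)
  finally show ?thesis .
qed

lemma nr_diff_ge: "nr c - nr d \<le> nr (\<lambda>i. c i - d i)"
  using nr_add[of "\<lambda>i. c i - d i" d] by simp

lemma tendsto_nr:
  assumes "\<And>i. i < n \<Longrightarrow> ((\<lambda>t. c t i) \<longlongrightarrow> C i) F"
  shows "((\<lambda>t. nr (c t)) \<longlongrightarrow> nr C) F"
proof (rule Lim_transform2[OF tendsto_const[of "nr C"]])
  let ?b = "\<lambda>t. \<Sum>k<n. cmod (c t k - C k) * nr (\<lambda>i. if i = k then 1 else 0)"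
  have "(?b \<longlongrightarrow> (\<Sum>k<n. cmod (C k - C k) * nr (\<lambda>i. if i = k then 1 else 0))) F"
    by (intro tendsto_intros assms) auto
  then have b: "(?b \<longlongrightarrow> 0) F" by simp
  show "((\<lambda>t. nr C - nr (c t)) \<longlongrightarrow> 0) F"
  proof (rule Lim_null_comparison[OF _ b], intro always_eventually allI)
    fix t
    have "nr (\<lambda>i. C i - c t i) = nr (\<lambda>i. c t i - C i)"
      using nr_scale[of "-1" "\<lambda>i. c t i - C i"] by simp
    moreover have "nr (\<lambda>i. c t i - C i) \<le> ?b t" by (rule nr_coord_le)
    ultimately show "norm (nr C - nr (c t)) \<le> ?b t"
      using nr_diff_ge[of C "c t"] nr_diff_ge[of "c t" C] by auto
  qed
qed

text \<open>The triangle inequality for integrals, for a seminorm given as a function: it holds for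
  every tagged Riemann sum by subadditivity and passes to the limit because \<open>nr\<close> is
  continuous in the first n coordinates.\<close>

lemma nr_integral_le:
  fixes c :: "'b::euclidean_space \<Rightarrow> nat \<Rightarrow> complex"
  assumes c: "\<And>i. i < n \<Longrightarrow> ((\<lambda>t. c t i) has_integral C i) (cbox a b)"
    and g: "(g has_integral G) (cbox a b)"
    and le: "\<And>t. t \<in> cbox a b \<Longrightarrow> nr (c t) \<le> g t"
  shows "nr C \<le> G"
proof (rule tendsto_le[OF _ _ tendsto_nr])
  show "division_filter (cbox a b) \<noteq> bot" by (rule division_filter_not_empty)
  show "((\<lambda>p. \<Sum>(x, k)\<in>p. measure lborel k *\<^sub>R g x) \<longlongrightarrow> G) (division_filter (cbox a b))"
    using g by (simp add: has_integral_cbox)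
  show "((\<lambda>p. \<Sum>(x, k)\<in>p. measure lborel k *\<^sub>R c x i) \<longlongrightarrow> C i) (division_filter (cbox a b))" if "i < n" for i
    using c[OF that] by (simp add: has_integral_cbox)
  show "\<forall>\<^sub>F p in division_filter (cbox a b).
      nr (\<lambda>i. \<Sum>(x, k)\<in>p. measure lborel k *\<^sub>R c x i) \<le> (\<Sum>(x, k)\<in>p. measure lborel k *\<^sub>R g x)"
    unfolding eventually_division_filter
  proof (intro exI[of _ "\<lambda>x. ball x 1"] conjI allI impI)
    fix p assume p: "p tagged_division_of cbox a b \<and> (\<lambda>x. ball x 1) fine p"
    have "finite p" using p by blast
    then have "nr (\<lambda>i. \<Sum>xk\<in>p. measure lborel (snd xk) *\<^sub>R c (fst xk) i) \<le> (\<Sum>xk\<in>p. nr (\<lambda>i. measure lborel (snd xk) *\<^sub>R c (fst xk) i))"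
      by (rule nr_sum)
    also have "\<dots> \<le> (\<Sum>xk\<in>p. measure lborel (snd xk) *\<^sub>R g (fst xk))"
    proof (rule sum_mono)
      fix xk assume "xk \<in> p"
      then have "fst xk \<in> cbox a b" using p by (metis prod.collapse tag_in_interval)
      then show "nr (\<lambda>i. measure lborel (snd xk) *\<^sub>R c (fst xk) i) \<le> measure lborel (snd xk) *\<^sub>R g (fst xk)"
        unfolding scaleR_conv_of_real nr_scale using le by (simp add: mult_left_mono)
    qed
    finally show "nr (\<lambda>i. \<Sum>(x, k)\<in>p. measure lborel k *\<^sub>R c x i) \<le> (\<Sum>(x, k)\<in>p. measure lborel k *\<^sub>R g x)"
      by (simp add: case_prod_beta)
  qed auto
qed

end

section \<open>Triangular contour around the spectrum\<close>

lemma convex_wedge: "0 \<le> \<delta> \<Longrightarrow> convex (wedge \<delta>)"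
  unfolding convex_def
proof (intro ballI allI impI)
  fix x y and u v :: real
  assume *: "0 \<le> \<delta>" "x \<in> wedge \<delta>" "y \<in> wedge \<delta>" "0 \<le> u" "0 \<le> v" "u + v = 1"
  have "\<delta> * cmod (u *\<^sub>R x + v *\<^sub>R y) \<le> \<delta> * (u * cmod x + v * cmod y)"
    using * by (intro mult_left_mono) (auto intro!: order_trans[OF norm_triangle_ineq])
  also have "\<dots> = u * (\<delta> * cmod x) + v * (\<delta> * cmod y)" by (simp add: algebra_simps)
  also have "\<dots> \<le> u * Re x + v * Re y"
    using * by (intro add_mono mult_left_mono) (auto simp: wedge_def)
  finally show "u *\<^sub>R x + v *\<^sub>R y \<in> wedge \<delta>" by (simp add: wedge_def)
qed

lemma wedge_scale: "z \<in> wedge \<delta> \<Longrightarrow> 0 \<le> t \<Longrightarrow> of_real t * z \<in> wedge \<delta>"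
  using mult_left_mono[of "\<delta> * cmod z" "Re z" t] by (simp add: wedge_def norm_mult mult_ac)

lemma wedge_real: "\<delta> \<le> 1 \<Longrightarrow> 0 \<le> t \<Longrightarrow> of_real t \<in> wedge \<delta>"
  using mult_right_mono[of \<delta> 1 t] by (simp add: wedge_def)

context
  fixes \<theta> :: real
  assumes \<theta>: "0 < \<theta>" "\<theta> < pi / 2"
begin

lemma cos_pos: "0 < cos \<theta>" and sin_pos: "0 < sin \<theta>"
  using \<theta> by (auto intro: cos_gt_zero_pi sin_gt_zero)

lemma ray_in_wedge: "0 \<le> R \<Longrightarrow> \<bar>\<phi>\<bar> = \<theta> \<Longrightarrow> of_real R * cis \<phi> \<in> wedge (cos \<theta>)"
  by (auto simp: wedge_def norm_mult abs_if split: if_splits)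

lemma real_in_triangle:
  assumes "0 < l" "l < R * cos \<theta>"
  shows "of_real l \<in> interior (convex hull {0, of_real R * cis (- \<theta>), of_real R * cis \<theta>})"
proof -
  let ?b = "of_real R * cis (- \<theta>)" and ?c = "of_real R * cis \<theta>"
  have R: "0 < R" using assms cos_pos by (metis less_trans zero_less_mult_pos2)
  have nc: "\<not> collinear {0, ?b, ?c}"
  proof
    assume "collinear {0, ?b, ?c}"
    then have "?b = 0 \<or> ?c = 0 \<or> (\<exists>k. ?c = k *\<^sub>R ?b)"
      by (simp add: collinear_lemma)
    then obtain k where "?c = k *\<^sub>R ?b" using R by auto
    then have "Re ?c = k * Re ?b" "Im ?c = k * Im ?b" by auto
    then have "R * cos \<theta> = R * (k * cos \<theta>)" "R * sin \<theta> = R * (- k * sin \<theta>)" by (auto simp: mult_ac)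
    then have "cos \<theta> = k * cos \<theta>" "sin \<theta> = - k * sin \<theta>" using R by (simp_all only: mult_cancel_left) auto
    then show False using cos_pos sin_pos by auto
  qed
  \<comment> \<open>The barycentric weight of each outer corner; the two weights add up to l/(R cos
    \<theta>) < 1.\<close>
  define y where "y = l / (2 * R * cos \<theta>)"
  have "0 < 1 - 2 * y" "0 < y" using assms R cos_pos by (auto simp: y_def)
  moreover have "(1 - 2 * y) *\<^sub>R 0 + y *\<^sub>R ?b + y *\<^sub>R ?c = of_real l"
    using R cos_pos by (simp add: complex_eq_iff y_def)
  moreover have "(1 - 2 * y) + y + y = 1" by simp
  ultimately show ?thesis
    unfolding interior_convex_hull_3_minimal[OF nc DIM_complex] by blast
qed

text \<open>The case l = 0 is separated because w / (w - l) has the junk value 0 at w = 0.\<close>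
lemma triangle_cauchy:
  fixes h :: "complex \<Rightarrow> complex"
  assumes h: "h holomorphic_on wedge (cos \<theta>)" and l: "0 \<le> l" "l < R * cos \<theta>"
  defines "f \<equiv> \<lambda>w. if l = 0 then h w else w * h w / (w - of_real l)"
    and "b \<equiv> of_real R * cis (- \<theta>)" and "c \<equiv> of_real R * cis \<theta>"
  obtains I1 I2 I3 where "(f has_contour_integral I1) (linepath 0 b)"
    "(f has_contour_integral I2) (linepath b c)" "(f has_contour_integral I3) (linepath 0 c)"
    "I1 + I2 - I3 = 2 * of_real pi * \<i> * (of_real l * h (of_real l))"
proof -
  have R: "0 < R" using l cos_pos by (metis le_less_trans zero_less_mult_pos2)
  let ?T = "convex hull {0, b, c}"
  have T: "?T \<subseteq> wedge (cos \<theta>)"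
    using R cos_pos ray_in_wedge[of R \<theta>] ray_in_wedge[of R "- \<theta>"] \<theta>
    by (intro hull_minimal) (auto simp: b_def c_def convex_wedge)
  have hT: "h holomorphic_on ?T" using h T holomorphic_on_subset by blast
  have seg: "closed_segment 0 b \<subseteq> ?T" "closed_segment b c \<subseteq> ?T" "closed_segment 0 c \<subseteq> ?T"
    unfolding segment_convex_hull by (intro hull_mono; auto)+
  have notin: "of_real l \<notin> closed_segment 0 b \<union> closed_segment b c \<union> closed_segment 0 c" if "l \<noteq> 0"
    using real_in_triangle[of l R] l that interior_of_triangle[of 0 b c]
    by (auto simp: b_def c_def closed_segment_commute)
  have cont: "continuous_on S f" if "S \<subseteq> ?T" "l \<noteq> 0 \<Longrightarrow> of_real l \<notin> S" for S
  proof (cases "l = 0")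
    case True
    then have "f = h" by (auto simp: f_def)
    then show ?thesis using hT that continuous_on_subset holomorphic_on_imp_continuous_on by blast
  next
    case False
    have hS: "continuous_on S h" using hT that continuous_on_subset holomorphic_on_imp_continuous_on by blast
    have "continuous_on S (\<lambda>w. w * h w / (w - of_real l))"
      using that False by (intro continuous_intros hS) auto
    then show ?thesis using False by (simp add: f_def)
  qed
  have ex: "\<exists>I. (f has_contour_integral I) (linepath u v)"
    if "closed_segment u v \<subseteq> ?T" "l \<noteq> 0 \<Longrightarrow> of_real l \<notin> closed_segment u v" for u v
    using contour_integrable_continuous_linepath[OF cont[OF that]]
    by (auto simp: contour_integrable_on_def)
  obtain I1 where I1: "(f has_contour_integral I1) (linepath 0 b)" using ex[OF seg(1)] notin by blast
  obtain I2 where I2: "(f has_contour_integral I2) (linepath b c)" using ex[OF seg(2)] notin by blast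
  obtain I3 where I3: "(f has_contour_integral I3) (linepath 0 c)" using ex[OF seg(3)] notin by blast
  let ?p = "linepath 0 b +++ linepath b c +++ linepath c 0"
  have I3': "(f has_contour_integral - I3) (linepath c 0)"
    using has_contour_integral_reverse_linepath[OF I3] by simp
  have join: "(f has_contour_integral (I1 + (I2 + - I3))) ?p"
    by (intro has_contour_integral_join I1 I2 I3') auto
  have full: "(f has_contour_integral 2 * of_real pi * \<i> * (of_real l * h (of_real l))) ?p"
  proof (cases "l = 0")
    case True
    then have "f = h" by (auto simp: f_def)
    with Cauchy_theorem_triangle[OF hT] True show ?thesis by simp
  next
    case False
    have int: "of_real l \<in> interior ?T" using real_in_triangle[of l R] l False by (simp add: b_def c_def)
    have w: "winding_number ?p (of_real l) = 1"
      using winding_number_triangle[OF int] l False R sin_pos by (simp add: b_def)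
    have "((\<lambda>w. (w * h w) / (w - of_real l)) has_contour_integral
             (2 * pi * \<i> * winding_number ?p (of_real l) * (of_real l * h (of_real l)))) ?p"
    proof (rule Cauchy_integral_formula_convex_simple)
      show "path_image ?p \<subseteq> ?T - {of_real l}"
        using seg notin[OF False] by (auto simp: path_image_join closed_segment_commute)
      show "(\<lambda>w. w * h w) holomorphic_on ?T" by (intro holomorphic_intros hT)
    qed (use int in auto)
    with False w show ?thesis by (simp add: f_def)
  qed
  have "I1 + I2 - I3 = 2 * of_real pi * \<i> * (of_real l * h (of_real l))"
    using has_contour_integral_unique[OF join full] by (simp only: add_diff_eq add_uminus_conv_diff)
  with I1 I2 I3 show thesis by (rule that)
qed

text \<open>On the side Re w = R cos \<theta> the factor |w| and the length are both of order R; the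
  second-order decay of h compensates exactly these two, and the distance to the pole remains in the
  denominator.\<close>

lemma far_side_bound:
  fixes h :: "complex \<Rightarrow> complex"
  assumes hb: "\<And>z. z \<in> wedge (cos \<theta>) \<Longrightarrow> cmod (h z) \<le> K / (1 + a * cmod z)\<^sup>2"
    and a: "0 < a" and K: "0 \<le> K" and l: "0 \<le> l" "l < R * cos \<theta>"
    and I: "((\<lambda>w. if l = 0 then h w else w * h w / (w - of_real l)) has_contour_integral I)
        (linepath (of_real R * cis (- \<theta>)) (of_real R * cis \<theta>))"
  shows "cmod I \<le> (2 * K / (a * cos \<theta>)\<^sup>2) / (R * cos \<theta> - l)"
proof -
  let ?b = "of_real R * cis (- \<theta>)" and ?c = "of_real R * cis \<theta>"
  have R: "0 < R" using l cos_pos by (metis le_less_trans zero_less_mult_pos2)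
  let ?B = "R * (K / (a * (R * cos \<theta>))\<^sup>2) / (R * cos \<theta> - l)"
  have "cmod I \<le> ?B * norm (?c - ?b)"
  proof (rule has_contour_integral_bound_linepath[OF I])
    show "0 \<le> ?B" using R K l by (intro divide_nonneg_nonneg mult_nonneg_nonneg) auto
    fix w assume w: "w \<in> closed_segment ?b ?c"
    then obtain u where u: "0 \<le> u" "u \<le> 1" "w = (1 - u) *\<^sub>R ?b + u *\<^sub>R ?c"
      by (auto simp: closed_segment_def)
    have Rew: "Re w = R * cos \<theta>" unfolding u(3) by (simp add: algebra_simps)
    have wW: "w \<in> wedge (cos \<theta>)"
      using convex_wedge[of "cos \<theta>"] ray_in_wedge[of R "- \<theta>"] ray_in_wedge[of R "\<theta>"] R \<theta> u cos_pos
      unfolding convex_def by auto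
    have wR: "cmod w \<le> R"
    proof -
      have "cos \<theta> * cmod w \<le> cos \<theta> * R" using wW Rew by (simp add: wedge_def mult.commute)
      then show ?thesis using cos_pos by simp
    qed
    have wl: "R * cos \<theta> - l \<le> cmod (w - of_real l)"
      using complex_Re_le_cmod[of "w - of_real l"] Rew by simp
    have "R * cos \<theta> \<le> cmod w" using complex_Re_le_cmod[of w] Rew by simp
    then have aw: "a * (R * cos \<theta>) \<le> 1 + a * cmod w"
      using a by (smt (verit) mult_left_mono)
    have hw: "cmod (h w) \<le> K / (a * (R * cos \<theta>))\<^sup>2"
      using hb[OF wW] aw R K a cos_pos
      by (elim order_trans) (intro divide_left_mono power_mono mult_pos_pos zero_less_power; simp add: add_pos_nonneg)
    have f: "cmod (w * h w / (w - of_real l)) \<le> ?B"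
      unfolding norm_divide norm_mult using wR hw wl l K R
      by (intro frac_le mult_mono) auto
    have "w \<noteq> 0" using Rew R cos_pos by auto
    then show "cmod (if l = 0 then h w else w * h w / (w - of_real l)) \<le> ?B"
      using f by (auto split: if_splits)
  qed
  also have "norm (?c - ?b) \<le> 2 * R"
    using norm_triangle_ineq4[of ?c ?b] R by (simp add: norm_mult)
  then have "?B * norm (?c - ?b) \<le> ?B * (2 * R)"
    using R K l by (intro mult_left_mono divide_nonneg_nonneg mult_nonneg_nonneg) auto
  also have "?B * (2 * R) = (2 * K / (a * cos \<theta>)\<^sup>2) / (R * cos \<theta> - l)"
    using R a cos_pos l by (simp add: field_simps power2_eq_square)
  finally show ?thesis .
qed

text \<open>The condition t > 0 matters: since \<open>Arg 0 = 0\<close>, the origin belongs to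
  \<open>sector \<gamma>\<close> when \<gamma> is nonnegative, and the resolvent estimate says
  nothing there.\<close>

lemma ray_not_in_sector:
  assumes "\<gamma> < \<theta>" "0 < t" "\<bar>\<phi>\<bar> = \<theta>"
  shows "of_real t * cis \<phi> \<notin> sector \<gamma>"
proof -
  have "Arg (of_real t * cis \<phi>) = \<phi>"
    using assms \<theta> by (subst Arg_times_of_real) (auto intro!: Arg_cis)
  then show ?thesis using assms by (simp add: sector_def)
qed

end

lemma ray_weight_integral:
  assumes "0 < a" "0 < R"
  obtains G where "((\<lambda>t. R / (1 + a * (R * t))\<^sup>2) has_integral G) {0..1::real}" "G \<le> 1 / a"
proof
  let ?F = "\<lambda>t. - 1 / (a * (1 + a * (R * t)))"
  show "((\<lambda>t. R / (1 + a * (R * t))\<^sup>2) has_integral (?F 1 - ?F 0)) {0..1::real}"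
  proof (rule fundamental_theorem_of_calculus)
    fix t :: real assume t: "t \<in> {0..1}"
    then have nz: "1 + a * (R * t) \<noteq> 0" using assms by (smt (verit) atLeastAtMost_iff mult_nonneg_nonneg)
    have "(?F has_real_derivative R / (1 + a * (R * t))\<^sup>2) (at t within {0..1})"
      using nz assms by (auto intro!: derivative_eq_intros simp: divide_simps power2_eq_square)
    then show "(?F has_vector_derivative R / (1 + a * (R * t))\<^sup>2) (at t within {0..1})"
      by (simp add: has_real_derivative_iff_has_vector_derivative)
  qed simp
  have "0 \<le> 1 / (a * (1 + a * R))" using assms by simp
  then show "?F 1 - ?F 0 \<le> 1 / a" using assms by simp
qed

section \<open>Functional calculus from the resolvent estimate\<close>

text \<open>\<open>resolvent\<close> is the estimate for the inverse of z + Delta_h in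
  eigen-coordinates, where Delta_h acts as multiplication by -\<open>lam i\<close>.
  \<open>Mh_half\<close> serves to absorb additive constants into multiples of
  \<open>Mh\<close>.\<close>

locale sectorial = coord_norm +
  fixes lam :: "nat \<Rightarrow> real" and Mh \<gamma> :: real
  assumes lam_nonneg: "i < n \<Longrightarrow> 0 \<le> lam i"
    and Mh_half: "1 / 2 \<le> Mh"
    and resolvent: "z \<notin> sector \<gamma> \<Longrightarrow> nr (\<lambda>i. c i / (z - of_real (lam i))) \<le> Mh / cmod z * nr c"
begin

lemma Mh_nonneg: "0 \<le> Mh" using Mh_half by simp

text \<open>The bound Mh/|w| of the resolvent cancels the factor |w|, leaving the weight K/(1 +
  a|w|)^2, whose integral along the ray is at most K/a whatever the length R.\<close>

lemma ray_bound:
  assumes \<theta>: "0 < \<theta>" "\<theta> < pi / 2" "\<gamma> < \<theta>" and \<phi>: "\<bar>\<phi>\<bar> = \<theta>"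
    and hb: "\<And>z. z \<in> wedge (cos \<theta>) \<Longrightarrow> cmod (h z) \<le> K / (1 + a * cmod z)\<^sup>2"
    and a: "0 < a" and K: "0 \<le> K" and R: "0 < R"
    and I: "\<And>i. i < n \<Longrightarrow> ((\<lambda>w. if lam i = 0 then h w else w * h w / (w - of_real (lam i))) has_contour_integral I i)
        (linepath 0 (of_real R * cis \<phi>))"
  shows "nr (\<lambda>i. c i * I i) \<le> Mh * K / a * nr c"
proof -
  let ?b = "of_real R * cis \<phi>"
  obtain G where G: "((\<lambda>t. R / (1 + a * (R * t))\<^sup>2) has_integral G) {0..1::real}" "G \<le> 1 / a"
    using ray_weight_integral[OF a R] .
  let ?w = "\<lambda>t::real. of_real (R * t) * cis \<phi>"
  \<comment> \<open>Set to 0 at t = 0, where the resolvent estimate does not apply; away from 0 the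
    two cases of the contour integrand agree.\<close>
  let ?f = "\<lambda>t i. if t = 0 then 0 else c i * (?w t * h (?w t) / (?w t - of_real (lam i)) * ?b)"
  have "nr (\<lambda>i. c i * I i) \<le> Mh * K * nr c * G"
  proof (rule nr_integral_le[of ?f _ 0 1])
    show "((\<lambda>t. Mh * K * nr c * (R / (1 + a * (R * t))\<^sup>2)) has_integral Mh * K * nr c * G) (cbox 0 1)"
      unfolding box_real by (rule has_integral_mult_right[OF G(1)])
    show "((\<lambda>t. ?f t i) has_integral c i * I i) (cbox 0 1)" if "i < n" for i
    proof -
      have "((\<lambda>t. c i * ((\<lambda>w. if lam i = 0 then h w else w * h w / (w - of_real (lam i))) (linepath 0 ?b t) * (?b - 0)))
          has_integral c i * I i) {0..1}"
        using I[OF that] unfolding has_contour_integral_linepath by (rule has_integral_mult_right)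
      then have "((\<lambda>t. ?f t i) has_integral c i * I i) {0..1}"
      proof (rule has_integral_spike_finite[of "{0}", rotated 2])
        fix t :: real assume t: "t \<in> {0..1} - {0}"
        have lp: "linepath 0 ?b t = ?w t" by (simp add: linepath_def scaleR_conv_of_real mult_ac)
        have "?w t \<noteq> 0" using t R by simp
        then show "?f t i = c i * ((\<lambda>w. if lam i = 0 then h w else w * h w / (w - of_real (lam i))) (linepath 0 ?b t) * (?b - 0))"
          unfolding lp using t by auto
      qed simp
      then show ?thesis by simp
    qed
    show "nr (?f t) \<le> Mh * K * nr c * (R / (1 + a * (R * t))\<^sup>2)" if "t \<in> cbox 0 1" for t
    proof (cases "t = 0")
      case True
      then show ?thesis using Mh_nonneg K nr_nonneg R by simp
    next
      case False
      then have t: "0 < t" using that by simp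
      have w0: "cmod (?w t) = R * t" using t R by (simp add: norm_mult)
      have W: "?w t \<in> wedge (cos \<theta>)" using ray_in_wedge[OF \<theta>(1,2), of "R * t" \<phi>] t R \<phi> by simp
      have nS: "?w t \<notin> sector \<gamma>" using ray_not_in_sector[OF \<theta>, of "R * t" \<phi>] t R \<phi> by simp
      have "nr (?f t) = nr (\<lambda>i. (?w t * h (?w t) * ?b) * (c i / (?w t - of_real (lam i))))"
        using False by (intro nr_cong) simp
      also have "\<dots> = cmod (?w t * h (?w t) * ?b) * nr (\<lambda>i. c i / (?w t - of_real (lam i)))"
        by (rule nr_scale)
      also have "\<dots> \<le> cmod (?w t * h (?w t) * ?b) * (Mh / cmod (?w t) * nr c)"
        by (intro mult_left_mono resolvent nS) auto
      also have "\<dots> = Mh * nr c * (R * cmod (h (?w t)))"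
        using w0 t R by (simp add: norm_mult field_simps)
      also have "\<dots> \<le> Mh * nr c * (R * (K / (1 + a * (R * t))\<^sup>2))"
        using hb[OF W] w0 Mh_nonneg nr_nonneg R by (intro mult_left_mono) auto
      finally show ?thesis by (simp add: mult_ac)
    qed
  qed
  also have "\<dots> \<le> Mh * K * nr c * (1 / a)"
    using G(2) Mh_nonneg K nr_nonneg by (intro mult_left_mono) auto
  finally show ?thesis by (simp add: mult_ac)
qed

text \<open>Cauchy's formula on a triangle growing with R. The rays are bounded uniformly in R. The
  far side is estimated coordinate by coordinate, with constants that depend on n and on the norms
  of unit vectors; it tends to 0, so these constants disappear from the result.\<close>

lemma functional_calculus_bound:
  assumes \<theta>: "0 < \<theta>" "\<theta> < pi / 2" "\<gamma> < \<theta>"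
    and h: "h holomorphic_on wedge (cos \<theta>)"
    and hb: "\<And>z. z \<in> wedge (cos \<theta>) \<Longrightarrow> cmod (h z) \<le> K / (1 + a * cmod z)\<^sup>2"
    and a: "0 < a" and K: "0 \<le> K"
  shows "nr (\<lambda>i. of_real (lam i) * h (of_real (lam i)) * c i) \<le> Mh * K / a * nr c"
proof -
  note cp = cos_pos[OF \<theta>(1,2)]
  let ?E = "\<lambda>R. \<Sum>k<n. cmod (c k) * ((2 * K / (a * cos \<theta>)\<^sup>2) * inverse (R * cos \<theta> - lam k)) * nr (\<lambda>i. if i = k then 1 else 0)"
  have bound: "2 * pi * nr (\<lambda>i. of_real (lam i) * h (of_real (lam i)) * c i)
      \<le> 2 * (Mh * K / a * nr c) + ?E R" if R: "0 < R" "\<And>i. i < n \<Longrightarrow> lam i < R * cos \<theta>" for R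
  proof -
    let ?f = "\<lambda>i w. if lam i = 0 then h w else w * h w / (w - of_real (lam i))"
    let ?b = "of_real R * cis (- \<theta>)" and ?c = "of_real R * cis \<theta>"
    define I1 where "I1 i = contour_integral (linepath 0 ?b) (?f i)" for i
    define I2 where "I2 i = contour_integral (linepath ?b ?c) (?f i)" for i
    define I3 where "I3 i = contour_integral (linepath 0 ?c) (?f i)" for i
    have *: "(?f i has_contour_integral I1 i) (linepath 0 ?b) \<and>
      (?f i has_contour_integral I2 i) (linepath ?b ?c) \<and> (?f i has_contour_integral I3 i) (linepath 0 ?c) \<and>
      I1 i + I2 i - I3 i = 2 * of_real pi * \<i> * (of_real (lam i) * h (of_real (lam i)))" if "i < n" for i
    proof (rule triangle_cauchy[OF \<theta>(1,2) h lam_nonneg[OF that] R(2)[OF that]])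
      fix J1 J2 J3
      assume J: "(?f i has_contour_integral J1) (linepath 0 ?b)"
        "(?f i has_contour_integral J2) (linepath ?b ?c)" "(?f i has_contour_integral J3) (linepath 0 ?c)"
        "J1 + J2 - J3 = 2 * of_real pi * \<i> * (of_real (lam i) * h (of_real (lam i)))"
      have "I1 i = J1" "I2 i = J2" "I3 i = J3"
        unfolding I1_def I2_def I3_def using J(1-3) by (simp_all only: contour_integral_unique)
      with J show ?thesis by simp
    qed
    note I1 = *[THEN conjunct1] and I2 = *[THEN conjunct2, THEN conjunct1]
      and I3 = *[THEN conjunct2, THEN conjunct2, THEN conjunct1]
      and I = *[THEN conjunct2, THEN conjunct2, THEN conjunct2]
    have "2 * pi * nr (\<lambda>i. of_real (lam i) * h (of_real (lam i)) * c i)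
        = nr (\<lambda>i. (2 * of_real pi * \<i>) * (of_real (lam i) * h (of_real (lam i)) * c i))"
      unfolding nr_scale by (simp add: norm_mult)
    also have "\<dots> = nr (\<lambda>i. (c i * I1 i - c i * I3 i) + c i * I2 i)"
    proof (rule nr_cong)
      fix i assume "i < n"
      have "(2 * of_real pi * \<i>) * (of_real (lam i) * h (of_real (lam i)) * c i) = (I1 i + I2 i - I3 i) * c i"
        unfolding I[OF \<open>i < n\<close>] by simp
      then show "(2 * of_real pi * \<i>) * (of_real (lam i) * h (of_real (lam i)) * c i) = (c i * I1 i - c i * I3 i) + c i * I2 i"
        by (simp add: algebra_simps)
    qed
    also have "\<dots> \<le> (nr (\<lambda>i. c i * I1 i) + nr (\<lambda>i. c i * I3 i)) + nr (\<lambda>i. c i * I2 i)"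
      by (rule order_trans[OF nr_add]) (simp add: nr_diff)
    also have "\<dots> \<le> (Mh * K / a * nr c + Mh * K / a * nr c) + ?E R"
    proof (intro add_mono)
      show "nr (\<lambda>i. c i * I1 i) \<le> Mh * K / a * nr c"
        by (rule ray_bound[OF \<theta> _ hb a K R(1) I1]) (use \<theta> in auto)
      show "nr (\<lambda>i. c i * I3 i) \<le> Mh * K / a * nr c"
        by (rule ray_bound[OF \<theta> _ hb a K R(1) I3]) (use \<theta> in auto)
      show "nr (\<lambda>i. c i * I2 i) \<le> ?E R"
      proof (rule order_trans[OF nr_coord_le], intro sum_mono mult_right_mono nr_nonneg)
        fix k assume "k \<in> {..<n}"
        then have "cmod (I2 k) \<le> (2 * K / (a * cos \<theta>)\<^sup>2) / (R * cos \<theta> - lam k)"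
          by (intro far_side_bound[OF \<theta>(1,2) hb a K lam_nonneg R(2) I2]) auto
        then show "cmod (c k * I2 k) \<le> cmod (c k) * ((2 * K / (a * cos \<theta>)\<^sup>2) * inverse (R * cos \<theta> - lam k))"
          unfolding norm_mult by (intro mult_left_mono) (auto simp: divide_inverse)
      qed
    qed
    finally show ?thesis by (simp only: mult_2[symmetric])
  qed
  have lim: "((\<lambda>R. inverse (R * cos \<theta> - l)) \<longlongrightarrow> 0) at_top" for l
  proof (rule tendsto_inverse_0_at_top)
    have "filterlim (\<lambda>R. - l + R * cos \<theta>) at_top at_top"
      by (intro filterlim_tendsto_add_at_top[OF tendsto_const] filterlim_at_top_mult_tendsto_pos[OF tendsto_const cp] filterlim_ident)
    then show "filterlim (\<lambda>R. R * cos \<theta> - l) at_top at_top" by simp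
  qed
  have "((\<lambda>R. 2 * (Mh * K / a * nr c) + ?E R) \<longlongrightarrow>
      2 * (Mh * K / a * nr c) + (\<Sum>k<n. cmod (c k) * ((2 * K / (a * cos \<theta>)\<^sup>2) * 0) * nr (\<lambda>i. if i = k then 1 else 0))) at_top"
    by (intro tendsto_intros lim)
  moreover have "\<forall>\<^sub>F R in at_top. 2 * pi * nr (\<lambda>i. of_real (lam i) * h (of_real (lam i)) * c i)
      \<le> 2 * (Mh * K / a * nr c) + ?E R"
  proof -
    have "\<forall>\<^sub>F R in at_top. \<forall>i\<in>{..<n}. lam i / cos \<theta> < R"
      by (rule eventually_ball_finite) (auto intro: eventually_gt_at_top)
    then have "\<forall>\<^sub>F R in at_top. 0 < R \<and> (\<forall>i\<in>{..<n}. lam i / cos \<theta> < R)"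
      by (intro eventually_conj eventually_gt_at_top)
    then show ?thesis
      by eventually_elim (intro bound; use cp in \<open>auto simp: pos_divide_less_eq\<close>)
  qed
  ultimately have "2 * pi * nr (\<lambda>i. of_real (lam i) * h (of_real (lam i)) * c i)
      \<le> 2 * (Mh * K / a * nr c)"
    by (simp add: tendsto_lowerbound)
  \<comment> \<open>The factor 1/\<pi> gained from Cauchy's formula is given away.\<close>
  moreover have "1 * nr (\<lambda>i. of_real (lam i) * h (of_real (lam i)) * c i)
      \<le> pi * nr (\<lambda>i. of_real (lam i) * h (of_real (lam i)) * c i)"
    using pi_gt3 by (intro mult_right_mono nr_nonneg) auto
  ultimately show ?thesis by linarith
qed

end

section \<open>The time-stepping scheme in spectral coordinates\<close>

text \<open>The lower bound is 1 + e1 + e2 in elementary symmetric functions, with e2 written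
  through power sums. The first conjunct says e2 >= 0, which the induction uses to discard the
  third-order term.\<close>

lemma prod_one_plus_ge:
  fixes a :: "'i \<Rightarrow> real"
  assumes "finite A" "\<And>p. p \<in> A \<Longrightarrow> 0 \<le> a p"
  shows "(\<Sum>p\<in>A. (a p)\<^sup>2) \<le> (\<Sum>p\<in>A. a p)\<^sup>2 \<and>
    1 + (\<Sum>p\<in>A. a p) + ((\<Sum>p\<in>A. a p)\<^sup>2 - (\<Sum>p\<in>A. (a p)\<^sup>2)) / 2 \<le> (\<Prod>p\<in>A. 1 + a p)"
  using assms
proof (induction A rule: finite_induct)
  case (insert x A)
  let ?S = "\<Sum>p\<in>A. a p" and ?Q = "\<Sum>p\<in>A. (a p)\<^sup>2"
  have IH: "?Q \<le> ?S\<^sup>2" "1 + ?S + (?S\<^sup>2 - ?Q) / 2 \<le> (\<Prod>p\<in>A. 1 + a p)" using insert by auto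
  have x: "0 \<le> a x" and S: "0 \<le> ?S" using insert by (auto intro: sum_nonneg)
  have "(1 + a x) * (1 + ?S + (?S\<^sup>2 - ?Q) / 2) \<le> (1 + a x) * (\<Prod>p\<in>A. 1 + a p)"
    using IH(2) x by (intro mult_left_mono) auto
  moreover have "0 \<le> a x * (?S\<^sup>2 - ?Q)" using x IH(1) by (intro mult_nonneg_nonneg) auto
  moreover have "0 \<le> a x * ?S" using x S by (rule mult_nonneg_nonneg)
  moreover have "1 + (a x + ?S) + ((a x + ?S)\<^sup>2 - ((a x)\<^sup>2 + ?Q)) / 2
      = (1 + a x) * (1 + ?S + (?S\<^sup>2 - ?Q) / 2) - a x * (?S\<^sup>2 - ?Q) / 2"
    by (simp add: power2_eq_square field_simps)
  moreover have "(a x + ?S)\<^sup>2 = (a x)\<^sup>2 + 2 * (a x * ?S) + ?S\<^sup>2"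
    by (simp add: power2_eq_square algebra_simps)
  ultimately have "(a x)\<^sup>2 + ?Q \<le> (a x + ?S)\<^sup>2"
    "1 + (a x + ?S) + ((a x + ?S)\<^sup>2 - ((a x)\<^sup>2 + ?Q)) / 2 \<le> (1 + a x) * (\<Prod>p\<in>A. 1 + a p)"
    using IH(1) by linarith+
  then show ?case using insert by simp
qed simp

text \<open>Since neighbouring step sizes are comparable, no single one dominates the sum; this
  makes the second elementary symmetric function comparable to the square of the sum.\<close>
lemma prod_neighbours_ge:
  fixes k :: "nat \<Rightarrow> real"
  assumes lm: "l < m" and k: "\<And>p. p \<in> {l..m} \<Longrightarrow> 0 < k p" and \<kappa>: "1 \<le> \<kappa>"
    and nb: "\<And>p. p \<in> {l..<m} \<Longrightarrow> k p \<le> \<kappa> * k (Suc p) \<and> k (Suc p) \<le> \<kappa> * k p"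
    and x: "0 \<le> x"
  shows "(1 + (\<Sum>p=l..m. k p) / (2 * (1 + \<kappa>)) * x)\<^sup>2 \<le> (\<Prod>p=l..m. 1 + k p * x)"
proof -
  let ?T = "\<Sum>p=l..m. k p"
  have T0: "0 \<le> ?T" using k by (intro sum_nonneg) (auto intro: less_imp_le)
  have "k p * ?T \<le> (1 + \<kappa>) * (k p * (?T - k p))" if p: "p \<in> {l..m}" for p
  proof -
    \<comment> \<open>A neighbour inside the range: the next index, or the previous one at the right
      end. One of them exists because l < m.\<close>
    obtain p' where p': "p' \<in> {l..m}" "p' \<noteq> p" "k p \<le> \<kappa> * k p'"
    proof (cases "p < m")
      case True
      then show ?thesis using that[of "Suc p"] nb[of p] p by auto
    next
      case False
      then show ?thesis using that[of "p - 1"] nb[of "p - 1"] p lm by auto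
    qed
    have "k p + k p' = sum k {p, p'}" using p' by simp
    also have "\<dots> \<le> ?T" using p p' k by (intro sum_mono2) (auto intro: less_imp_le)
    finally have "k p' \<le> ?T - k p" by simp
    then have "\<kappa> * k p' \<le> \<kappa> * (?T - k p)" using \<kappa> by (intro mult_left_mono) auto
    then have "?T \<le> (1 + \<kappa>) * (?T - k p)" using p'(3) by (simp add: algebra_simps)
    then show ?thesis using mult_left_mono[of ?T "(1 + \<kappa>) * (?T - k p)" "k p"] k[OF p] by (simp add: mult_ac)
  qed
  then have "(\<Sum>p=l..m. k p * ?T) \<le> (\<Sum>p=l..m. (1 + \<kappa>) * (k p * (?T - k p)))"
    by (intro sum_mono) auto
  then have "?T\<^sup>2 \<le> (1 + \<kappa>) * (?T\<^sup>2 - (\<Sum>p=l..m. (k p)\<^sup>2))"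
    unfolding sum_distrib_left[symmetric] sum_distrib_right[symmetric] right_diff_distrib sum_subtractf
    by (simp add: power2_eq_square algebra_simps)
  then have e2: "?T\<^sup>2 / (1 + \<kappa>) \<le> ?T\<^sup>2 - (\<Sum>p=l..m. (k p)\<^sup>2)"
    using \<kappa> by (simp add: pos_divide_le_eq mult.commute)
  \<comment> \<open>With this b, both 2b <= 1 and b^2 <= 1/(2(1 + \<kappa>)), so the square lies
    below 1 + e1 + e2 term by term.\<close>
  define b where "b = 1 / (2 * (1 + \<kappa>))"
  have b: "0 < b" "b \<le> 1 / 2" using \<kappa> by (auto simp: b_def divide_simps)
  have "b * b \<le> 1 / 2 * b" using b by (intro mult_right_mono) auto
  then have b2: "b * b \<le> 1 / (2 * (1 + \<kappa>))" using b unfolding b_def[symmetric] by linarith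
  have "(1 + ?T / (2 * (1 + \<kappa>)) * x)\<^sup>2 = (1 + b * (?T * x))\<^sup>2" by (simp add: b_def)
  also have "\<dots> = 1 + (2 * b) * (?T * x) + (b * b) * (?T * x)\<^sup>2" by (simp add: power2_eq_square algebra_simps)
  also have "\<dots> \<le> 1 + 1 * (?T * x) + (1 / (2 * (1 + \<kappa>))) * (?T * x)\<^sup>2"
    using b b2 T0 x by (intro add_mono mult_right_mono mult_nonneg_nonneg) auto
  also have "\<dots> = 1 + ?T * x + (?T\<^sup>2 / (1 + \<kappa>)) * x\<^sup>2 / 2" by (simp add: power_mult_distrib)
  also have "\<dots> \<le> 1 + ?T * x + (?T\<^sup>2 - (\<Sum>p=l..m. (k p)\<^sup>2)) * x\<^sup>2 / 2"
    using e2 by (intro add_left_mono divide_right_mono mult_right_mono) auto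
  also have "\<dots> = 1 + (\<Sum>p=l..m. k p * x) + ((\<Sum>p=l..m. k p * x)\<^sup>2 - (\<Sum>p=l..m. (k p * x)\<^sup>2)) / 2"
    by (simp add: sum_distrib_right[symmetric] power_mult_distrib left_diff_distrib)
  also have "\<dots> \<le> (\<Prod>p=l..m. 1 + k p * x)"
    using prod_one_plus_ge[of "{l..m}" "\<lambda>p. k p * x"] k x by (auto intro: less_imp_le mult_nonneg_nonneg)
  finally show ?thesis .
qed

lemma refS_scaled_holomorphic:
  assumes "0 < \<delta>" "j \<le> q" "l \<le> q" "0 \<le> k"
  shows "(\<lambda>z. refS q (of_real k * z) j l) holomorphic_on wedge \<delta>"
proof -
  have "(\<lambda>z. refS q z j l) \<circ> (\<lambda>z. of_real k * z) holomorphic_on wedge \<delta>"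
    using refS_holomorphic[OF assms(1-3)] wedge_scale assms(4)
    by (intro holomorphic_on_compose_gen[where t = "wedge \<delta>"] holomorphic_intros) auto
  then show ?thesis by (simp add: o_def)
qed

section \<open>Constants depending on the degree and the angle\<close>

text \<open>These constants are fixed from q and \<theta> before a mesh, a norm or an eigenvalue is
  introduced, which is what makes the final constant independent of them. The bound
  \<open>cr\<close> <= 1 lets all step factors be brought to the common form 1/(1 + cr
  k|z|).\<close>

locale ref_bounds =
  fixes q :: nat and \<theta> CS cr K :: real and R :: "nat \<Rightarrow> nat \<Rightarrow> complex"
  assumes \<theta>: "0 < \<theta>" "\<theta> < pi / 2"
    and CS1: "1 \<le> CS"
    and CS: "z \<in> wedge (cos \<theta>) \<Longrightarrow> j \<le> q \<Longrightarrow> l \<le> q \<Longrightarrow> cmod (refS q z j l) \<le> CS / (1 + cmod z)"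
    and cr01: "0 < cr" "cr \<le> 1"
    and cr: "z \<in> wedge (cos \<theta>) \<Longrightarrow> cmod (refr q z) \<le> 1 / (1 + cr * cmod z)"
    and K0: "0 \<le> K"
    and K: "z \<in> wedge (cos \<theta>) \<Longrightarrow> j \<le> q \<Longrightarrow> l \<le> q \<Longrightarrow>
              cmod (refS q z j l - R j l / (1 + z)) \<le> K / (1 + cmod z)\<^sup>2"

lemma ref_bounds_exist:
  assumes \<theta>: "0 < \<theta>" "\<theta> < pi / 2"
  shows "\<exists>CS cr K R. ref_bounds q \<theta> CS cr K R"
proof -
  have c: "0 < cos \<theta>" using cos_pos[OF \<theta>] .
  obtain CS where CS: "1 \<le> CS" "\<forall>z\<in>wedge (cos \<theta>). \<forall>j\<le>q. \<forall>l\<le>q. cmod (refS q z j l) \<le> CS / (1 + cmod z)"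
    using refS_bound[OF c] by metis
  obtain c0 where c0: "0 < c0" "\<forall>z\<in>wedge (cos \<theta>). cmod (refr q z) \<le> 1 / (1 + c0 * cmod z)"
    using refr_bound[OF c] by metis
  obtain R K where K: "0 \<le> K" "\<forall>z\<in>wedge (cos \<theta>). \<forall>j\<le>q. \<forall>l\<le>q.
           cmod (refS q z j l - R j l / (1 + z)) \<le> K / (1 + cmod z)\<^sup>2"
    using refS_split[OF c] by metis
  have "cmod (refr q z) \<le> 1 / (1 + min c0 1 * cmod z)" if "z \<in> wedge (cos \<theta>)" for z
  proof -
    have "1 / (1 + c0 * cmod z) \<le> 1 / (1 + min c0 1 * cmod z)"
      using c0(1) by (intro divide_left_mono mult_pos_pos add_left_mono mult_right_mono) (auto simp: add_pos_nonneg)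
    with c0(2) that show ?thesis by fastforce
  qed
  then have "ref_bounds q \<theta> CS (min c0 1) K R"
    by unfold_locales (use \<theta> CS c0(1) K in auto)
  then show ?thesis by blast
qed

text \<open>\<open>Y m j p\<close> is the coefficient of the j-th power of local time on step m in
  eigendirection p, \<open>F m i p\<close> the i-th moment of the source divided by the step length,
  and \<open>D m\<close> a common bound for the norms of these moments.\<close>

locale dg_scheme = sectorial n nr lam Mh \<gamma> + ref_bounds q \<theta> CS cr K R
  for n nr lam Mh \<gamma> q \<theta> CS cr K R +
  fixes \<kappa> :: real and M :: nat and k :: "nat \<Rightarrow> real"
    and F Y :: "nat \<Rightarrow> nat \<Rightarrow> nat \<Rightarrow> complex" and D :: "nat \<Rightarrow> real"
  assumes \<gamma>\<theta>: "\<gamma> < \<theta>" and \<gamma>0: "0 < \<gamma>" and \<kappa>: "1 \<le> \<kappa>"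
    and k_pos: "1 \<le> m \<Longrightarrow> m \<le> M \<Longrightarrow> 0 < k m"
    and k_nb: "1 \<le> m \<Longrightarrow> m < M \<Longrightarrow> k m \<le> \<kappa> * k (Suc m) \<and> k (Suc m) \<le> \<kappa> * k m"
    and scheme: "1 \<le> m \<Longrightarrow> m \<le> M \<Longrightarrow> i \<le> q \<Longrightarrow> p < n \<Longrightarrow>
        (\<Sum>j\<le>q. refB (of_real (k m * lam p)) i j * Y m j p)
          = (if i = 0 \<and> 1 < m then \<Sum>j\<le>q. Y (m - 1) j p else 0) + of_real (k m) * F m i p"
    and D: "1 \<le> m \<Longrightarrow> m \<le> M \<Longrightarrow> i \<le> q \<Longrightarrow> nr (F m i) \<le> D m"
begin

text \<open>End value of a step produced by a unit load in row i; \<open>sg 0\<close> is the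
  stability function.\<close>

definition "sg i z = (\<Sum>j\<le>q. refS q z j i)"

text \<open>Left limit of the solution at t_m; the value for m = 0 encodes the zero initial
  condition.\<close>

definition "um m p = (if m = 0 then 0 else \<Sum>j\<le>q. Y m j p)"

text \<open>The distance t_m - t_(l-1), with both end steps included.\<close>

definition "len l m = (\<Sum>p=l..m. k p)"

definition "bsum m = (\<Sum>l=1..m. k l / len l m * D l)"

lemma cos\<theta>: "0 < cos \<theta>" using cos_pos[OF \<theta>] .

lemma lam_wedge: "p < n \<Longrightarrow> 1 \<le> m \<Longrightarrow> m \<le> M \<Longrightarrow> of_real (k m * lam p) \<in> wedge (cos \<theta>)"
  using k_pos[of m] lam_nonneg[of p] by (intro wedge_real) auto

lemma Y_eq:
  assumes m: "1 \<le> m" "m \<le> M" and j: "j \<le> q" and p: "p < n"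
  shows "Y m j p = refS q (of_real (k m * lam p)) j 0 * um (m - 1) p
           + of_real (k m) * (\<Sum>i\<le>q. refS q (of_real (k m * lam p)) j i * F m i p)"
proof -
  let ?S = "refS q (of_real (k m * lam p))"
  have "Y m j p = (\<Sum>i\<le>q. ?S j i * ((if i = 0 then um (m - 1) p else 0) + of_real (k m) * F m i p))"
  proof (rule refS_unique[OF cos\<theta> lam_wedge[OF p m] _ j])
    fix i assume "i \<le> q"
    from scheme[OF m this p] m show "(\<Sum>j\<le>q. refB (of_real (k m * lam p)) i j * Y m j p)
      = (if i = 0 then um (m - 1) p else 0) + of_real (k m) * F m i p"
      by (auto simp: um_def)
  qed
  also have "\<dots> = (\<Sum>i\<le>q. if i = 0 then ?S j 0 * um (m - 1) p else 0) + (\<Sum>i\<le>q. ?S j i * (of_real (k m) * F m i p))"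
    unfolding sum.distrib[symmetric] by (intro sum.cong) (auto simp: algebra_simps)
  finally show ?thesis by (simp add: sum_distrib_left mult_ac)
qed

lemma um_step:
  assumes m: "1 \<le> m" "m \<le> M" and p: "p < n"
  shows "um m p = refr q (of_real (k m * lam p)) * um (m - 1) p
           + of_real (k m) * (\<Sum>i\<le>q. sg i (of_real (k m * lam p)) * F m i p)"
proof -
  let ?S = "refS q (of_real (k m * lam p))"
  have "um m p = (\<Sum>j\<le>q. ?S j 0 * um (m - 1) p + of_real (k m) * (\<Sum>i\<le>q. ?S j i * F m i p))"
  proof -
    have "um m p = (\<Sum>j\<le>q. Y m j p)" using m by (simp add: um_def)
    also have "\<dots> = (\<Sum>j\<le>q. ?S j 0 * um (m - 1) p + of_real (k m) * (\<Sum>i\<le>q. ?S j i * F m i p))"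
      by (intro sum.cong refl Y_eq m p) simp
    finally show ?thesis .
  qed
  also have "\<dots> = refr q (of_real (k m * lam p)) * um (m - 1) p + of_real (k m) * (\<Sum>j\<le>q. \<Sum>i\<le>q. ?S j i * F m i p)"
    by (simp add: sum.distrib refr_def sum_distrib_right sum_distrib_left)
  also have "(\<Sum>j\<le>q. \<Sum>i\<le>q. ?S j i * F m i p) = (\<Sum>i\<le>q. sg i (of_real (k m * lam p)) * F m i p)"
    by (subst sum.swap) (simp add: sg_def sum_distrib_right)
  finally show ?thesis .
qed

text \<open>Discrete variation of constants: the source of step l is carried forward by the
  stability functions of the steps l + 1, ..., m.\<close>

lemma um_duhamel:
  assumes "m \<le> M" and p: "p < n"
  shows "um m p = (\<Sum>l=1..m. \<Sum>i\<le>q. of_real (k l) * (\<Prod>j=Suc l..m. refr q (of_real (k j * lam p)))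
             * sg i (of_real (k l * lam p)) * F l i p)"
  using assms(1)
proof (induction m)
  case 0
  then show ?case by (simp add: um_def)
next
  case (Suc m)
  let ?r = "\<lambda>j. refr q (of_real (k j * lam p))"
  have "um (Suc m) p = ?r (Suc m) * um m p + of_real (k (Suc m)) * (\<Sum>i\<le>q. sg i (of_real (k (Suc m) * lam p)) * F (Suc m) i p)"
    using um_step[of "Suc m" p] Suc.prems p by simp
  also have "?r (Suc m) * um m p = (\<Sum>l=1..m. \<Sum>i\<le>q. of_real (k l) * (\<Prod>j=Suc l..Suc m. ?r j)
             * sg i (of_real (k l * lam p)) * F l i p)"
    unfolding Suc.IH[OF Suc_leD[OF Suc.prems]] sum_distrib_left
    by (intro sum.cong refl) (simp add: prod.nat_ivl_Suc' mult_ac)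
  finally show ?case by (simp add: sum_distrib_left mult_ac)
qed

text \<open>The kernel from moment i of the source on step l to coefficient j of the solution on
  step m, for l < m: load at l, propagation through the steps strictly between, solution at
  m.\<close>

definition "hk m j l i z = of_real (k l) * refS q (of_real (k m) * z) j 0
   * (\<Prod>p=Suc l..m - 1. refr q (of_real (k p) * z)) * sg i (of_real (k l) * z)"

lemma lamY_eq:
  assumes m: "1 \<le> m" "m \<le> M" and j: "j \<le> q" and p: "p < n"
  shows "of_real (lam p) * Y m j p =
     (\<Sum>l=1..m - 1. \<Sum>i\<le>q. of_real (lam p) * hk m j l i (of_real (lam p)) * F l i p)
     + (\<Sum>i\<le>q. of_real (k m * lam p) * refS q (of_real (k m * lam p)) j i * F m i p)"
  unfolding Y_eq[OF assms] distrib_left um_duhamel[OF le_trans[OF diff_le_self m(2)] p] hk_def sum_distrib_left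
  by (intro arg_cong2[of _ _ _ _ "(+)"] sum.cong refl) (simp_all add: mult_ac)

lemma len_pos: "1 \<le> l \<Longrightarrow> l \<le> m \<Longrightarrow> m \<le> M \<Longrightarrow> 0 < len l m"
  unfolding len_def using k_pos by (intro sum_pos) auto

lemma hk_holomorphic:
  assumes "1 \<le> l" "l < m" "m \<le> M" "j \<le> q" "i \<le> q"
  shows "hk m j l i holomorphic_on wedge (cos \<theta>)"
proof -
  have "0 \<le> k p" if "1 \<le> p" "p \<le> m" for p using k_pos[of p] that assms by simp
  then show ?thesis
    unfolding hk_def[abs_def] sg_def refr_def using assms
    by (intro holomorphic_intros refS_scaled_holomorphic cos\<theta>) auto
qed

text \<open>The factors at the two ends come from \<open>refS\<close>; up to a power of
  \<open>CS\<close> and a factor q + 1 they obey the same bound as the stability functions in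
  between, so the product extends over all steps from l to m and \<open>prod_neighbours_ge\<close>
  applies to the steps cr * k.\<close>

lemma hk_bound:
  assumes l: "1 \<le> l" "l < m" "m \<le> M" "j \<le> q" "i \<le> q" and z: "z \<in> wedge (cos \<theta>)"
  shows "cmod (hk m j l i z) \<le> (real (q + 1) * CS\<^sup>2 * k l) / (1 + cr * len l m / (2 * (1 + \<kappa>)) * cmod z)\<^sup>2"
proof -
  let ?x = "cmod z"
  have kp: "0 < k p" if "p \<in> {l..m}" for p using k_pos[of p] that assms by simp
  have sc: "of_real (k p) * z \<in> wedge (cos \<theta>)" "cmod (of_real (k p) * z) = k p * ?x" if "p \<in> {l..m}" for p
    using kp[OF that] by (auto intro!: wedge_scale z simp: norm_mult)
  have crx: "1 + cr * (k p * ?x) \<le> 1 + k p * ?x" "0 < 1 + cr * (k p * ?x)" "0 < 1 + k p * ?x" if "p \<in> {l..m}" for p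
    using kp[OF that] cr01 by (auto intro!: add_pos_nonneg mult_left_le_one_le)
  have S1: "cmod (refS q (of_real (k p) * z) a b) \<le> CS * (1 / (1 + cr * (k p * ?x)))"
    if "p \<in> {l..m}" "a \<le> q" "b \<le> q" for p a b
  proof -
    have "cmod (refS q (of_real (k p) * z) a b) \<le> CS / (1 + k p * ?x)"
      using CS[OF sc(1)[OF that(1)] that(2,3)] sc(2)[OF that(1)] by simp
    also have "\<dots> \<le> CS / (1 + cr * (k p * ?x))"
      using crx[OF that(1)] CS1 by (intro divide_left_mono mult_pos_pos) auto
    finally show ?thesis by simp
  qed
  have sg1: "cmod (sg i (of_real (k l) * z)) \<le> real (q + 1) * CS * (1 / (1 + cr * (k l * ?x)))"
  proof -
    have "cmod (sg i (of_real (k l) * z)) \<le> (\<Sum>j\<le>q. CS * (1 / (1 + cr * (k l * ?x))))"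
      unfolding sg_def using l by (intro sum_norm_le S1) auto
    then show ?thesis by simp
  qed
  have pr: "cmod (\<Prod>p=Suc l..m - 1. refr q (of_real (k p) * z)) \<le> (\<Prod>p=Suc l..m - 1. 1 / (1 + cr * (k p * ?x)))"
    unfolding prod_norm[symmetric]
  proof (intro prod_mono conjI norm_ge_zero)
    fix p assume "p \<in> {Suc l..m - 1}"
    then have "p \<in> {l..m}" by auto
    then show "cmod (refr q (of_real (k p) * z)) \<le> 1 / (1 + cr * (k p * ?x))"
      using cr[OF sc(1)] sc(2) by metis
  qed
  let ?g = "\<lambda>p. 1 / (1 + cr * (k p * ?x))"
  have g0: "0 < ?g p" if "p \<in> {l..m}" for p using crx(2)[OF that] by simp
  have gp0: "0 \<le> (\<Prod>p=Suc l..m - 1. ?g p)" by (intro prod_nonneg ballI less_imp_le g0) auto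
  have "cmod (hk m j l i z) \<le> k l * (CS * ?g m) * (\<Prod>p=Suc l..m - 1. ?g p) * (real (q + 1) * CS * ?g l)"
    unfolding hk_def norm_mult using kp l S1[of m j 0] sg1 pr gp0 CS1 g0[of l] g0[of m]
    by (intro mult_mono mult_nonneg_nonneg) (auto intro: less_imp_le)
  also have "\<dots> = real (q + 1) * CS\<^sup>2 * k l * (?g l * (\<Prod>p=Suc l..m - 1. ?g p) * ?g m)"
    by (simp only: power2_eq_square mult_ac)
  also have "?g l * (\<Prod>p=Suc l..m - 1. ?g p) * ?g m = (\<Prod>p=l..m. ?g p)"
  proof -
    obtain m' where m': "m = Suc m'" "l \<le> m'" using l by (cases m) auto
    then show ?thesis by (simp add: prod.nat_ivl_Suc' prod.atLeast_Suc_atMost mult_ac)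
  qed
  also have "\<dots> = 1 / (\<Prod>p=l..m. 1 + (cr * k p) * ?x)" by (simp add: prod_dividef mult_ac)
  also have "real (q + 1) * CS\<^sup>2 * k l * (1 / (\<Prod>p=l..m. 1 + (cr * k p) * ?x))
      \<le> real (q + 1) * CS\<^sup>2 * k l * (1 / (1 + (\<Sum>p=l..m. cr * k p) / (2 * (1 + \<kappa>)) * ?x)\<^sup>2)"
  proof (intro mult_left_mono divide_left_mono mult_pos_pos)
    show "(1 + (\<Sum>p=l..m. cr * k p) / (2 * (1 + \<kappa>)) * ?x)\<^sup>2 \<le> (\<Prod>p=l..m. 1 + (cr * k p) * ?x)"
    proof (rule prod_neighbours_ge)
      fix p assume p: "p \<in> {l..<m}"
      show "cr * k p \<le> \<kappa> * (cr * k (Suc p)) \<and> cr * k (Suc p) \<le> \<kappa> * (cr * k p)"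
        using k_nb[of p] p l cr01 by (auto simp: mult.left_commute[of \<kappa>])
    qed (use l kp cr01 \<kappa> in auto)
    have T0: "0 \<le> (\<Sum>p=l..m. cr * k p)" using kp cr01 by (intro sum_nonneg) (auto intro: less_imp_le)
    show "0 < (1 + (\<Sum>p=l..m. cr * k p) / (2 * (1 + \<kappa>)) * ?x)\<^sup>2"
      using T0 \<kappa> by (intro zero_less_power add_pos_nonneg) auto
    show "0 < (\<Prod>p=l..m. 1 + (cr * k p) * ?x)"
      using crx(2) by (intro prod_pos) (auto simp: mult.assoc)
    show "0 \<le> real (q + 1) * CS\<^sup>2 * k l" using kp[of l] l by simp
  qed auto
  finally show ?thesis by (simp add: len_def sum_distrib_left[symmetric])
qed

text \<open>The functional calculus with a proportional to \<open>len l m\<close> turns the decay in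
  z into the weight \<open>k l / len l m\<close>.\<close>

lemma hk_nr_bound:
  assumes l: "1 \<le> l" "l < m" "m \<le> M" "j \<le> q" "i \<le> q"
  shows "nr (\<lambda>p. of_real (lam p) * hk m j l i (of_real (lam p)) * F l i p)
     \<le> (2 * (1 + \<kappa>) * real (q + 1) * CS\<^sup>2 / cr) * Mh * (k l / len l m * D l)"
proof -
  have L: "0 < len l m" and kl: "0 < k l" using len_pos[of l m] k_pos[of l] l by auto
  have "nr (\<lambda>p. of_real (lam p) * hk m j l i (of_real (lam p)) * F l i p)
      \<le> Mh * (real (q + 1) * CS\<^sup>2 * k l) / (cr * len l m / (2 * (1 + \<kappa>))) * nr (F l i)"
    by (rule functional_calculus_bound[OF \<theta> \<gamma>\<theta> hk_holomorphic[OF l] hk_bound[OF l]])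
       (use L cr01 \<kappa> kl in auto)
  also have "\<dots> \<le> Mh * (real (q + 1) * CS\<^sup>2 * k l) / (cr * len l m / (2 * (1 + \<kappa>))) * D l"
    using D[of l i] l L cr01 \<kappa> kl Mh_nonneg by (intro mult_left_mono) auto
  also have "\<dots> = (2 * (1 + \<kappa>) * real (q + 1) * CS\<^sup>2 / cr) * Mh * (k l / len l m * D l)"
    by (simp add: mult_ac)
  finally show ?thesis .
qed

lemma neg_not_sector: "0 < x \<Longrightarrow> - complex_of_real x \<notin> sector \<gamma>"
  using \<theta> \<gamma>\<theta> Arg_of_real[of "- x"] pi_gt_zero unfolding sector_def by (auto simp del: pi_gt_zero)

text \<open>The Yosida approximation: h\<lambda>/(1 + h\<lambda>) = 1 + (1/h)/(z - \<lambda>) at the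
  negative real point z = -1/h, where the resolvent is bounded by h Mh.\<close>

lemma yosida_bound:
  assumes "0 < h"
  shows "nr (\<lambda>p. of_real (h * lam p) / (1 + of_real (h * lam p)) * c p) \<le> (1 + Mh) * nr c"
proof -
  let ?z = "- complex_of_real (1 / h)"
  have "nr (\<lambda>p. of_real (h * lam p) / (1 + of_real (h * lam p)) * c p)
      = nr (\<lambda>p. c p + of_real (1 / h) * (c p / (?z - of_real (lam p))))"
  proof (rule nr_cong)
    fix p assume "p < n"
    then have "0 \<le> h * lam p" using lam_nonneg assms by simp
    then have nz: "1 + complex_of_real (h * lam p) \<noteq> 0" by (auto simp: complex_eq_iff)
    define u where "u = 1 + complex_of_real (h * lam p)"
    have "?z - of_real (lam p) = - u / of_real h"
      using assms by (simp add: field_simps u_def)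
    then have "of_real (1 / h) * (c p / (?z - of_real (lam p))) = - (c p / u)"
      using assms by simp
    then show "of_real (h * lam p) / (1 + of_real (h * lam p)) * c p
        = c p + of_real (1 / h) * (c p / (?z - of_real (lam p)))"
    proof -
      have e: "of_real (h * lam p) = u - 1" and u0: "u \<noteq> 0" using nz by (auto simp: u_def)
      have "of_real (h * lam p) / u * c p = c p - c p / u"
        unfolding e using u0 by (simp add: field_simps)
      with \<open>of_real (1 / h) * (c p / (?z - of_real (lam p))) = - (c p / u)\<close> show ?thesis
        by (simp only: u_def[symmetric]) simp
    qed
  qed
  also have "\<dots> \<le> nr c + cmod (of_real (1 / h)) * nr (\<lambda>p. c p / (?z - of_real (lam p)))"
    using nr_add[of c "\<lambda>p. of_real (1 / h) * (c p / (?z - of_real (lam p)))"] unfolding nr_scale .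
  also have "\<dots> \<le> nr c + cmod (of_real (1 / h)) * (Mh / cmod ?z * nr c)"
    using assms by (intro add_left_mono mult_left_mono resolvent neg_not_sector) auto
  also have "cmod (of_real (1 / h)) * (Mh / cmod ?z * nr c) = Mh * nr c"
    using assms by (simp add: norm_divide)
  finally show ?thesis by (simp add: algebra_simps)
qed

text \<open>The decay of \<open>refS\<close> alone is too slow for the contour integral. Subtracting
  R/(1 + kz) leaves second-order decay, and the subtracted part is a Yosida approximation; 1 + Mh <=
  3 Mh by \<open>Mh_half\<close>.\<close>

lemma diag_bound:
  assumes m: "1 \<le> m" "m \<le> M" "j \<le> q" "i \<le> q"
  shows "nr (\<lambda>p. of_real (k m * lam p) * refS q (of_real (k m * lam p)) j i * F m i p)
     \<le> (K + 3 * cmod (R j i)) * Mh * D m"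
proof -
  have km: "0 < k m" using k_pos m by simp
  let ?h = "\<lambda>z. of_real (k m) * (refS q (of_real (k m) * z) j i - R j i / (1 + of_real (k m) * z))"
  have one: "1 + of_real (k m) * z \<noteq> 0" if "z \<in> wedge (cos \<theta>)" for z
  proof -
    have "0 \<le> Re (of_real (k m) * z)" using wedge_Re_nonneg[OF cos\<theta> that] km by simp
    then show ?thesis by (auto simp: complex_eq_iff)
  qed
  have "nr (\<lambda>p. of_real (k m * lam p) * refS q (of_real (k m * lam p)) j i * F m i p)
      = nr (\<lambda>p. of_real (lam p) * ?h (of_real (lam p)) * F m i p
               + R j i * (of_real (k m * lam p) / (1 + of_real (k m * lam p)) * F m i p))"
    by (rule nr_cong) (simp add: algebra_simps)
  also have "\<dots> \<le> nr (\<lambda>p. of_real (lam p) * ?h (of_real (lam p)) * F m i p)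
      + cmod (R j i) * nr (\<lambda>p. of_real (k m * lam p) / (1 + of_real (k m * lam p)) * F m i p)"
    unfolding nr_scale[symmetric] by (rule nr_add)
  also have "\<dots> \<le> Mh * (k m * K) / k m * nr (F m i) + cmod (R j i) * ((1 + Mh) * nr (F m i))"
  proof (intro add_mono mult_left_mono yosida_bound km norm_ge_zero)
    show "nr (\<lambda>p. of_real (lam p) * ?h (of_real (lam p)) * F m i p) \<le> Mh * (k m * K) / k m * nr (F m i)"
    proof (rule functional_calculus_bound[OF \<theta> \<gamma>\<theta>])
      show "?h holomorphic_on wedge (cos \<theta>)"
        using m km one by (intro holomorphic_intros refS_scaled_holomorphic cos\<theta>) auto
      show "cmod (?h z) \<le> k m * K / (1 + k m * cmod z)\<^sup>2" if "z \<in> wedge (cos \<theta>)" for z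
      proof -
        have *: "cmod (refS q (of_real (k m) * z) j i - R j i / (1 + of_real (k m) * z)) \<le> K / (1 + cmod (of_real (k m) * z))\<^sup>2"
          using km m by (intro K wedge_scale that) auto
        then show ?thesis
          using km mult_left_mono[OF *, of "k m"] by (simp add: norm_mult)
      qed
    qed (use km K0 in auto)
  qed
  also have "\<dots> \<le> Mh * K * D m + cmod (R j i) * (3 * Mh * D m)"
  proof (rule add_mono)
    show "Mh * (k m * K) / k m * nr (F m i) \<le> Mh * K * D m"
      using km D[of m i] m Mh_nonneg K0 by (simp add: mult_left_mono)
    have "(1 + Mh) * nr (F m i) \<le> 3 * Mh * D m"
      using D[of m i] m Mh_half nr_nonneg by (intro mult_mono) auto
    then show "cmod (R j i) * ((1 + Mh) * nr (F m i)) \<le> cmod (R j i) * (3 * Mh * D m)"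
      by (rule mult_left_mono) simp
  qed
  finally show ?thesis by (simp add: algebra_simps)
qed

definition "RC = (\<Sum>j\<le>q. \<Sum>i\<le>q. cmod (R j i))"

text \<open>Built from q, \<kappa> and the constants of \<open>ref_bounds\<close> alone; the first
  summand collects the earlier steps, the second the current one.\<close>

definition "C1 = real (q + 1) * (2 * (1 + \<kappa>) * real (q + 1) * CS\<^sup>2 / cr) + real (q + 1) * (K + 3 * RC)"

lemma RC: "j \<le> q \<Longrightarrow> i \<le> q \<Longrightarrow> cmod (R j i) \<le> RC"
proof -
  assume ji: "j \<le> q" "i \<le> q"
  have "cmod (R j i) \<le> (\<Sum>i\<le>q. cmod (R j i))"
    using ji by (intro member_le_sum[where f="\<lambda>i. cmod (R j i)"]) auto
  also have "\<dots> \<le> RC" unfolding RC_def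
    using ji by (intro member_le_sum[where f="\<lambda>j. \<Sum>i\<le>q. cmod (R j i)"]) (auto intro: sum_nonneg)
  finally show ?thesis .
qed

lemma D_nonneg: "1 \<le> m \<Longrightarrow> m \<le> M \<Longrightarrow> 0 \<le> D m"
  using order_trans[OF nr_nonneg D[of m 0]] by simp

text \<open>The weight of l = m equals 1 and all others are nonnegative.\<close>

lemma bsum_ge: "1 \<le> m \<Longrightarrow> m \<le> M \<Longrightarrow> D m \<le> bsum m"
proof -
  assume m: "1 \<le> m" "m \<le> M"
  have "k m / len m m * D m \<le> bsum m"
    unfolding bsum_def
  proof (rule member_le_sum[where f="\<lambda>l. k l / len l m * D l"])
    fix l assume "l \<in> {1..m} - {m}"
    then show "0 \<le> k l / len l m * D l"
      using D_nonneg[of l] k_pos[of l] len_pos[of l m] m by auto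
  qed (use m in auto)
  then show ?thesis using k_pos[OF m] by (simp add: len_def)
qed

lemma C1_nonneg: "0 \<le> C1"
  unfolding C1_def RC_def using \<kappa> cr01 K0
  by (intro add_nonneg_nonneg mult_nonneg_nonneg divide_nonneg_nonneg sum_nonneg) auto

theorem lamY_bound:
  assumes m: "1 \<le> m" "m \<le> M" and j: "j \<le> q"
  shows "nr (\<lambda>p. of_real (lam p) * Y m j p) \<le> C1 * Mh * bsum m"
proof -
  let ?c = "2 * (1 + \<kappa>) * real (q + 1) * CS\<^sup>2 / cr"
  have c0: "0 \<le> ?c" using \<kappa> cr01 by simp
  have RC0: "0 \<le> RC" using RC[of 0 0] norm_ge_zero order_trans by blast
  have "nr (\<lambda>p. of_real (lam p) * Y m j p)
     = nr (\<lambda>p. (\<Sum>l=1..m - 1. \<Sum>i\<le>q. of_real (lam p) * hk m j l i (of_real (lam p)) * F l i p)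
     + (\<Sum>i\<le>q. of_real (k m * lam p) * refS q (of_real (k m * lam p)) j i * F m i p))"
    by (rule nr_cong) (rule lamY_eq[OF assms])
  also have "\<dots> \<le> nr (\<lambda>p. \<Sum>l=1..m - 1. \<Sum>i\<le>q. of_real (lam p) * hk m j l i (of_real (lam p)) * F l i p)
     + nr (\<lambda>p. \<Sum>i\<le>q. of_real (k m * lam p) * refS q (of_real (k m * lam p)) j i * F m i p)"
    by (rule nr_add)
  also have "\<dots> \<le> (\<Sum>l=1..m - 1. \<Sum>i\<le>q. ?c * Mh * (k l / len l m * D l)) + (\<Sum>i\<le>q. (K + 3 * RC) * Mh * D m)"
  proof (intro add_mono)
    show "nr (\<lambda>p. \<Sum>l=1..m - 1. \<Sum>i\<le>q. of_real (lam p) * hk m j l i (of_real (lam p)) * F l i p)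
      \<le> (\<Sum>l=1..m - 1. \<Sum>i\<le>q. ?c * Mh * (k l / len l m * D l))"
    proof (rule order_trans[OF nr_sum], simp, rule sum_mono)
      fix l assume l: "l \<in> {1..m - 1}"
      show "nr (\<lambda>p. \<Sum>i\<le>q. of_real (lam p) * hk m j l i (of_real (lam p)) * F l i p) \<le> (\<Sum>i\<le>q. ?c * Mh * (k l / len l m * D l))"
        by (rule order_trans[OF nr_sum], simp, rule sum_mono, rule hk_nr_bound) (use l m j in auto)
    qed
    show "nr (\<lambda>p. \<Sum>i\<le>q. of_real (k m * lam p) * refS q (of_real (k m * lam p)) j i * F m i p)
      \<le> (\<Sum>i\<le>q. (K + 3 * RC) * Mh * D m)"
    proof (rule order_trans[OF nr_sum], simp, rule sum_mono)
      fix i assume "i \<in> {..q}"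
      then have "nr (\<lambda>p. of_real (k m * lam p) * refS q (of_real (k m * lam p)) j i * F m i p)
        \<le> (K + 3 * cmod (R j i)) * Mh * D m" using m j by (intro diag_bound) auto
      also have "\<dots> \<le> (K + 3 * RC) * Mh * D m"
        using RC[OF j] \<open>i \<in> _\<close> D_nonneg[OF m] Mh_nonneg by (intro mult_right_mono add_left_mono mult_left_mono) auto
      finally show "nr (\<lambda>p. of_real (k m * lam p) * refS q (of_real (k m * lam p)) j i * F m i p)
        \<le> (K + 3 * RC) * Mh * D m" .
    qed
  qed
  also have "(\<Sum>l=1..m - 1. \<Sum>i\<le>q. ?c * Mh * (k l / len l m * D l))
      = real (q + 1) * ?c * Mh * (\<Sum>l=1..m - 1. k l / len l m * D l)"
    unfolding sum_distrib_left by (intro sum.cong refl) simp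
  also have "(\<Sum>i\<le>q. (K + 3 * RC) * Mh * D m) = real (q + 1) * (K + 3 * RC) * Mh * D m" by simp
  also have "real (q + 1) * ?c * Mh * (\<Sum>l=1..m - 1. k l / len l m * D l) + real (q + 1) * (K + 3 * RC) * Mh * D m
     \<le> real (q + 1) * ?c * Mh * bsum m + real (q + 1) * (K + 3 * RC) * Mh * bsum m"
  proof (intro add_mono mult_left_mono bsum_ge m)
    show "(\<Sum>l=1..m - 1. k l / len l m * D l) \<le> bsum m"
      unfolding bsum_def
    proof (rule sum_mono2)
      fix l assume "l \<in> {1..m} - {1..m - 1}"
      then show "0 \<le> k l / len l m * D l" using D_nonneg[of l] k_pos[of l] len_pos[of l m] m by auto
    qed auto
    show "0 \<le> real (q + 1) * ?c * Mh" "0 \<le> real (q + 1) * (K + 3 * RC) * Mh"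
      using c0 RC0 K0 Mh_nonneg by (intro mult_nonneg_nonneg add_nonneg_nonneg; simp)+
  qed
  finally show ?thesis by (simp add: C1_def algebra_simps)
qed

definition "C2 = real (q + 1) * CS * (2 + real (q + 1) * C1)"

lemma C2_nonneg: "0 \<le> C2" unfolding C2_def using CS1 C1_nonneg by simp

text \<open>Column 0 of D is the first unit vector, so subtracting the previous end value from
  coefficient 0 turns the step equation into D Z = k (F - H \<lambda>Y). Inverting D =
  \<open>refB 0\<close> bounds Z/k by the source and \<open>lamY_bound\<close>. The entries j >= 1
  of Z/k yield the time derivative, the entry 0 the scaled jump.\<close>

theorem dY_bound:
  assumes m: "1 \<le> m" "m \<le> M" and j: "j \<le> q"
  shows "nr (\<lambda>p. (Y m j p - (if j = 0 then um (m - 1) p else 0)) / of_real (k m)) \<le> C2 * Mh * bsum m"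
proof -
  have km: "0 < k m" using k_pos m by simp
  let ?Z = "\<lambda>j p. Y m j p - (if j = 0 then um (m - 1) p else 0)"
  let ?E = "\<lambda>i p. F m i p - (\<Sum>l\<le>q. of_real (refH i l) * (of_real (lam p) * Y m l p))"
  have rep: "?Z j p = (\<Sum>i\<le>q. refS q 0 j i * (of_real (k m) * ?E i p))" if p: "p < n" for p
  proof (rule refS_unique[OF cos\<theta> zero_in_wedge _ j])
    fix i assume i: "i \<le> q"
    have "(\<Sum>j\<le>q. refB 0 i j * ?Z j p) = (\<Sum>j\<le>q. refB (of_real (k m * lam p)) i j * Y m j p)
        - (\<Sum>j\<le>q. of_real (refH i j) * (of_real (k m * lam p) * Y m j p))
        - (\<Sum>j\<le>q. if j = 0 then (if i = 0 then um (m - 1) p else 0) else 0)"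
      unfolding sum_subtractf[symmetric]
      by (intro sum.cong refl) (auto simp: refB_def refD_def algebra_simps)
    also have "\<dots> = of_real (k m) * ?E i p"
      using scheme[OF m i p] m by (auto simp: um_def right_diff_distrib sum_distrib_left mult_ac)
    finally show "(\<Sum>j\<le>q. refB 0 i j * ?Z j p) = of_real (k m) * ?E i p" .
  qed
  have "nr (\<lambda>p. ?Z j p / of_real (k m)) = nr (\<lambda>p. \<Sum>i\<le>q. refS q 0 j i * ?E i p)"
  proof (rule nr_cong)
    fix p assume "p < n"
    show "?Z j p / of_real (k m) = (\<Sum>i\<le>q. refS q 0 j i * ?E i p)"
      unfolding rep[OF \<open>p < n\<close>] sum_divide_distrib using km by (intro sum.cong) auto
  qed
  also have "\<dots> \<le> (\<Sum>i\<le>q. CS * ((2 + real (q + 1) * C1) * Mh * bsum m))"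
  proof (rule order_trans[OF nr_sum], simp, rule sum_mono)
    fix i assume "i \<in> {..q}"
    then have i: "i \<le> q" by simp
    have b0: "0 \<le> bsum m" using bsum_ge[OF m] D_nonneg[OF m] by simp
    have "nr (?E i) \<le> nr (F m i) + nr (\<lambda>p. \<Sum>l\<le>q. of_real (refH i l) * (of_real (lam p) * Y m l p))"
      by (rule nr_diff)
    also have "\<dots> \<le> bsum m + (\<Sum>l\<le>q. C1 * Mh * bsum m)"
    proof (intro add_mono)
      show "nr (F m i) \<le> bsum m" using D[OF m i] bsum_ge[OF m] by simp
      show "nr (\<lambda>p. \<Sum>l\<le>q. of_real (refH i l) * (of_real (lam p) * Y m l p)) \<le> (\<Sum>l\<le>q. C1 * Mh * bsum m)"
      proof (rule order_trans[OF nr_sum], simp, rule sum_mono)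
        fix l assume "l \<in> {..q}"
        then have "nr (\<lambda>p. of_real (refH i l) * (of_real (lam p) * Y m l p)) \<le> 1 * (C1 * Mh * bsum m)"
          unfolding nr_scale by (intro mult_mono abs_refH_le lamY_bound m nr_nonneg) auto
        then show "nr (\<lambda>p. of_real (refH i l) * (of_real (lam p) * Y m l p)) \<le> C1 * Mh * bsum m" by simp
      qed
    qed
    also have "\<dots> \<le> 2 * Mh * bsum m + (\<Sum>l\<le>q. C1 * Mh * bsum m)"
      using mult_right_mono[OF _ b0, of 1 "2 * Mh"] Mh_half by simp
    also have "\<dots> = (2 + real (q + 1) * C1) * Mh * bsum m" by (simp add: algebra_simps)
    finally have E: "nr (?E i) \<le> (2 + real (q + 1) * C1) * Mh * bsum m" .
    have "cmod (refS q 0 j i) \<le> CS" using CS[OF zero_in_wedge j i] by simp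
    then show "nr (\<lambda>p. refS q 0 j i * ?E i p) \<le> CS * ((2 + real (q + 1) * C1) * Mh * bsum m)"
      unfolding nr_scale using E CS1 nr_nonneg by (intro mult_mono) auto
  qed
  also have "\<dots> = C2 * Mh * bsum m" by (simp add: C2_def)
  finally show ?thesis .
qed

end

section \<open>Time meshes and the discrete convolution\<close>

text \<open>Convexity of x^p in tangent form, which serves both Jensen inequalities below, for sums
  and for means. The cases x = 0 and y = 0 are apart because the rest divides by y and takes the
  logarithm of x/y.\<close>

lemma powr_tangent:
  fixes x y p :: real
  assumes "0 \<le> x" "0 \<le> y" "1 \<le> p"
  shows "y powr p + p * y powr (p - 1) * (x - y) \<le> x powr p"
proof (cases "y = 0 \<or> x = 0")
  case True
  then show ?thesis
  proof
    assume x: "x = 0"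
    have "y powr p = y powr (p - 1) * y" using assms by (cases "y = 0") (auto simp: powr_mult_base mult.commute)
    then have "y powr p + p * y powr (p - 1) * (x - y) = (1 - p) * (y powr (p - 1) * y)"
      using x by (simp add: algebra_simps)
    also have "\<dots> \<le> 0" using assms by (intro mult_nonpos_nonneg mult_nonneg_nonneg) auto
    finally show ?thesis using x by simp
  qed simp
next
  case False
  then have x: "0 < x" and y: "0 < y" using assms by auto
  define r where "r = x / y"
  have r: "0 < r" using x y by (simp add: r_def)
  have "1 + p * (r - 1) \<le> r powr p"
  proof -
    \<comment> \<open>Leads to r - 1 <= r ln r; multiplied by p - 1 and combined with 1 + s <= exp
      s, this is the tangent inequality at 1.\<close>
    have "- ln r \<le> 1 / r - 1" using ln_le_minus_one[of "1 / r"] r by (simp add: ln_div)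
    then have "r * (1 - 1 / r) \<le> r * ln r" using r by (intro mult_left_mono) auto
    then have "r - 1 \<le> r * ln r" using r by (simp add: right_diff_distrib)
    then have "(p - 1) * (r - 1) \<le> (p - 1) * (r * ln r)" using assms by (intro mult_left_mono) auto
    then have "1 + p * (r - 1) \<le> r * (1 + (p - 1) * ln r)" by (simp add: algebra_simps)
    also have "\<dots> \<le> r * exp ((p - 1) * ln r)" using r by (intro mult_left_mono exp_ge_add_one_self) auto
    also have "\<dots> = r powr 1 * r powr (p - 1)" using r by (simp add: powr_def)
    also have "\<dots> = r powr p" unfolding powr_add[symmetric] by simp
    finally show ?thesis .
  qed
  then have "y powr p * (1 + p * (r - 1)) \<le> y powr p * r powr p" by (intro mult_left_mono) auto
  also have "y powr p * r powr p = x powr p"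
    using x y by (simp add: r_def powr_mult[symmetric])
  also have "y powr p * (1 + p * (r - 1)) = y powr p + p * (y powr p / y) * (x - y)"
    using y by (simp add: r_def field_simps)
  also have "y powr p / y = y powr (p - 1)" using y by (simp add: powr_diff)
  finally show ?thesis .
qed

text \<open>Jensen for weights of total mass S <= \<Lambda>: in the sum of the tangent inequalities
  at the weighted mean y the linear parts cancel, and (S y)^p = S^(p-1) * S y^p.\<close>

lemma powr_sum_le:
  fixes a D :: "'i \<Rightarrow> real"
  assumes a: "\<And>l. l \<in> A \<Longrightarrow> 0 \<le> a l" and D: "\<And>l. l \<in> A \<Longrightarrow> 0 \<le> D l"
    and \<Lambda>: "sum a A \<le> \<Lambda>" and p: "1 \<le> p"
  shows "(\<Sum>l\<in>A. a l * D l) powr p \<le> \<Lambda> powr (p - 1) * (\<Sum>l\<in>A. a l * D l powr p)"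
proof -
  let ?S = "sum a A" and ?b = "\<Sum>l\<in>A. a l * D l"
  have S0: "0 \<le> ?S" using a by (rule sum_nonneg)
  have P0: "0 \<le> (\<Sum>l\<in>A. a l * D l powr p)" using a by (intro sum_nonneg mult_nonneg_nonneg) auto
  show ?thesis
  proof (cases "?S = 0")
    case True
    have "a l = 0" if "finite A" "l \<in> A" for l using True that a by (simp add: sum_nonneg_eq_0_iff)
    then have "?b = 0" by (cases "finite A") auto
    then show ?thesis using P0 by simp
  next
    case False
    then have S: "0 < ?S" using S0 by simp
    define y where "y = ?b / ?S"
    have b0: "0 \<le> ?b" using a D by (intro sum_nonneg mult_nonneg_nonneg) auto
    have y: "0 \<le> y" using b0 S by (simp add: y_def)
    have "?S * y powr p = (\<Sum>l\<in>A. a l * (y powr p + p * y powr (p - 1) * (D l - y)))"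
    proof -
      have "(\<Sum>l\<in>A. a l * (y powr p + p * y powr (p - 1) * (D l - y)))
          = ?S * y powr p + p * y powr (p - 1) * (?b - ?S * y)"
        by (simp add: sum.distrib sum_distrib_left sum_distrib_right algebra_simps sum_subtractf)
      then show ?thesis using S by (simp add: y_def)
    qed
    also have "\<dots> \<le> (\<Sum>l\<in>A. a l * D l powr p)"
      using a D y p by (intro sum_mono mult_left_mono powr_tangent) auto
    finally have *: "?S * y powr p \<le> (\<Sum>l\<in>A. a l * D l powr p)" .
    have "?b = ?S * y" using S by (simp add: y_def)
    then have "?b powr p = ?S powr p * y powr p" using S y by (simp add: powr_mult)
    also have "?S powr p = ?S powr (p - 1) * ?S" using S by (simp add: powr_diff)
    also have "?S powr (p - 1) * ?S * y powr p \<le> \<Lambda> powr (p - 1) * (\<Sum>l\<in>A. a l * D l powr p)"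
      unfolding mult.assoc using * S y p \<Lambda> by (intro mult_mono powr_mono2) auto
    finally show ?thesis .
  qed
qed

section \<open>Row and column sums of the convolution weights\<close>

locale mesh =
  fixes T :: real and M :: nat and tt :: "nat \<Rightarrow> real"
  assumes M1: "1 \<le> M" and t0: "tt 0 = 0" and tM: "tt M = T"
    and step: "1 \<le> m \<Longrightarrow> m \<le> M \<Longrightarrow> tt (m - 1) < tt m"
begin

abbreviation "k \<equiv> kstep tt"

lemma k_pos: "1 \<le> m \<Longrightarrow> m \<le> M \<Longrightarrow> 0 < k m"
  using step by (simp add: kstep_def)

lemma sum_k: "1 \<le> l \<Longrightarrow> l \<le> m \<Longrightarrow> (\<Sum>p=l..m. k p) = tt m - tt (l - 1)"
proof (induction m)
  case (Suc m)
  then show ?case by (cases "l = Suc m") (auto simp: kstep_def le_Suc_eq)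
qed simp

lemma tt_less: "l < m \<Longrightarrow> m \<le> M \<Longrightarrow> tt l < tt m"
  using sum_pos[of "{Suc l..m}" k] sum_k[of "Suc l" m] k_pos by simp

lemma tt_mono: "l \<le> m \<Longrightarrow> m \<le> M \<Longrightarrow> tt l \<le> tt m"
  using tt_less[of l m] by (cases "l = m") auto

lemma kmin_le: "1 \<le> m \<Longrightarrow> m \<le> M \<Longrightarrow> kmin tt M \<le> k m"
  unfolding kmin_def by (intro Min_le) auto

lemma kmax_ge: "1 \<le> m \<Longrightarrow> m \<le> M \<Longrightarrow> k m \<le> kmax tt M"
  unfolding kmax_def by (intro Max_ge) auto

lemma kmin_pos: "0 < kmin tt M"
  unfolding kmin_def using M1 k_pos by (subst Min_gr_iff) auto

lemma kmax_pos: "0 < kmax tt M"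
  using k_pos[of 1] kmax_ge[of 1] M1 by simp

definition "Lam = 1 + ln (T / kmin tt M)"

lemma quotient_le_ln: "0 < y \<Longrightarrow> 0 < (x::real) \<Longrightarrow> (x - y) / x \<le> ln x - ln y"
  using ln_le_minus_one[of "y / x"] by (simp add: ln_div diff_divide_distrib)

lemma ln_quot_le: "0 < x \<Longrightarrow> x \<le> T \<Longrightarrow> kmin tt M \<le> y \<Longrightarrow> ln x - ln y \<le> ln (T / kmin tt M)"
  using kmin_pos by (subst ln_div) (auto intro!: diff_mono)

text \<open>For l < m the weight is the length of step l times the smallest value of 1/(t_m - t) on
  it, hence at most the increment of -ln(t_m - t), and these telescope. The step l = m contributes
  exactly 1, so the logarithm is never taken at 0.\<close>

lemma row_sum:
  assumes m: "1 \<le> m" "m \<le> M"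
  shows "(\<Sum>l=1..m. k l / (tt m - tt (l - 1))) \<le> Lam"
proof -
  have tel: "(\<Sum>l=1..j. k l / (tt m - tt (l - 1))) \<le> ln (tt m - tt 0) - ln (tt m - tt j)" if "j < m" for j
    using that
  proof (induction j)
    case (Suc j)
    have "k (Suc j) / (tt m - tt j) \<le> ln (tt m - tt j) - ln (tt m - tt (Suc j))"
      using quotient_le_ln[of "tt m - tt (Suc j)" "tt m - tt j"] tt_less[of "Suc j" m] tt_less[of j m] Suc.prems m
      by (simp add: kstep_def)
    with Suc show ?case by simp
  qed simp
  obtain m' where m': "m = Suc m'" using m by (cases m) auto
  have "(\<Sum>l=1..m. k l / (tt m - tt (l - 1))) = (\<Sum>l=1..m'. k l / (tt m - tt (l - 1))) + k m / k m"
    unfolding m' by (simp add: kstep_def)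
  also have "\<dots> \<le> (ln (tt m - tt 0) - ln (k m)) + 1"
    using tel[of m'] k_pos[OF m] by (simp add: m' kstep_def)
  also have "\<dots> \<le> Lam"
    using ln_quot_le[of "tt m" "k m"] tt_less[of 0 m] tt_mono[of m M] kmin_le m
    by (simp add: Lam_def t0 tM)
  finally show ?thesis .
qed

text \<open>The same telescoping in the other index: m = l contributes 1, and each later weight is
  at most the increment of ln(t - t_(l-1)).\<close>

lemma col_sum:
  assumes l: "1 \<le> l" "l \<le> M"
  shows "(\<Sum>m=l..M. k m / (tt m - tt (l - 1))) \<le> Lam"
proof -
  have tel: "(\<Sum>m=l..l + j. k m / (tt m - tt (l - 1))) \<le> 1 + ln (tt (l + j) - tt (l - 1)) - ln (k l)" if "l + j \<le> M" for j
    using that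
  proof (induction j)
    case 0
    then show ?case using k_pos[OF l] by (simp add: kstep_def)
  next
    case (Suc j)
    have "k (l + Suc j) / (tt (l + Suc j) - tt (l - 1)) \<le> ln (tt (l + Suc j) - tt (l - 1)) - ln (tt (l + j) - tt (l - 1))"
      using quotient_le_ln[of "tt (l + j) - tt (l - 1)" "tt (l + Suc j) - tt (l - 1)"]
        tt_less[of "l - 1" "l + j"] tt_less[of "l - 1" "l + Suc j"] Suc.prems l
      by (simp add: kstep_def)
    with Suc show ?case by simp
  qed
  have "ln (tt M - tt (l - 1)) - ln (k l) \<le> ln (T / kmin tt M)"
    using ln_quot_le[of "tt M - tt (l - 1)" "k l"] tt_less[of "l - 1" M] tt_mono[of 0 "l - 1"] kmin_le l
    by (simp add: t0 tM)
  then show ?thesis using tel[of "M - l"] l by (simp add: Lam_def)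
qed

lemma T_pos: "0 < T" using tt_less[of 0 M] M1 t0 tM by simp

lemma kmin_le_T: "kmin tt M \<le> T"
  using kmin_le[of 1] M1 tt_mono[of 1 M] t0 tM by (simp add: kstep_def)

lemma Lam_ge1: "1 \<le> Lam"
  using kmin_pos kmin_le_T T_pos by (simp add: Lam_def)

text \<open>The convolution \<open>bsum\<close> of the scheme, with \<open>len l m\<close> written
  as a difference of nodes.\<close>

definition "conv D m = (\<Sum>l=1..m. k l / (tt m - tt (l - 1)) * D l)"

lemma weight_nonneg: "1 \<le> l \<Longrightarrow> l \<le> m \<Longrightarrow> m \<le> M \<Longrightarrow> 0 \<le> k l / (tt m - tt (l - 1))"
proof -
  assume "1 \<le> l" "l \<le> m" "m \<le> M"
  then have "0 < k l" "tt (l - 1) < tt m" by (auto intro!: k_pos tt_less)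
  then show ?thesis by simp
qed

lemma conv_nonneg:
  assumes "m \<le> M" "\<And>l. 1 \<le> l \<Longrightarrow> l \<le> M \<Longrightarrow> 0 \<le> D l"
  shows "0 \<le> conv D m"
  unfolding conv_def using assms weight_nonneg by (intro sum_nonneg mult_nonneg_nonneg) auto

lemma conv_sup:
  assumes m: "1 \<le> m" "m \<le> M" and D: "\<And>l. 1 \<le> l \<Longrightarrow> l \<le> M \<Longrightarrow> D l \<le> x" and x: "0 \<le> x"
  shows "conv D m \<le> Lam * x"
proof -
  have "conv D m \<le> (\<Sum>l=1..m. k l / (tt m - tt (l - 1)) * x)"
    unfolding conv_def using m D weight_nonneg by (intro sum_mono mult_left_mono) auto
  also have "\<dots> \<le> Lam * x"
    unfolding sum_distrib_right[symmetric] using row_sum[OF m] x by (intro mult_right_mono) auto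
  finally show ?thesis .
qed

text \<open>Schur test: row and column sums of the kernel are both at most Lam.\<close>
lemma conv_powr:
  assumes p: "1 \<le> p" and D: "\<And>l. 1 \<le> l \<Longrightarrow> l \<le> M \<Longrightarrow> 0 \<le> D l"
  shows "(\<Sum>m=1..M. k m * conv D m powr p) \<le> Lam powr p * (\<Sum>l=1..M. k l * D l powr p)"
proof -
  have "(\<Sum>m=1..M. k m * conv D m powr p)
      \<le> (\<Sum>m=1..M. k m * (Lam powr (p - 1) * (\<Sum>l=1..m. k l / (tt m - tt (l - 1)) * D l powr p)))"
  proof (intro sum_mono mult_left_mono)
    fix m assume m: "m \<in> {1..M}"
    then show "conv D m powr p \<le> Lam powr (p - 1) * (\<Sum>l=1..m. k l / (tt m - tt (l - 1)) * D l powr p)"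
      unfolding conv_def using weight_nonneg D p row_sum[of m] by (intro powr_sum_le) auto
    show "0 \<le> k m" using k_pos[of m] m by simp
  qed
  also have "\<dots> = Lam powr (p - 1) * (\<Sum>m=1..M. \<Sum>l=1..m. (k l * D l powr p) * (k m / (tt m - tt (l - 1))))"
    unfolding sum_distrib_left by (intro sum.cong refl) (simp add: mult_ac)
  also have "(\<Sum>m=1..M. \<Sum>l=1..m. (k l * D l powr p) * (k m / (tt m - tt (l - 1))))
      = (\<Sum>l=1..M. \<Sum>m=l..M. (k l * D l powr p) * (k m / (tt m - tt (l - 1))))"
    by (subst sum.Sigma, simp, simp, subst sum.Sigma, simp, simp, intro sum.reindex_bij_witness[of _ prod.swap prod.swap]) auto
  also have "\<dots> = (\<Sum>l=1..M. (k l * D l powr p) * (\<Sum>m=l..M. k m / (tt m - tt (l - 1))))"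
    by (simp only: sum_distrib_left)
  also have "\<dots> \<le> (\<Sum>l=1..M. (k l * D l powr p) * Lam)"
  proof (intro sum_mono mult_left_mono)
    fix l assume "l \<in> {1..M}"
    then show "(\<Sum>m=l..M. k m / (tt m - tt (l - 1))) \<le> Lam" "0 \<le> k l * D l powr p"
      using col_sum[of l] k_pos[of l] by auto
  qed
  finally have "(\<Sum>m=1..M. k m * conv D m powr p)
      \<le> Lam powr (p - 1) * (\<Sum>l=1..M. (k l * D l powr p) * Lam)" by (simp add: mult_left_mono)
  also have "\<dots> = (Lam powr (p - 1) * Lam) * (\<Sum>l=1..M. k l * D l powr p)"
    by (simp add: sum_distrib_right[symmetric])
  also have "Lam powr (p - 1) * Lam = Lam powr p" using Lam_ge1 by (simp add: powr_diff)
  finally show ?thesis .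
qed

lemma ivl_sub: "1 \<le> l \<Longrightarrow> l \<le> M \<Longrightarrow> {tt (l - 1)<..<tt l} \<subseteq> {0<..<T}"
proof -
  assume "1 \<le> l" "l \<le> M"
  then have "tt 0 \<le> tt (l - 1)" "tt l \<le> tt M" by (auto intro!: tt_mono)
  then show ?thesis by (auto simp: t0 tM)
qed

section \<open>Means of the source over the cells\<close>

definition "avg g l = (LINT t:{tt (l - 1)<..<tt l}|lborel. g t) / k l"

context
  fixes g :: "real \<Rightarrow> real"
  assumes g_int: "set_integrable lborel {0<..<T} g" and g_nonneg: "\<And>t. t \<in> {0<..<T} \<Longrightarrow> 0 \<le> g t"
begin

lemma g_int_sub: "1 \<le> l \<Longrightarrow> l \<le> M \<Longrightarrow> set_integrable lborel {tt (l - 1)<..<tt l} g"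
  by (rule set_integrable_subset[OF g_int _ ivl_sub]) auto

lemma avg_nonneg: "1 \<le> l \<Longrightarrow> l \<le> M \<Longrightarrow> 0 \<le> avg g l"
  unfolding avg_def set_lebesgue_integral_def
  using k_pos[of l] ivl_sub[of l] g_nonneg
  by (intro divide_nonneg_nonneg Bochner_Integration.integral_nonneg) (auto simp: indicator_def)

lemma measure_ivl: "1 \<le> l \<Longrightarrow> l \<le> M \<Longrightarrow> emeasure lborel {tt (l - 1)<..<tt l} = ennreal (k l)"
  using step[of l] by (simp add: kstep_def)

lemma const_int: "1 \<le> l \<Longrightarrow> l \<le> M \<Longrightarrow> set_integrable lborel {tt (l - 1)<..<tt l} (\<lambda>t. c::real)"
  "1 \<le> l \<Longrightarrow> l \<le> M \<Longrightarrow> (LINT t:{tt (l - 1)<..<tt l}|lborel. c) = k l * c"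
  using step[of l] by (auto simp: set_integrable_def set_lebesgue_integral_def kstep_def)

text \<open>Jensen for the mean, by the tangent at the mean. The right side is a nonnegative
  integral because g^p need not be integrable; the tangent is integrable, and its positive part
  carries the inequality over.\<close>

lemma avg_powr:
  assumes p: "1 \<le> p" and l: "1 \<le> l" "l \<le> M"
  shows "ennreal (k l * avg g l powr p)
    \<le> (\<integral>\<^sup>+ t. indicator {tt (l - 1)<..<tt l} t * ennreal (g t powr p) \<partial>lborel)"
proof -
  let ?I = "{tt (l - 1)<..<tt l}" and ?D = "avg g l"
  let ?u = "\<lambda>t. ?D powr p + (p * ?D powr (p - 1)) * (g t - ?D)"
  have u1: "set_integrable lborel ?I (\<lambda>t. g t - ?D)"
    by (intro set_integral_diff g_int_sub const_int l)
  have u: "set_integrable lborel ?I ?u"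
    by (intro set_integral_add set_integrable_mult_right u1 const_int l)
  have "(LINT t:?I|lborel. g t - ?D) = (LINT t:?I|lborel. g t) - k l * ?D"
    using const_int[OF l] g_int_sub[OF l] by (simp add: set_integral_diff)
  also have "\<dots> = 0" using k_pos[OF l] by (simp add: avg_def)
  finally have 0: "(LINT t:?I|lborel. g t - ?D) = 0" .
  have "(LINT t:?I|lborel. ?u t) = k l * ?D powr p + (p * ?D powr (p - 1)) * (LINT t:?I|lborel. g t - ?D)"
    using const_int[OF l] u1 by (simp add: set_integral_add)
  then have "k l * ?D powr p = (\<integral>t. indicator ?I t * ?u t \<partial>lborel)"
    unfolding 0 by (simp add: set_lebesgue_integral_def)
  also have "\<dots> \<le> (\<integral>t. max 0 (indicator ?I t * ?u t) \<partial>lborel)"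
    using u by (intro integral_mono) (auto simp: set_integrable_def)
  finally have "ennreal (k l * ?D powr p) \<le> ennreal (\<integral>t. max 0 (indicator ?I t * ?u t) \<partial>lborel)"
    by (rule ennreal_leI)
  also have "\<dots> = (\<integral>\<^sup>+ t. ennreal (max 0 (indicator ?I t * ?u t)) \<partial>lborel)"
    using u by (intro nn_integral_eq_integral[symmetric]) (auto simp: set_integrable_def)
  also have "\<dots> \<le> (\<integral>\<^sup>+ t. indicator ?I t * ennreal (g t powr p) \<partial>lborel)"
  proof (intro nn_integral_mono)
    fix t
    show "ennreal (max 0 (indicator ?I t * ?u t)) \<le> indicator ?I t * ennreal (g t powr p)"
    proof (cases "t \<in> ?I")
      case True
      then have "?u t \<le> g t powr p"
        using ivl_sub[OF l] g_nonneg avg_nonneg[OF l] p by (intro powr_tangent) auto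
      then show ?thesis using True by (auto intro: ennreal_leI)
    qed simp
  qed
  finally show ?thesis .
qed

lemma sum_avg_powr:
  assumes p: "1 \<le> p"
  shows "ennreal (\<Sum>l=1..M. k l * avg g l powr p)
    \<le> (\<integral>\<^sup>+ t. indicator {0<..<T} t * ennreal (g t powr p) \<partial>lborel)"
proof -
  let ?I = "\<lambda>l. {tt (l - 1)<..<tt l}"
  \<comment> \<open>\<open>g\<close> is known to be measurable only after restriction to (0,T); the
    cut-off version permits exchanging sum and integral.\<close>
  let ?h = "\<lambda>t. indicator {0<..<T} t * g t"
  have [measurable]: "?h \<in> borel_measurable lborel"
    using g_int by (auto simp: set_integrable_def)
  have eq: "indicator (?I l) t * ennreal (g t powr p) = indicator (?I l) t * ennreal (?h t powr p)"
    if "l \<in> {1..M}" for l t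
    using ivl_sub[of l] that by (auto simp: indicator_def)
  have "ennreal (\<Sum>l=1..M. k l * avg g l powr p) = (\<Sum>l=1..M. ennreal (k l * avg g l powr p))"
    using k_pos by (intro sum_ennreal[symmetric] mult_nonneg_nonneg) (auto intro: less_imp_le)
  also have "\<dots> \<le> (\<Sum>l=1..M. \<integral>\<^sup>+ t. indicator (?I l) t * ennreal (g t powr p) \<partial>lborel)"
    using p by (intro sum_mono avg_powr) auto
  also have "\<dots> = (\<Sum>l=1..M. \<integral>\<^sup>+ t. indicator (?I l) t * ennreal (?h t powr p) \<partial>lborel)"
    by (intro sum.cong refl nn_integral_cong eq)
  also have "\<dots> = (\<integral>\<^sup>+ t. (\<Sum>l=1..M. indicator (?I l) t * ennreal (?h t powr p)) \<partial>lborel)"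
    by (rule nn_integral_sum[symmetric]) measurable
  also have "\<dots> \<le> (\<integral>\<^sup>+ t. indicator {0<..<T} t * ennreal (g t powr p) \<partial>lborel)"
  proof (intro nn_integral_mono)
    fix t
    show "(\<Sum>l=1..M. indicator (?I l) t * ennreal (?h t powr p)) \<le> indicator {0<..<T} t * ennreal (g t powr p)"
    proof (cases "\<exists>l\<in>{1..M}. t \<in> ?I l")
      case True
      then obtain l where l: "l \<in> {1..M}" "t \<in> ?I l" by blast
      have "t \<notin> ?I j" if "j \<in> {1..M}" "j \<noteq> l" for j
      proof (cases "j < l")
        case True
        then have "tt j \<le> tt (l - 1)" using l that by (intro tt_mono) auto
        then show ?thesis using l by auto
      next
        case False
        then have "tt l \<le> tt (j - 1)" using l that by (intro tt_mono) auto
        then show ?thesis using l by auto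
      qed
      then have "(\<Sum>j=1..M. indicator (?I j) t * ennreal (?h t powr p))
          = (\<Sum>j=1..M. if j = l then ennreal (?h t powr p) else 0)"
        using l by (intro sum.cong refl) (auto simp: indicator_def)
      also have "\<dots> = ennreal (?h t powr p)" using l by simp
      finally show ?thesis using l ivl_sub[of l] by (auto simp: indicator_def)
    next
      case False
      then have "(\<Sum>l=1..M. indicator (?I l) t * ennreal (?h t powr p)) = 0"
        by (intro sum.neutral) (auto simp: indicator_def)
      then show ?thesis by (simp only: zero_le)
    qed
  qed
  finally show ?thesis .
qed

lemma avg_le_ess_sup:
  assumes l: "1 \<le> l" "l \<le> M"
  shows "ennreal (avg g l) \<le> ess_sup_on {0<..<T} g"
  unfolding ess_sup_on_def
proof (rule Inf_greatest, clarify)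
  fix z assume z: "AE t in lborel. t \<in> {0<..<T} \<longrightarrow> ennreal (g t) \<le> z"
  let ?I = "{tt (l - 1)<..<tt l}"
  show "ennreal (avg g l) \<le> z"
  proof (cases z)
    case (real x)
    have "(LINT t:?I|lborel. g t) \<le> (LINT t:?I|lborel. x)"
      unfolding set_lebesgue_integral_def
    proof (intro integral_mono_AE)
      show "AE t in lborel. indicator ?I t *\<^sub>R g t \<le> indicator ?I t *\<^sub>R x"
        using z
      proof eventually_elim
        case (elim t)
        then show ?case using ivl_sub[OF l] real g_nonneg[of t] by (auto simp: indicator_def)
      qed
    qed (use g_int_sub[OF l] const_int(1)[OF l, of x] in \<open>auto simp: set_integrable_def\<close>)
    then have "avg g l \<le> x" using const_int(2)[OF l] k_pos[OF l] by (simp add: avg_def field_simps)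
    then show ?thesis using real by (simp add: ennreal_leI)
  qed simp
qed

section \<open>Assembling the bounds in the norms with exponent s\<close>

lemma root_enn_le:
  assumes p: "1 \<le> p" and c: "0 \<le> c" and le: "Y \<le> ennreal (c powr p) * X"
  shows "root_enn p Y \<le> ennreal c * root_enn p X"
proof (cases X)
  case top
  \<comment> \<open>For c = 0 the right side is 0 * top = 0, and the assumption forces Y =
    0.\<close>
  show ?thesis
  proof (cases "c = 0")
    case True
    with le have "Y = 0" by simp
    then show ?thesis by (simp add: root_enn_def)
  next
    case False
    with c show ?thesis by (simp add: top root_enn_def ennreal_mult_top)
  qed
next
  case (real x)
  with le have "Y \<le> ennreal (c powr p * x)" by (simp add: ennreal_mult)
  then obtain y where y: "Y = ennreal y" "0 \<le> y" "y \<le> c powr p * x"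
    using real by (cases Y) (auto simp: ennreal_le_iff top_unique)
  have "y powr (1 / p) \<le> (c powr p * x) powr (1 / p)" using y p by (intro powr_mono2) auto
  also have "\<dots> = c * x powr (1 / p)" using p c real by (simp add: powr_mult powr_powr)
  finally show ?thesis using y real c
    by (simp add: root_enn_def ennreal_mult[symmetric] ennreal_leI)
qed

lemma ess_sup_on_le:
  assumes l: "1 \<le> l" and v: "\<And>t. t \<in> {tt (l - 1)<..<tt l} \<Longrightarrow> v t \<le> x"
  shows "ess_sup_on {tt (l - 1)<..tt l} v \<le> ennreal x"
  unfolding ess_sup_on_def
proof (rule Inf_lower, clarify)
  have "AE t in lborel. t \<noteq> tt l" by (rule AE_lborel_singleton)
  then show "AE t in lborel. t \<in> {tt (l - 1)<..tt l} \<longrightarrow> ennreal (v t) \<le> ennreal x"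
    by eventually_elim (auto intro!: ennreal_leI v)
qed

lemma top_bound:
  assumes B: "0 \<le> B" and m: "1 \<le> m" "m \<le> M"
  shows "ennreal (B * conv (avg g) m) \<le> ennreal (B * Lam) * ess_sup_on {0<..<T} g"
proof (cases "ess_sup_on {0<..<T} g")
  case top
  show ?thesis
  proof (cases "B = 0")
    case False
    then have "0 < B * Lam" using B Lam_ge1 by simp
    then have "ennreal (B * Lam) \<noteq> 0" by (simp only: ennreal_eq_0_iff not_le)
    then show ?thesis by (simp only: top ennreal_mult_top top_greatest if_False)
  qed simp
next
  case (real x)
  then have "avg g l \<le> x" if "1 \<le> l" "l \<le> M" for l
    using avg_le_ess_sup[OF that] by (simp add: ennreal_le_iff)
  then have "conv (avg g) m \<le> Lam * x" using real m by (intro conv_sup) auto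
  then have "B * conv (avg g) m \<le> B * Lam * x" using B by (simp add: mult_left_mono mult.assoc)
  then show ?thesis using real B Lam_ge1 by (simp add: ennreal_mult[symmetric] ennreal_leI)
qed

lemma powr_bound:
  assumes B: "0 \<le> B" and p: "1 \<le> p"
  shows "(\<Sum>m=1..M. ennreal (k m * (B * conv (avg g) m) powr p))
      \<le> ennreal ((B * Lam) powr p) * (\<integral>\<^sup>+ t. indicator {0<..<T} t * ennreal (g t powr p) \<partial>lborel)"
proof -
  have c0: "0 \<le> conv (avg g) m" if "1 \<le> m" "m \<le> M" for m using that avg_nonneg by (intro conv_nonneg) auto
  have "(\<Sum>m=1..M. ennreal (k m * (B * conv (avg g) m) powr p)) = ennreal (\<Sum>m=1..M. k m * (B * conv (avg g) m) powr p)"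
    using k_pos by (intro sum_ennreal mult_nonneg_nonneg) (auto intro: less_imp_le)
  also have "(\<Sum>m=1..M. k m * (B * conv (avg g) m) powr p) = B powr p * (\<Sum>m=1..M. k m * conv (avg g) m powr p)"
    unfolding sum_distrib_left using B c0 by (intro sum.cong refl) (simp add: powr_mult)
  also have "\<dots> \<le> B powr p * (Lam powr p * (\<Sum>l=1..M. k l * avg g l powr p))"
    using conv_powr[OF p, of "avg g"] avg_nonneg by (intro mult_left_mono) auto
  also have "\<dots> = (B * Lam) powr p * (\<Sum>l=1..M. k l * avg g l powr p)"
    using B Lam_ge1 by (simp add: powr_mult)
  finally have "(\<Sum>m=1..M. ennreal (k m * (B * conv (avg g) m) powr p))
      \<le> ennreal ((B * Lam) powr p * (\<Sum>l=1..M. k l * avg g l powr p))" by (simp add: ennreal_leI)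
  also have "\<dots> = ennreal ((B * Lam) powr p) * ennreal (\<Sum>l=1..M. k l * avg g l powr p)"
    using k_pos by (intro ennreal_mult) (auto intro!: sum_nonneg mult_nonneg_nonneg intro: less_imp_le)
  also have "\<dots> \<le> ennreal ((B * Lam) powr p) * (\<integral>\<^sup>+ t. indicator {0<..<T} t * ennreal (g t powr p) \<partial>lborel)"
    by (intro mult_left_mono sum_avg_powr p) auto
  finally show ?thesis .
qed

lemma exponent_ge1: "1 \<le> s \<Longrightarrow> s \<noteq> top \<Longrightarrow> 1 \<le> enn2real s"
  by (cases s) auto

lemma disc_norm_le:
  assumes s: "1 \<le> s" and B: "0 \<le> B"
    and a: "\<And>m. 1 \<le> m \<Longrightarrow> m \<le> M \<Longrightarrow> 0 \<le> a m \<and> a m \<le> B * conv (avg g) m"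
  shows "disc_norm s M k a \<le> ennreal (B * Lam) * time_norm s {0<..<T} g"
proof (cases "s = top")
  case True
  have "(SUP m\<in>{1..M}. ennreal (a m)) \<le> ennreal (B * Lam) * ess_sup_on {0<..<T} g"
  proof (rule SUP_least)
    fix m assume m: "m \<in> {1..M}"
    then have "ennreal (a m) \<le> ennreal (B * conv (avg g) m)" using a by (intro ennreal_leI) auto
    with top_bound[OF B, of m] m show "ennreal (a m) \<le> ennreal (B * Lam) * ess_sup_on {0<..<T} g"
      by (auto intro: order_trans)
  qed
  with True show ?thesis by (simp add: disc_norm_def time_norm_def)
next
  case False
  let ?p = "enn2real s"
  have p: "1 \<le> ?p" using exponent_ge1[OF s False] .
  have "(\<Sum>m=1..M. ennreal (k m * a m powr ?p)) \<le> (\<Sum>m=1..M. ennreal (k m * (B * conv (avg g) m) powr ?p))"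
    using a p k_pos by (intro sum_mono ennreal_leI mult_left_mono powr_mono2) (auto intro: less_imp_le)
  also note powr_bound[OF B p]
  finally show ?thesis using False B Lam_ge1 p
    by (auto simp: disc_norm_def time_norm_def nn_integral_completion intro!: root_enn_le)
qed

text \<open>The bound on \<open>v\<close> is required on open cells: at the right end the solution
  may jump and \<open>deriv\<close> carries no information. That point is null for both the integral
  and the essential supremum.\<close>

lemma piece_norm_le:
  assumes s: "1 \<le> s" and B: "0 \<le> B"
    and v: "\<And>m t. 1 \<le> m \<Longrightarrow> m \<le> M \<Longrightarrow> t \<in> {tt (m - 1)<..<tt m} \<Longrightarrow> 0 \<le> v t \<and> v t \<le> B * conv (avg g) m"
  shows "piece_norm s M (\<lambda>m. {tt (m - 1)<..tt m}) v \<le> ennreal (B * Lam) * time_norm s {0<..<T} g"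
proof (cases "s = top")
  case True
  have "(SUP m\<in>{1..M}. ess_sup_on {tt (m - 1)<..tt m} v) \<le> ennreal (B * Lam) * ess_sup_on {0<..<T} g"
  proof (rule SUP_least)
    fix m assume m: "m \<in> {1..M}"
    then have "ess_sup_on {tt (m - 1)<..tt m} v \<le> ennreal (B * conv (avg g) m)"
      using v[of m] by (intro ess_sup_on_le) auto
    with top_bound[OF B, of m] m show "ess_sup_on {tt (m - 1)<..tt m} v \<le> ennreal (B * Lam) * ess_sup_on {0<..<T} g"
      by (auto intro: order_trans)
  qed
  with True show ?thesis by (simp add: piece_norm_def time_norm_def)
next
  case False
  let ?p = "enn2real s"
  have p: "1 \<le> ?p" using exponent_ge1[OF s False] .
  have "(\<Sum>m=1..M. \<integral>\<^sup>+ t. indicator {tt (m - 1)<..tt m} t * ennreal (v t powr ?p) \<partial>lborel)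
      \<le> (\<Sum>m=1..M. ennreal (k m * (B * conv (avg g) m) powr ?p))"
  proof (intro sum_mono)
    fix m assume m: "m \<in> {1..M}"
    let ?c = "(B * conv (avg g) m) powr ?p"
    have "AE t in lborel. t \<noteq> tt m" by (rule AE_lborel_singleton)
    then have "AE t in lborel. indicator {tt (m - 1)<..tt m} t * ennreal (v t powr ?p)
        \<le> ennreal ?c * indicator {tt (m - 1)<..<tt m} t"
    proof eventually_elim
      case (elim t)
      show ?case
      proof (cases "t \<in> {tt (m - 1)<..<tt m}")
        case True
        then have "v t powr ?p \<le> ?c" using v[of m t] m p by (intro powr_mono2) auto
        then show ?thesis using True by (simp add: ennreal_leI)
      qed (use elim in auto)
    qed
    then have "(\<integral>\<^sup>+ t. indicator {tt (m - 1)<..tt m} t * ennreal (v t powr ?p) \<partial>lborel)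
        \<le> (\<integral>\<^sup>+ t. ennreal ?c * indicator {tt (m - 1)<..<tt m} t \<partial>lborel)"
      by (rule nn_integral_mono_AE)
    also have "\<dots> = ennreal ?c * ennreal (k m)"
      using measure_ivl[of m] m by (subst nn_integral_cmult_indicator) auto
    also have "\<dots> = ennreal (k m * ?c)" using k_pos[of m] m by (simp add: ennreal_mult[symmetric] mult.commute)
    finally show "(\<integral>\<^sup>+ t. indicator {tt (m - 1)<..tt m} t * ennreal (v t powr ?p) \<partial>lborel)
        \<le> ennreal (k m * ?c)" .
  qed
  also note powr_bound[OF B p]
  finally show ?thesis using False B Lam_ge1 p
    by (auto simp: piece_norm_def time_norm_def nn_integral_completion intro!: root_enn_le)
qed

end

end

text \<open>The condition k <= T/4 acts twice: it forces M > 1, so that a ratio of neighbouring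
  steps exists and gives \<kappa> >= 1, and it makes ln(T/k) >= 1 because e < 4, which lets additive
  constants be absorbed into the factor.\<close>

lemma mesh_constants:
  assumes tm: "time_mesh T c \<beta> \<kappa> M tt" and c: "0 < c" "0 < \<beta>" and T: "0 < T"
  shows "mesh T M tt" "1 \<le> \<kappa>" "1 \<le> ln (T / kmax tt M)"
    "\<And>m. 1 \<le> m \<Longrightarrow> m < M \<Longrightarrow> kstep tt m \<le> \<kappa> * kstep tt (Suc m) \<and> kstep tt (Suc m) \<le> \<kappa> * kstep tt m"
    "mesh.Lam T M tt \<le> (1 + \<beta> + \<bar>(1 - \<beta>) * ln T - ln c\<bar>) * ln (T / kmax tt M)"
proof -
  show me: "mesh T M tt" by unfold_locales (use tm in \<open>auto simp: time_mesh_def\<close>)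
  interpret mesh T M tt by (rule me)
  have kT: "kmax tt M \<le> T / 4" using tm by (auto simp: time_mesh_def)
  have M2: "1 < M"
  proof (rule ccontr)
    assume "\<not> 1 < M"
    then have "M = 1" using M1 by simp
    then have "k 1 = T" using t0 tM by (simp add: kstep_def)
    then show False using kmax_ge[of 1] M1 kT T by simp
  qed
  have ratio: "1 / \<kappa> \<le> k m / k (Suc m) \<and> k m / k (Suc m) \<le> \<kappa>" if "1 \<le> m" "m < M" for m
    using tm that by (auto simp: time_mesh_def)
  have \<kappa>0: "0 < \<kappa>"
  proof -
    have "0 < k 1 / k (Suc 1)" using M2 by (intro divide_pos_pos k_pos) auto
    with ratio[of 1] M2 show ?thesis by auto
  qed
  show "1 \<le> \<kappa>"
  proof (rule ccontr)
    assume "\<not> 1 \<le> \<kappa>"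
    then have "\<kappa> * \<kappa> < 1 * 1" using \<kappa>0 by (intro mult_strict_mono) auto
    then have "\<kappa> < 1 / \<kappa>" using \<kappa>0 by (simp add: pos_less_divide_eq)
    with ratio[of 1] M2 show False by simp
  qed
  show "k m \<le> \<kappa> * k (Suc m) \<and> k (Suc m) \<le> \<kappa> * k m" if m: "1 \<le> m" "m < M" for m
    using ratio[OF m] k_pos[of m] k_pos[of "Suc m"] m \<kappa>0 by (simp add: field_simps)
  show ln1: "1 \<le> ln (T / kmax tt M)"
  proof -
    have "exp 1 \<le> (4::real)" using exp_le by simp
    also have "4 \<le> T / kmax tt M" using kT kmax_pos by (simp add: field_simps)
    finally show ?thesis using T kmax_pos by (subst ln_ge_iff) auto
  qed
  \<comment> \<open>The lower bound on k_min gives ln(T/k_min) <= \<beta> ln(T/k) + (1 - \<beta>) ln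
    T - ln c; \<open>?A\<close> is the part free of k.\<close>
  let ?L = "ln (T / kmax tt M)" and ?A = "(1 - \<beta>) * ln T - ln c"
  have "c * kmax tt M powr \<beta> \<le> kmin tt M" using tm by (auto simp: time_mesh_def)
  then have "ln (c * kmax tt M powr \<beta>) \<le> ln (kmin tt M)"
    using c kmax_pos by (intro ln_mono) auto
  then have "ln c + \<beta> * ln (kmax tt M) \<le> ln (kmin tt M)"
    using c kmax_pos by (simp add: ln_mult ln_powr)
  then have "Lam \<le> 1 + \<beta> * ?L + ?A"
    using T kmax_pos kmin_pos by (simp add: Lam_def ln_div algebra_simps)
  also have "\<dots> \<le> ?L + \<beta> * ?L + \<bar>?A\<bar> * ?L"
    using ln1 mult_left_mono[OF ln1, of "\<bar>?A\<bar>"] by simp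
  also have "\<dots> = (1 + \<beta> + \<bar>?A\<bar>) * ?L" by (simp add: algebra_simps)
  finally show "Lam \<le> (1 + \<beta> + \<bar>?A\<bar>) * ?L" .
qed

section \<open>The finite element space\<close>

lemma finite_multi_indices: "finite (multi_indices simp r :: ('a::euclidean_space \<Rightarrow> nat) set)"
proof (rule finite_subset)
  show "multi_indices simp r \<subseteq> {f. \<forall>x::'a. (x \<in> Basis \<longrightarrow> f x \<in> {..r}) \<and> (x \<notin> Basis \<longrightarrow> f x = 0)}"
  proof (clarify, intro conjI impI)
    fix f :: "'a \<Rightarrow> nat" and x assume f: "f \<in> multi_indices simp r"
    show "f x = 0" if "x \<notin> Basis" using f that by (simp add: multi_indices_def)
    show "f x \<in> {..r}" if "x \<in> Basis"
      using f that member_le_sum[of x Basis f] by (auto simp: multi_indices_def split: if_splits)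
  qed
qed (intro finite_set_of_finite_funs finite_Basis finite_atMost)

lemma poly_space_zero: "(\<lambda>x. 0) \<in> poly_space simp r"
  by (auto simp: poly_space_def intro!: exI[of _ "\<lambda>_. 0"])

lemma poly_space_add: "p \<in> poly_space simp r \<Longrightarrow> p' \<in> poly_space simp r \<Longrightarrow> (\<lambda>x. p x + p' x) \<in> poly_space simp r"
proof -
  assume "p \<in> poly_space simp r" "p' \<in> poly_space simp r"
  then obtain a b where "p = (\<lambda>x. \<Sum>\<alpha>\<in>multi_indices simp r. a \<alpha> * monom \<alpha> x)"
    "p' = (\<lambda>x. \<Sum>\<alpha>\<in>multi_indices simp r. b \<alpha> * monom \<alpha> x)" by (auto simp: poly_space_def)
  then show ?thesis unfolding poly_space_def
    by (intro CollectI exI[of _ "\<lambda>\<alpha>. a \<alpha> + b \<alpha>"]) (simp add: sum.distrib algebra_simps)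
qed

lemma poly_space_scale: "p \<in> poly_space simp r \<Longrightarrow> (\<lambda>x. c * p x) \<in> poly_space simp r"
proof -
  assume "p \<in> poly_space simp r"
  then obtain a where "p = (\<lambda>x. \<Sum>\<alpha>\<in>multi_indices simp r. a \<alpha> * monom \<alpha> x)"
    by (auto simp: poly_space_def)
  then show ?thesis unfolding poly_space_def
    by (intro CollectI exI[of _ "\<lambda>\<alpha>. c * a \<alpha>"]) (simp add: sum_distrib_left mult_ac)
qed

text \<open>Continuity of the derivative is required direction by direction, a form that passes
  easily through sums and products; joint continuity is recovered in
  \<open>C1_frechet_continuous\<close> by expansion in the basis.\<close>

definition C1_diff :: "('a::euclidean_space \<Rightarrow> 'b::euclidean_space) \<Rightarrow> bool" where
  "C1_diff f \<longleftrightarrow> (\<exists>f'. (\<forall>x. (f has_derivative f' x) (at x)) \<and> (\<forall>e. continuous_on UNIV (\<lambda>x. f' x e)))"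

lemma C1_const: "C1_diff (\<lambda>x. c)"
  unfolding C1_diff_def by (intro exI[of _ "\<lambda>_ _. 0"]) auto

lemma C1_linear: "linear f \<Longrightarrow> C1_diff f"
  unfolding C1_diff_def
  by (intro exI[of _ "\<lambda>_. f"] conjI allI bounded_linear_imp_has_derivative continuous_on_const)
     (simp add: linear_conv_bounded_linear)

lemma C1_add: "C1_diff f \<Longrightarrow> C1_diff g \<Longrightarrow> C1_diff (\<lambda>x. f x + g x)"
  unfolding C1_diff_def
proof (elim exE conjE)
  fix f' g' assume "\<forall>x. (f has_derivative f' x) (at x)" "\<forall>e. continuous_on UNIV (\<lambda>x. f' x e)"
    "\<forall>x. (g has_derivative g' x) (at x)" "\<forall>e. continuous_on UNIV (\<lambda>x. g' x e)"
  then show "\<exists>h'. (\<forall>x. ((\<lambda>x. f x + g x) has_derivative h' x) (at x)) \<and> (\<forall>e. continuous_on UNIV (\<lambda>x. h' x e))"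
    by (intro exI[of _ "\<lambda>x e. f' x e + g' x e"]) (auto intro!: has_derivative_add continuous_intros)
qed

lemma C1_mult:
  fixes f g :: "'a::euclidean_space \<Rightarrow> real"
  shows "C1_diff f \<Longrightarrow> C1_diff g \<Longrightarrow> C1_diff (\<lambda>x. f x * g x)"
  unfolding C1_diff_def
proof (elim exE conjE)
  fix f' g' assume *: "\<forall>x. (f has_derivative f' x) (at x)" "\<forall>e. continuous_on UNIV (\<lambda>x. f' x e)"
    "\<forall>x. (g has_derivative g' x) (at x)" "\<forall>e. continuous_on UNIV (\<lambda>x. g' x e)"
  have "isCont f x" "isCont g x" for x using * has_derivative_continuous by blast+
  then have "continuous_on UNIV f" "continuous_on UNIV g"
    by (simp_all add: continuous_at_imp_continuous_on)
  with * show "\<exists>h'. (\<forall>x. ((\<lambda>x. f x * g x) has_derivative h' x) (at x)) \<and> (\<forall>e. continuous_on UNIV (\<lambda>x. h' x e))"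
    by (intro exI[of _ "\<lambda>x e. f x * g' x e + f' x e * g x"]) (auto intro!: has_derivative_mult continuous_intros)
qed

lemma C1_scaleR:
  fixes f :: "'a::euclidean_space \<Rightarrow> real" and b :: "'b::euclidean_space"
  shows "C1_diff f \<Longrightarrow> C1_diff (\<lambda>x. f x *\<^sub>R b)"
  unfolding C1_diff_def
proof (elim exE conjE)
  fix f' assume *: "\<forall>x. (f has_derivative f' x) (at x)" "\<forall>e. continuous_on UNIV (\<lambda>x. f' x e)"
  then show "\<exists>h'. (\<forall>x. ((\<lambda>x. f x *\<^sub>R b) has_derivative h' x) (at x)) \<and> (\<forall>e. continuous_on UNIV (\<lambda>x. h' x e))"
    by (intro exI[of _ "\<lambda>x e. f' x e *\<^sub>R b"]) (auto intro!: has_derivative_scaleR_left continuous_intros)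
qed

lemma C1_sum: "finite I \<Longrightarrow> (\<And>i. i \<in> I \<Longrightarrow> C1_diff (f i)) \<Longrightarrow> C1_diff (\<lambda>x. \<Sum>i\<in>I. f i x)"
  by (induction I rule: finite_induct) (auto intro: C1_const C1_add)

lemma C1_prod:
  fixes f :: "'i \<Rightarrow> 'a::euclidean_space \<Rightarrow> real"
  shows "finite I \<Longrightarrow> (\<And>i. i \<in> I \<Longrightarrow> C1_diff (f i)) \<Longrightarrow> C1_diff (\<lambda>x. \<Prod>i\<in>I. f i x)"
  by (induction I rule: finite_induct) (auto intro: C1_const C1_mult)

lemma C1_power:
  fixes f :: "'a::euclidean_space \<Rightarrow> real"
  shows "C1_diff f \<Longrightarrow> C1_diff (\<lambda>x. f x ^ n)"
  by (induction n) (auto intro: C1_const C1_mult)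

lemma C1_poly_space: "p \<in> poly_space simp r \<Longrightarrow> C1_diff p"
proof -
  assume "p \<in> poly_space simp r"
  then obtain a where p: "p = (\<lambda>x. \<Sum>\<alpha>\<in>multi_indices simp r. a \<alpha> * monom \<alpha> x)"
    by (auto simp: poly_space_def)
  have "linear (\<lambda>x::'a. x \<bullet> b)" for b
    by (simp add: linear_conv_bounded_linear bounded_linear_inner_left)
  then show ?thesis
    unfolding p monom_def
    by (intro C1_sum finite_multi_indices C1_mult C1_const C1_prod finite_Basis C1_power C1_linear)
qed

lemma C1_admissible:
  fixes F :: "'a::euclidean_space \<Rightarrow> 'a"
  assumes "admissible_map simp F" shows "C1_diff F"
proof (cases simp)
  case True
  then obtain A c where A: "linear A" "F = (\<lambda>x. A x + c)" using assms by (auto simp: admissible_map_def)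
  show ?thesis unfolding A(2) by (intro C1_add C1_linear A C1_const)
next
  case False
  have "F = (\<lambda>x. \<Sum>b\<in>Basis. (F x \<bullet> b) *\<^sub>R b)" by (simp add: euclidean_representation)
  moreover have "C1_diff (\<lambda>x. \<Sum>b\<in>Basis. (F x \<bullet> b) *\<^sub>R b)"
    using assms False by (intro C1_sum finite_Basis C1_scaleR C1_poly_space[of _ False 1]) (auto simp: admissible_map_def)
  ultimately show ?thesis by simp
qed

lemma admissible_props:
  fixes F :: "'a::euclidean_space \<Rightarrow> 'a"
  assumes "admissible_map simp F"
  shows "inj_on F (ref_cell simp)" "\<And>x. x \<in> ref_cell simp \<Longrightarrow> bij (frechet_derivative F (at x))"
proof -
  have "inj_on F (ref_cell simp) \<and> (\<forall>x\<in>ref_cell simp. bij (frechet_derivative F (at x)))"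
  proof (cases simp)
    case True
    then obtain A c where A: "linear A" "bij A" "F = (\<lambda>x. A x + c)" using assms by (auto simp: admissible_map_def)
    have "(F has_derivative A) (at x)" for x
      unfolding A(3) using A(1) by (auto intro!: derivative_eq_intros bounded_linear_imp_has_derivative simp: linear_conv_bounded_linear)
    then have "frechet_derivative F (at x) = A" for x
      by (metis frechet_derivative_at)
    with A show ?thesis by (auto simp: inj_on_def bij_def)
  next
    case False
    then show ?thesis using assms by (auto simp: admissible_map_def)
  qed
  then show "inj_on F (ref_cell simp)" "\<And>x. x \<in> ref_cell simp \<Longrightarrow> bij (frechet_derivative F (at x))" by auto
qed

lemma ref_cell_compact: "compact (ref_cell simp :: 'a::euclidean_space set)"
  and ref_cell_convex: "convex (ref_cell simp :: 'a::euclidean_space set)"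
  and ref_cell_nonempty: "(ref_cell simp :: 'a::euclidean_space set) \<noteq> {}"
proof -
  let ?S = "{x::'a. (\<forall>b\<in>Basis. 0 \<le> x \<bullet> b) \<and> (\<Sum>b\<in>Basis. x \<bullet> b) \<le> 1}"
  have S: "?S = (\<Inter>b\<in>Basis. {x. 0 \<le> x \<bullet> b}) \<inter> {x. x \<bullet> (\<Sum>b\<in>Basis. b) \<le> 1}"
    by (auto simp: inner_sum_right)
  have "closed ?S"
    unfolding S by (intro closed_Int closed_INT ballI closed_Collect_le continuous_intros)
  moreover have "?S \<subseteq> cbox 0 One"
  proof
    fix x assume x: "x \<in> ?S"
    have "x \<bullet> b \<le> 1" if "b \<in> Basis" for b
    proof -
      have "x \<bullet> b \<le> (\<Sum>b\<in>Basis. x \<bullet> b)" using x that by (intro member_le_sum) auto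
      with x show ?thesis by simp
    qed
    with x show "x \<in> cbox 0 One" by (simp add: mem_box)
  qed
  ultimately have "compact ?S" using bounded_subset[OF bounded_cbox] compact_eq_bounded_closed by blast
  then show "compact (ref_cell simp :: 'a set)" by (simp add: ref_cell_def)
  have "convex ?S"
    unfolding S by (intro convex_Int convex_INT) (auto simp: convex_def inner_add_left intro!: add_nonneg_nonneg mult_nonneg_nonneg convex_bound_le)
  then show "convex (ref_cell simp :: 'a set)" by (simp add: ref_cell_def)
  have "0 \<in> ref_cell simp" by (simp add: ref_cell_def mem_box)
  then show "(ref_cell simp :: 'a set) \<noteq> {}" by blast
qed

lemma C1_has_derivative: "C1_diff f \<Longrightarrow> (f has_derivative frechet_derivative f (at x)) (at x)"
  unfolding C1_diff_def by (metis frechet_derivative_at)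

lemma C1_frechet_continuous:
  fixes f :: "'a::euclidean_space \<Rightarrow> 'b::euclidean_space"
  assumes "C1_diff f"
  shows "continuous_on UNIV (\<lambda>(x, e). frechet_derivative f (at x) e)"
proof -
  obtain f' where f': "\<And>x. (f has_derivative f' x) (at x)" "\<And>e. continuous_on UNIV (\<lambda>x. f' x e)"
    using assms by (auto simp: C1_diff_def)
  have eq: "frechet_derivative f (at x) = f' x" for x by (rule frechet_derivative_at[OF f'(1), symmetric])
  have expand: "f' x e = (\<Sum>b\<in>Basis. (e \<bullet> b) *\<^sub>R f' x b)" for x e
  proof -
    have lin: "linear (f' x)" using f'(1) by (rule has_derivative_linear)
    have "f' x (\<Sum>b\<in>Basis. (e \<bullet> b) *\<^sub>R b) = (\<Sum>b\<in>Basis. (e \<bullet> b) *\<^sub>R f' x b)"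
      by (simp add: linear_sum[OF lin] linear_cmul[OF lin])
    then show ?thesis by (simp only: euclidean_representation)
  qed
  have "(\<lambda>(x, e). frechet_derivative f (at x) e) = (\<lambda>(x, e). \<Sum>b\<in>Basis. (e \<bullet> b) *\<^sub>R f' x b)"
    by (intro ext, clarify, unfold eq, rule expand)
  moreover have "continuous_on UNIV (\<lambda>z. \<Sum>b\<in>Basis. (snd z \<bullet> b) *\<^sub>R f' (fst z) b)"
    by (intro continuous_intros continuous_on_compose2[OF f'(2)]) auto
  ultimately show ?thesis by (simp add: case_prod_beta')
qed

lemma unit_norm_scale:
  fixes g :: "'a::real_normed_vector \<Rightarrow> 'b::real_normed_vector"
  assumes "linear g" shows "norm (g w) = norm w * norm (g (w /\<^sub>R norm w))"
  using linear_cmul[OF assms, of "inverse (norm w)" w] linear_0[OF assms] by (cases "w = 0") simp_all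

lemma frechet_upper:
  fixes p :: "'a::euclidean_space \<Rightarrow> real"
  assumes p: "C1_diff p" and K: "compact K" "K \<noteq> {}"
  shows "\<exists>C\<ge>0. \<forall>y\<in>K. \<forall>w. \<bar>frechet_derivative p (at y) w\<bar> \<le> C * norm w"
proof -
  have ne: "K \<times> sphere (0::'a) 1 \<noteq> {}" using K by auto
  have "compact (K \<times> sphere (0::'a) 1)" using K by (intro compact_Times) auto
  moreover have "continuous_on (K \<times> sphere (0::'a) 1) (\<lambda>z. \<bar>frechet_derivative p (at (fst z)) (snd z)\<bar>)"
    using continuous_on_subset[OF C1_frechet_continuous[OF p]] by (intro continuous_intros) (simp add: case_prod_beta')
  ultimately have "\<exists>z\<in>K \<times> sphere (0::'a) 1. \<forall>z'\<in>K \<times> sphere (0::'a) 1. \<bar>frechet_derivative p (at (fst z')) (snd z')\<bar> \<le> \<bar>frechet_derivative p (at (fst z)) (snd z)\<bar>"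
    using ne by (intro continuous_attains_sup)
  then obtain z where z: "\<forall>z'\<in>K \<times> sphere (0::'a) 1. \<bar>frechet_derivative p (at (fst z')) (snd z')\<bar> \<le> \<bar>frechet_derivative p (at (fst z)) (snd z)\<bar>"
    by blast
  let ?C = "\<bar>frechet_derivative p (at (fst z)) (snd z)\<bar>"
  have "\<bar>frechet_derivative p (at y) w\<bar> \<le> ?C * norm w" if "y \<in> K" for y w
  proof (cases "w = 0")
    case False
    have lin: "linear (frechet_derivative p (at y))" using C1_has_derivative[OF p] has_derivative_linear by blast
    have "\<bar>frechet_derivative p (at y) (w /\<^sub>R norm w)\<bar> \<le> ?C" using z that False by auto
    then show ?thesis using unit_norm_scale[OF lin, of w] by (simp add: mult.commute mult_left_mono)
  next
    case True
    then show ?thesis using linear_0 C1_has_derivative[OF p] has_derivative_linear by fastforce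
  qed
  then show ?thesis by (intro exI[of _ ?C]) auto
qed

text \<open>The minimum over \<open>K\<close> times the unit sphere is positive because each
  derivative is injective. It controls the derivative of the inverse cell map.\<close>

lemma frechet_lower:
  fixes F :: "'a::euclidean_space \<Rightarrow> 'a"
  assumes F: "C1_diff F" and K: "compact K" "K \<noteq> {}"
    and bij: "\<And>y. y \<in> K \<Longrightarrow> bij (frechet_derivative F (at y))"
  shows "\<exists>c>0. \<forall>y\<in>K. \<forall>w. c * norm w \<le> norm (frechet_derivative F (at y) w)"
proof -
  have lin: "linear (frechet_derivative F (at y))" for y using C1_has_derivative[OF F] has_derivative_linear by blast
  have ne: "K \<times> sphere (0::'a) 1 \<noteq> {}" using K by auto
  have "compact (K \<times> sphere (0::'a) 1)" using K by (intro compact_Times) auto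
  moreover have "continuous_on (K \<times> sphere (0::'a) 1) (\<lambda>z. norm (frechet_derivative F (at (fst z)) (snd z)))"
    using continuous_on_subset[OF C1_frechet_continuous[OF F]] by (intro continuous_intros) (simp add: case_prod_beta')
  ultimately have "\<exists>z\<in>K \<times> sphere (0::'a) 1. \<forall>z'\<in>K \<times> sphere (0::'a) 1. norm (frechet_derivative F (at (fst z)) (snd z)) \<le> norm (frechet_derivative F (at (fst z')) (snd z'))"
    using ne by (intro continuous_attains_inf)
  then obtain z where z: "z \<in> K \<times> sphere (0::'a) 1" "\<forall>z'\<in>K \<times> sphere (0::'a) 1. norm (frechet_derivative F (at (fst z)) (snd z)) \<le> norm (frechet_derivative F (at (fst z')) (snd z'))"
    by blast
  let ?c = "norm (frechet_derivative F (at (fst z)) (snd z))"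
  have "frechet_derivative F (at (fst z)) (snd z) \<noteq> 0"
  proof
    assume "frechet_derivative F (at (fst z)) (snd z) = 0"
    then have "snd z = 0" using bij[of "fst z"] z(1) linear_injective_0[OF lin] by (auto simp: bij_def)
    with z(1) show False by auto
  qed
  then have c: "0 < ?c" by simp
  have "?c * norm w \<le> norm (frechet_derivative F (at y) w)" if "y \<in> K" for y w
  proof (cases "w = 0")
    case False
    have "?c \<le> norm (frechet_derivative F (at y) (w /\<^sub>R norm w))" using z(2) that False by auto
    then show ?thesis using unit_norm_scale[OF lin, of y w] by (simp add: mult.commute mult_left_mono)
  qed simp
  with c show ?thesis by blast
qed

section \<open>The discrete space: dimension and L2 product\<close>

locale fem =
  fixes \<Omega> :: "'a::euclidean_space set" and simp :: bool and r :: nat and Th :: "('a \<Rightarrow> 'a) set"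
  assumes dom: "lipschitz_domain \<Omega>" and mesh: "cell_mesh simp \<Omega> Th"
begin

abbreviation "V \<equiv> fe_space simp r \<Omega> Th"
abbreviation "K \<equiv> (ref_cell simp :: 'a set)"

lemma \<Omega>: "open \<Omega>" "bounded \<Omega>" "\<Omega> \<noteq> {}" using dom by (auto simp: lipschitz_domain_def)

lemma Th: "finite Th" "\<And>F. F \<in> Th \<Longrightarrow> admissible_map simp F" "(\<Union>F\<in>Th. F ` K) = closure \<Omega>"
  using mesh by (auto simp: cell_mesh_def)

lemma V_cont: "v \<in> V \<Longrightarrow> continuous_on UNIV v" and V_out: "v \<in> V \<Longrightarrow> x \<notin> \<Omega> \<Longrightarrow> v x = 0"
  by (auto simp: fe_space_def)

lemma V_poly: "v \<in> V \<Longrightarrow> F \<in> Th \<Longrightarrow> \<exists>p\<in>poly_space simp r. \<forall>y\<in>K. v (F y) = p y"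
  by (auto simp: fe_space_def)

lemma fe_zero: "(\<lambda>x. 0) \<in> V"
  by (auto simp: fe_space_def intro!: bexI[OF _ poly_space_zero])

lemma fe_add: "u \<in> V \<Longrightarrow> v \<in> V \<Longrightarrow> (\<lambda>x. u x + v x) \<in> V"
  unfolding fe_space_def
proof (safe intro!: continuous_on_add)
  fix F assume *: "F \<in> Th" "\<forall>F\<in>Th. \<exists>p\<in>poly_space simp r. \<forall>y\<in>K. u (F y) = p y"
    "\<forall>F\<in>Th. \<exists>p\<in>poly_space simp r. \<forall>y\<in>K. v (F y) = p y"
  then obtain p p' where "p \<in> poly_space simp r" "\<forall>y\<in>K. u (F y) = p y" "p' \<in> poly_space simp r" "\<forall>y\<in>K. v (F y) = p' y"
    by metis
  then show "\<exists>p\<in>poly_space simp r. \<forall>y\<in>K. u (F y) + v (F y) = p y"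
    by (intro bexI[OF _ poly_space_add[of p _ _ p']]) auto
qed auto

lemma fe_scale: "u \<in> V \<Longrightarrow> (\<lambda>x. c * u x) \<in> V"
  unfolding fe_space_def
proof (safe intro!: continuous_intros)
  fix F assume *: "F \<in> Th" "\<forall>F\<in>Th. \<exists>p\<in>poly_space simp r. \<forall>y\<in>K. u (F y) = p y"
  then obtain p where "p \<in> poly_space simp r" "\<forall>y\<in>K. u (F y) = p y" by metis
  then show "\<exists>p\<in>poly_space simp r. \<forall>y\<in>K. c * u (F y) = p y"
    by (intro bexI[OF _ poly_space_scale[of p]]) auto
qed auto

text \<open>The space is a set of functions, so finite dimension is expressed by dependence of long
  families. A function is determined by its polynomial coefficients on the cells, whence N is the
  number of cells times the number of monomials; outside \<Omega> all functions vanish.\<close>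

lemma fe_finite_dim:
  "\<exists>N. \<forall>f::nat \<Rightarrow> 'a \<Rightarrow> real. (\<forall>i\<le>N. f i \<in> V) \<longrightarrow>
      (\<exists>c. (\<exists>i\<le>N. c i \<noteq> 0) \<and> (\<lambda>x. \<Sum>i\<le>N. c i * f i x) = (\<lambda>x. 0))"
proof (rule exI[of _ "card (Th \<times> (multi_indices simp r :: ('a \<Rightarrow> nat) set))"], intro allI impI)
  let ?J = "Th \<times> (multi_indices simp r :: ('a \<Rightarrow> nat) set)"
  fix f :: "nat \<Rightarrow> 'a \<Rightarrow> real" assume f: "\<forall>i\<le>card ?J. f i \<in> V"
  define a where "a i F = (SOME a. \<forall>y\<in>K. f i (F y) = (\<Sum>\<alpha>\<in>multi_indices simp r. a \<alpha> * monom \<alpha> y))" for i F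
  have a: "f i (F y) = (\<Sum>\<alpha>\<in>multi_indices simp r. a i F \<alpha> * monom \<alpha> y)"
    if "i \<le> card ?J" "F \<in> Th" "y \<in> K" for i F y
  proof -
    obtain p where p: "p \<in> poly_space simp r" "\<forall>y\<in>K. f i (F y) = p y" using V_poly f \<open>F \<in> Th\<close> \<open>i \<le> card ?J\<close> by blast
    from p(1) obtain a' where "p = (\<lambda>x. \<Sum>\<alpha>\<in>multi_indices simp r. a' \<alpha> * monom \<alpha> x)" by (auto simp: poly_space_def)
    with p(2) have "\<exists>a. \<forall>y\<in>K. f i (F y) = (\<Sum>\<alpha>\<in>multi_indices simp r. a \<alpha> * monom \<alpha> y)" by auto
    from someI_ex[OF this] \<open>y \<in> K\<close> show ?thesis by (simp add: a_def)
  qed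
  have fJ: "finite ?J" using Th(1) finite_multi_indices by (rule finite_cartesian_product)
  have "card ?J < card {..card ?J}" by (simp only: card_atMost lessI)
  from linear_dependence[OF fJ finite_atMost this, of "\<lambda>i j. a i (fst j) (snd j)"]
  obtain c where c: "\<exists>i\<in>{..card ?J}. c i \<noteq> 0"
    "\<forall>j\<in>?J. (\<Sum>i\<in>{..card ?J}. c i * a i (fst j) (snd j)) = (0::real)" by blast
  have "(\<Sum>i\<le>card ?J. c i * f i x) = 0" for x
  proof (cases "x \<in> \<Omega>")
    case True
    then have "x \<in> closure \<Omega>" using closure_subset by blast
    then obtain F y where F: "F \<in> Th" "y \<in> K" "x = F y" using Th(3) by blast
    have "(\<Sum>i\<le>card ?J. c i * f i x) = (\<Sum>i\<le>card ?J. \<Sum>\<alpha>\<in>multi_indices simp r. (c i * a i F \<alpha>) * monom \<alpha> y)"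
      unfolding F(3) by (intro sum.cong refl) (use F in \<open>auto simp: a sum_distrib_left mult_ac\<close>)
    also have "\<dots> = (\<Sum>\<alpha>\<in>multi_indices simp r. (\<Sum>i\<le>card ?J. c i * a i F \<alpha>) * monom \<alpha> y)"
      by (subst sum.swap) (simp add: sum_distrib_right)
    also have "\<dots> = 0"
    proof -
      have "(\<Sum>i\<le>card ?J. c i * a i F \<alpha>) = 0" if "\<alpha> \<in> multi_indices simp r" for \<alpha> :: "'a \<Rightarrow> nat"
        using bspec[OF c(2), of "(F, \<alpha>)"] F that by simp
      then show ?thesis by (intro sum.neutral) simp
    qed
    finally show ?thesis .
  next
    case False
    then show ?thesis using f V_out by (intro sum.neutral) auto
  qed
  with c(1) show "\<exists>c. (\<exists>i\<le>card ?J. c i \<noteq> 0) \<and> (\<lambda>x. \<Sum>i\<le>card ?J. c i * f i x) = (\<lambda>x. 0)"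
    by (intro exI[of _ c]) auto
qed

lemma abs_int_cont:
  assumes "continuous_on UNIV (g :: 'a \<Rightarrow> real)"
  shows "g absolutely_integrable_on \<Omega>"
proof -
  obtain a where sub: "\<Omega> \<subseteq> cbox (- a) a" using bounded_subset_cbox_symmetric[OF \<Omega>(2)] by blast
  have "g absolutely_integrable_on cbox (- a) a"
    by (rule absolutely_integrable_continuous[OF continuous_on_subset[OF assms subset_UNIV]])
  moreover have "\<Omega> \<in> sets lebesgue" using \<Omega>(1) by simp
  ultimately show ?thesis using sub by (rule set_integrable_subset)
qed

lemma L2_int: "u \<in> V \<Longrightarrow> v \<in> V \<Longrightarrow> set_integrable lebesgue \<Omega> (\<lambda>x. u x * v x)"
  by (intro abs_int_cont continuous_intros V_cont)

lemma L2ip_add: "u \<in> V \<Longrightarrow> v \<in> V \<Longrightarrow> w \<in> V \<Longrightarrow> L2ip \<Omega> (\<lambda>x. u x + v x) w = L2ip \<Omega> u w + L2ip \<Omega> v w"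
  unfolding L2ip_def by (subst set_integral_add(2)[symmetric]) (auto intro: L2_int simp: distrib_right)

lemma L2ip_scale: "L2ip \<Omega> (\<lambda>x. c * u x) w = c * L2ip \<Omega> u w"
  unfolding L2ip_def by (simp add: mult.assoc)

lemma L2ip_sym: "L2ip \<Omega> u v = L2ip \<Omega> v u"
  unfolding L2ip_def by (simp add: mult.commute)

lemma L2ip_nonneg: "0 \<le> L2ip \<Omega> u u"
  unfolding L2ip_def set_lebesgue_integral_def by (intro Bochner_Integration.integral_nonneg) auto

text \<open>The part of \<Omega> where u is nonzero is open by continuity and null, hence
  empty.\<close>

lemma L2ip_zero:
  assumes u: "u \<in> V" and 0: "L2ip \<Omega> u u = 0" shows "u = (\<lambda>x. 0)"
proof -
  let ?S = "\<Omega> \<inter> {x. u x \<noteq> 0}"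
  have "AE x in lebesgue. indicator \<Omega> x * (u x * u x) = 0"
    using 0 L2_int[OF u u] unfolding L2ip_def set_lebesgue_integral_def set_integrable_def
    by (subst (asm) integral_nonneg_eq_0_iff_AE) auto
  then have "AE x in lebesgue. x \<notin> ?S" by eventually_elim (auto simp: indicator_def split: if_splits)
  moreover have op: "open ?S"
    using \<Omega>(1) V_cont[OF u] by (intro open_Int open_Collect_neq) auto
  then have "?S \<in> sets lebesgue" by simp
  ultimately have "negligible ?S"
    unfolding negligible_iff_null_sets by (subst AE_iff_null_sets)
  with op have "?S = {}" using open_not_negligible by blast
  with V_out[OF u] show ?thesis by blast
qed

section \<open>Gradients almost everywhere and the energy product\<close>

definition "good = (\<Union>F\<in>Th. F ` interior K)"

text \<open>Where a function is not differentiable, \<open>frechet_derivative\<close> is an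
  unspecified value, so identities for \<open>grad_ip\<close> are shown on \<open>good\<close>. The
  rest is null: frontiers of convex sets are null, and differentiable maps preserve null
  sets.\<close>

lemma good_complement: "negligible (\<Omega> - good)"
proof (rule negligible_subset)
  have "\<Omega> - good \<subseteq> (\<Union>F\<in>Th. F ` (K - interior K))"
  proof
    fix x assume x: "x \<in> \<Omega> - good"
    then have "x \<in> closure \<Omega>" using closure_subset by blast
    then obtain F y where "F \<in> Th" "y \<in> K" "x = F y" using Th(3) by blast
    with x show "x \<in> (\<Union>F\<in>Th. F ` (K - interior K))" by (auto simp: good_def)
  qed
  moreover have "closed K" by (rule compact_imp_closed[OF ref_cell_compact])
  ultimately show "\<Omega> - good \<subseteq> (\<Union>F\<in>Th. F ` frontier K)"
    by (simp only: frontier_def closure_closed)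
  show "negligible (\<Union>F\<in>Th. F ` frontier K)"
  proof (intro negligible_Union finite_imageI Th; clarify)
    fix F assume "F \<in> Th"
    have "F differentiable_on frontier K"
      using C1_has_derivative[OF C1_admissible[OF Th(2)[OF \<open>F \<in> Th\<close>]]]
      by (auto simp: differentiable_on_def differentiable_def intro: has_derivative_at_withinI)
    then show "negligible (F ` frontier K)"
      by (intro negligible_differentiable_image_negligible negligible_convex_frontier ref_cell_convex) auto
  qed
qed

lemma open_cell_image: "F \<in> Th \<Longrightarrow> open (F ` interior K)"
proof (rule invariance_of_domain)
  assume F: "F \<in> Th"
  show "continuous_on (interior K) F"
    using C1_has_derivative[OF C1_admissible[OF Th(2)[OF F]]]
    by (auto intro: has_derivative_continuous continuous_at_imp_continuous_on)
  show "inj_on F (interior K)"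
    using admissible_props(1)[OF Th(2)[OF F]] interior_subset by (rule inj_on_subset)
qed simp

lemma open_good: "open good"
  unfolding good_def using open_cell_image by blast

text \<open>On an open cell v is p composed with the inverse of F. The derivative is uniformly
  bounded because, on the compact reference cell, p' is bounded above and F' is bounded
  below.\<close>

lemma fe_derivative_cell:
  assumes v: "v \<in> V" and F: "F \<in> Th"
  shows "\<exists>B. \<forall>y\<in>interior K. v differentiable (at (F y)) \<and> (\<forall>b. \<bar>frechet_derivative v (at (F y)) b\<bar> \<le> B * norm b)"
proof -
  obtain p where p: "p \<in> poly_space simp r" "\<forall>y\<in>K. v (F y) = p y" using V_poly[OF v F] by blast
  have C1: "C1_diff F" "C1_diff p" using C1_admissible[OF Th(2)[OF F]] C1_poly_space[OF p(1)] by auto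
  note adm = admissible_props[OF Th(2)[OF F]]
  obtain C where C: "0 \<le> C" "\<And>y w. y \<in> K \<Longrightarrow> \<bar>frechet_derivative p (at y) w\<bar> \<le> C * norm w"
    using frechet_upper[OF C1(2) ref_cell_compact ref_cell_nonempty] by metis
  obtain c where c: "0 < c" "\<And>y w. y \<in> K \<Longrightarrow> c * norm w \<le> norm (frechet_derivative F (at y) w)"
    using frechet_lower[OF C1(1) ref_cell_compact ref_cell_nonempty adm(2)] by metis
  have "v differentiable (at (F y)) \<and> (\<forall>b. \<bar>frechet_derivative v (at (F y)) b\<bar> \<le> (C / c) * norm b)"
    if y: "y \<in> interior K" for y
  proof -
    have yK: "y \<in> K" using y interior_subset by blast
    let ?F' = "frechet_derivative F (at y)" and ?p' = "frechet_derivative p (at y)"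
    let ?g = "inv_into K F" and ?g' = "inv ?F'"
    have bij: "bij ?F'" using adm(2)[OF yK] .
    have "(?g has_derivative ?g') (at (F y))"
    proof (rule has_derivative_inverse_strong[OF open_interior y])
      show "continuous_on (interior K) F"
        using C1_has_derivative[OF C1(1)] by (auto intro: has_derivative_continuous continuous_at_imp_continuous_on)
      show "?g (F x) = x" if "x \<in> interior K" for x
        using that interior_subset adm(1) by (auto intro!: inv_into_f_f)
      show "?F' \<circ> ?g' = id" by (rule surj_iff[THEN iffD1, OF bij_is_surj[OF bij]])
    qed (rule C1_has_derivative[OF C1(1)])
    moreover have gy: "?g (F y) = y" using yK adm(1) by simp
    ultimately have "(p \<circ> ?g has_derivative ?p' \<circ> ?g') (at (F y))"
      using C1_has_derivative[OF C1(2), of y] by (intro diff_chain_at) simp_all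
    then have D: "(v has_derivative ?p' \<circ> ?g') (at (F y))"
    proof (rule has_derivative_transform_within_open[OF _ open_cell_image[OF F]])
      show "F y \<in> F ` interior K" using y by simp
      fix x assume "x \<in> F ` interior K"
      then obtain y' where "y' \<in> K" "x = F y'" using interior_subset by blast
      then show "(p \<circ> ?g) x = v x" using p(2) adm(1) by simp
    qed
    then have fd: "frechet_derivative v (at (F y)) = ?p' \<circ> ?g'" by (metis frechet_derivative_at)
    have "\<bar>(?p' \<circ> ?g') b\<bar> \<le> (C / c) * norm b" for b
    proof -
      have "c * norm (?g' b) \<le> norm b" using c(2)[OF yK, of "?g' b"] bij by (simp add: bij_is_surj surj_f_inv_f)
      then have "norm (?g' b) \<le> norm b / c" using c(1) by (simp add: field_simps)
      then have "C * norm (?g' b) \<le> C * (norm b / c)" using C(1) by (rule mult_left_mono)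
      with C(2)[OF yK, of "?g' b"] show ?thesis by simp
    qed
    with D fd show ?thesis by (auto simp: differentiable_def)
  qed
  then show ?thesis by blast
qed

lemma fe_derivative:
  assumes v: "v \<in> V"
  shows "\<And>x. x \<in> good \<Longrightarrow> v differentiable (at x)"
    and "\<exists>B. \<forall>x\<in>good. \<forall>b. \<bar>frechet_derivative v (at x) b\<bar> \<le> B * norm b"
proof -
  obtain B where B: "\<And>F y. F \<in> Th \<Longrightarrow> y \<in> interior K \<Longrightarrow> v differentiable (at (F y)) \<and>
      (\<forall>b. \<bar>frechet_derivative v (at (F y)) b\<bar> \<le> B F * norm b)"
    using fe_derivative_cell[OF v] by metis
  then show "\<And>x. x \<in> good \<Longrightarrow> v differentiable (at x)" by (auto simp: good_def)
  have "\<bar>frechet_derivative v (at x) b\<bar> \<le> (\<Sum>F\<in>Th. \<bar>B F\<bar>) * norm b" if "x \<in> good" for x b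
  proof -
    obtain F y where F: "F \<in> Th" "y \<in> interior K" "x = F y" using \<open>x \<in> good\<close> by (auto simp: good_def)
    have "B F \<le> (\<Sum>F\<in>Th. \<bar>B F\<bar>)"
      using member_le_sum[of F Th "\<lambda>F. \<bar>B F\<bar>"] F Th(1) by fastforce
    then have "B F * norm b \<le> (\<Sum>F\<in>Th. \<bar>B F\<bar>) * norm b" by (rule mult_right_mono) simp
    moreover have "\<bar>frechet_derivative v (at x) b\<bar> \<le> B F * norm b" using B[OF F(1,2)] F(3) by simp
    ultimately show ?thesis by simp
  qed
  then show "\<exists>B. \<forall>x\<in>good. \<forall>b. \<bar>frechet_derivative v (at x) b\<bar> \<le> B * norm b" by blast
qed

text \<open>On \<open>good\<close> the partial derivative is a limit of difference quotients with
  increments 1/(n + 1).\<close>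

lemma partial_measurable:
  assumes v: "v \<in> V"
  shows "(\<lambda>x. indicator good x * frechet_derivative v (at x) b) \<in> borel_measurable borel"
proof (rule borel_measurable_LIMSEQ_real)
  let ?h = "\<lambda>n. inverse (real (Suc n))"
  let ?q = "\<lambda>n x. indicator good x * ((v (x + ?h n *\<^sub>R b) - v x) / ?h n)"
  have [measurable]: "v \<in> borel_measurable borel" using V_cont[OF v] by (rule borel_measurable_continuous_onI)
  have [measurable]: "good \<in> sets borel" using open_good by simp
  show "?q n \<in> borel_measurable borel" for n by measurable
  fix x
  show "(\<lambda>n. ?q n x) \<longlonglongrightarrow> indicator good x * frechet_derivative v (at x) b"
  proof (cases "x \<in> good")
    case True
    then have D: "(v has_derivative frechet_derivative v (at x)) (at x)"
      using fe_derivative(1)[OF v] by (simp add: frechet_derivative_works)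
    have "((\<lambda>t. v (x + t *\<^sub>R b)) has_derivative (\<lambda>t. frechet_derivative v (at x) (t *\<^sub>R b))) (at 0)"
    proof -
      have 1: "((\<lambda>t. x + t *\<^sub>R b) has_derivative (\<lambda>t. t *\<^sub>R b)) (at 0)"
        by (auto intro!: derivative_eq_intros)
      have 2: "(v has_derivative frechet_derivative v (at x)) (at (x + 0 *\<^sub>R b))" using D by simp
      from has_derivative_compose[OF 1 2] show ?thesis .
    qed
    moreover have "(\<lambda>t. frechet_derivative v (at x) (t *\<^sub>R b)) = (\<lambda>t. t * frechet_derivative v (at x) b)"
      using linear_cmul[OF has_derivative_linear[OF D]] by simp
    ultimately have "((\<lambda>t. v (x + t *\<^sub>R b)) has_field_derivative frechet_derivative v (at x) b) (at 0)"
      by (simp add: has_field_derivative_def mult_commute_abs)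
    then have "((\<lambda>t. (v (x + t *\<^sub>R b) - v x) / t) \<longlongrightarrow> frechet_derivative v (at x) b) (at 0)"
      by (simp add: has_field_derivative_iff)
    moreover have "filterlim ?h (at 0) sequentially"
      using LIMSEQ_inverse_real_of_nat by (simp add: filterlim_at)
    ultimately have "(\<lambda>n. (v (x + ?h n *\<^sub>R b) - v x) / ?h n) \<longlonglongrightarrow> frechet_derivative v (at x) b"
      by (rule filterlim_compose)
    with True show ?thesis by simp
  qed simp
qed

text \<open>Bounded and measurable on a bounded domain. Integrability secures additivity of
  \<open>grad_ip\<close>, as a non-integrable integrand would produce the default value 0.\<close>

lemma partial_product_integrable:
  assumes u: "u \<in> V" and v: "v \<in> V"
  shows "(\<lambda>x. frechet_derivative u (at x) b * frechet_derivative v (at x) b) absolutely_integrable_on \<Omega>"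
proof -
  obtain B1 where B1: "\<forall>x\<in>good. \<forall>b. \<bar>frechet_derivative u (at x) b\<bar> \<le> B1 * norm b" using fe_derivative(2)[OF u] by blast
  obtain B2 where B2: "\<forall>x\<in>good. \<forall>b. \<bar>frechet_derivative v (at x) b\<bar> \<le> B2 * norm b" using fe_derivative(2)[OF v] by blast
  let ?f = "\<lambda>x. (indicator good x * frechet_derivative u (at x) b) * (indicator good x * frechet_derivative v (at x) b)"
  have "?f absolutely_integrable_on \<Omega>"
  proof (rule measurable_bounded_by_integrable_imp_absolutely_integrable)
    have "?f \<in> borel_measurable borel" by (intro borel_measurable_times partial_measurable u v)
    then have "?f \<in> borel_measurable lborel" by simp
    then have "?f \<in> borel_measurable lebesgue" by (rule measurable_completion)
    then show "?f \<in> borel_measurable (lebesgue_on \<Omega>)" by (rule measurable_restrict_space1)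
    show "\<Omega> \<in> sets lebesgue" using \<Omega>(1) by simp
    have "\<Omega> \<in> lmeasurable" using \<Omega> by (intro lmeasurable_open)
    then show "(\<lambda>x. (\<bar>B1\<bar> * norm b) * (\<bar>B2\<bar> * norm b)) integrable_on \<Omega>"
      by (rule integrable_on_const)
    show "norm (?f x) \<le> (\<bar>B1\<bar> * norm b) * (\<bar>B2\<bar> * norm b)" if "x \<in> \<Omega>" for x
    proof (cases "x \<in> good")
      case True
      have "\<bar>frechet_derivative u (at x) b\<bar> \<le> \<bar>B1\<bar> * norm b" "\<bar>frechet_derivative v (at x) b\<bar> \<le> \<bar>B2\<bar> * norm b"
        using B1 B2 True by (auto intro!: order_trans[OF _ mult_right_mono[OF abs_ge_self]])
      then have "\<bar>frechet_derivative u (at x) b\<bar> * \<bar>frechet_derivative v (at x) b\<bar> \<le> (\<bar>B1\<bar> * norm b) * (\<bar>B2\<bar> * norm b)"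
        by (intro mult_mono) auto
      then show ?thesis using True by (simp add: abs_mult)
    qed simp
  qed
  then show ?thesis
    by (rule absolutely_integrable_spike[OF _ good_complement]) auto
qed

definition "gradprod u v x = (\<Sum>b\<in>Basis. frechet_derivative u (at x) b * frechet_derivative v (at x) b)"

lemma grad_ip_eq:
  assumes u: "u \<in> V" and v: "v \<in> V"
  shows "gradprod u v integrable_on \<Omega>" "grad_ip \<Omega> u v = integral \<Omega> (gradprod u v)"
proof -
  have "gradprod u v absolutely_integrable_on \<Omega>"
    unfolding gradprod_def[abs_def] by (intro absolutely_integrable_sum partial_product_integrable u v finite_Basis)
  from set_lebesgue_integral_eq_integral[OF this]
  show "gradprod u v integrable_on \<Omega>" "grad_ip \<Omega> u v = integral \<Omega> (gradprod u v)"
    by (simp_all add: grad_ip_def gradprod_def[abs_def])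
qed

lemma grad_ip_sym: "grad_ip \<Omega> u v = grad_ip \<Omega> v u"
  by (simp add: grad_ip_def mult.commute)

lemma grad_ip_nonneg: "0 \<le> grad_ip \<Omega> u u"
  unfolding grad_ip_def set_lebesgue_integral_def
  by (intro Bochner_Integration.integral_nonneg scaleR_nonneg_nonneg sum_nonneg zero_le_square indicator_pos_le)

lemma grad_ip_add:
  assumes u: "u \<in> V" and v: "v \<in> V" and w: "w \<in> V"
  shows "grad_ip \<Omega> (\<lambda>x. u x + v x) w = grad_ip \<Omega> u w + grad_ip \<Omega> v w"
proof -
  have "grad_ip \<Omega> (\<lambda>x. u x + v x) w = integral \<Omega> (gradprod (\<lambda>x. u x + v x) w)"
    by (rule grad_ip_eq(2)[OF fe_add[OF u v] w])
  also have "\<dots> = integral \<Omega> (\<lambda>x. gradprod u w x + gradprod v w x)"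
  proof (rule integral_spike[OF good_complement])
    fix x assume "x \<in> \<Omega> - (\<Omega> - good)"
    then have x: "x \<in> good" by blast
    have "((\<lambda>x. u x + v x) has_derivative (\<lambda>b. frechet_derivative u (at x) b + frechet_derivative v (at x) b)) (at x)"
      using fe_derivative(1)[OF u x] fe_derivative(1)[OF v x]
      by (intro has_derivative_add) (simp_all add: frechet_derivative_works)
    then have "frechet_derivative (\<lambda>x. u x + v x) (at x) = (\<lambda>b. frechet_derivative u (at x) b + frechet_derivative v (at x) b)"
      by (metis frechet_derivative_at)
    then show "gradprod u w x + gradprod v w x = gradprod (\<lambda>x. u x + v x) w x"
      by (simp add: gradprod_def sum.distrib[symmetric] distrib_right)
  qed
  also have "\<dots> = grad_ip \<Omega> u w + grad_ip \<Omega> v w"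
    unfolding grad_ip_eq(2)[OF u w] grad_ip_eq(2)[OF v w]
    by (rule Henstock_Kurzweil_Integration.integral_add[OF grad_ip_eq(1)[OF u w] grad_ip_eq(1)[OF v w]])
  finally show ?thesis .
qed

lemma grad_ip_scale:
  assumes u: "u \<in> V" and w: "w \<in> V"
  shows "grad_ip \<Omega> (\<lambda>x. c * u x) w = c * grad_ip \<Omega> u w"
proof -
  have "grad_ip \<Omega> (\<lambda>x. c * u x) w = integral \<Omega> (gradprod (\<lambda>x. c * u x) w)"
    by (rule grad_ip_eq(2)[OF fe_scale[OF u] w])
  also have "\<dots> = integral \<Omega> (\<lambda>x. c * gradprod u w x)"
  proof (rule integral_spike[OF good_complement])
    fix x assume "x \<in> \<Omega> - (\<Omega> - good)"
    then have x: "x \<in> good" by blast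
    have "((\<lambda>x. c * u x) has_derivative (\<lambda>b. c * frechet_derivative u (at x) b)) (at x)"
      using fe_derivative(1)[OF u x] by (intro has_derivative_mult_right) (simp add: frechet_derivative_works)
    then have "frechet_derivative (\<lambda>x. c * u x) (at x) = (\<lambda>b. c * frechet_derivative u (at x) b)"
      by (metis frechet_derivative_at)
    then show "c * gradprod u w x = gradprod (\<lambda>x. c * u x) w x"
      by (simp add: gradprod_def sum_distrib_left mult_ac)
  qed
  also have "\<dots> = c * grad_ip \<Omega> u w" unfolding grad_ip_eq(2)[OF u w] by simp
  finally show ?thesis .
qed

end

section \<open>Spectral decomposition of symmetric operators\<close>

text \<open>The discrete space has no type of its own, so linearity and the inner product are stated
  relative to \<open>V\<close>. The operator will be the negative discrete Laplacian.\<close>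

locale sym_operator =
  fixes V :: "('x \<Rightarrow> real) set" and ip :: "('x \<Rightarrow> real) \<Rightarrow> ('x \<Rightarrow> real) \<Rightarrow> real"
    and A :: "('x \<Rightarrow> real) \<Rightarrow> 'x \<Rightarrow> real"
  assumes V_zero: "(\<lambda>x. 0) \<in> V"
    and V_add: "u \<in> V \<Longrightarrow> v \<in> V \<Longrightarrow> (\<lambda>x. u x + v x) \<in> V"
    and V_scale: "u \<in> V \<Longrightarrow> (\<lambda>x. c * u x) \<in> V"
    and ip_add: "u \<in> V \<Longrightarrow> v \<in> V \<Longrightarrow> w \<in> V \<Longrightarrow> ip (\<lambda>x. u x + v x) w = ip u w + ip v w"
    and ip_scale: "u \<in> V \<Longrightarrow> w \<in> V \<Longrightarrow> ip (\<lambda>x. c * u x) w = c * ip u w"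
    and ip_sym: "u \<in> V \<Longrightarrow> v \<in> V \<Longrightarrow> ip u v = ip v u"
    and ip_nonneg: "u \<in> V \<Longrightarrow> 0 \<le> ip u u"
    and ip_zero: "u \<in> V \<Longrightarrow> ip u u = 0 \<Longrightarrow> u = (\<lambda>x. 0)"
    and A_V: "u \<in> V \<Longrightarrow> A u \<in> V"
    and A_sym: "u \<in> V \<Longrightarrow> v \<in> V \<Longrightarrow> ip (A u) v = ip (A v) u"
    and A_nonneg: "u \<in> V \<Longrightarrow> 0 \<le> ip (A u) u"
    and A_add: "u \<in> V \<Longrightarrow> v \<in> V \<Longrightarrow> A (\<lambda>x. u x + v x) = (\<lambda>x. A u x + A v x)"
    and A_scale: "u \<in> V \<Longrightarrow> A (\<lambda>x. c * u x) = (\<lambda>x. c * A u x)"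
    and fin: "\<exists>N. \<forall>f::nat \<Rightarrow> 'x \<Rightarrow> real. (\<forall>i\<le>N. f i \<in> V) \<longrightarrow>
                (\<exists>c. (\<exists>i\<le>N. c i \<noteq> 0) \<and> (\<lambda>x. \<Sum>i\<le>N. c i * f i x) = (\<lambda>x. 0))"
begin

lemma lincomb:
  assumes "finite I" "\<And>i. i \<in> I \<Longrightarrow> f i \<in> V"
  shows lincomb_V: "(\<lambda>x. \<Sum>i\<in>I. c i * f i x) \<in> V"
    and ip_lincomb: "w \<in> V \<Longrightarrow> ip (\<lambda>x. \<Sum>i\<in>I. c i * f i x) w = (\<Sum>i\<in>I. c i * ip (f i) w)"
    and A_lincomb: "A (\<lambda>x. \<Sum>i\<in>I. c i * f i x) = (\<lambda>x. \<Sum>i\<in>I. c i * A (f i) x)"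
proof -
  have A0: "A (\<lambda>x. 0) = (\<lambda>x. 0)" using A_scale[OF V_zero, of 0] by simp
  have ip0: "ip (\<lambda>x. 0) w = 0" if "w \<in> V" for w using ip_scale[OF V_zero that, of 0] by simp
  have "(\<lambda>x. \<Sum>i\<in>I. c i * f i x) \<in> V \<and> (\<forall>w\<in>V. ip (\<lambda>x. \<Sum>i\<in>I. c i * f i x) w = (\<Sum>i\<in>I. c i * ip (f i) w))
    \<and> A (\<lambda>x. \<Sum>i\<in>I. c i * f i x) = (\<lambda>x. \<Sum>i\<in>I. c i * A (f i) x)"
    using assms
  proof (induction I rule: finite_induct)
    case empty
    then show ?case using V_zero A0 ip0 by simp
  next
    case (insert j I)
    have IH: "(\<lambda>x. \<Sum>i\<in>I. c i * f i x) \<in> V"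
      "\<And>w. w \<in> V \<Longrightarrow> ip (\<lambda>x. \<Sum>i\<in>I. c i * f i x) w = (\<Sum>i\<in>I. c i * ip (f i) w)"
      "A (\<lambda>x. \<Sum>i\<in>I. c i * f i x) = (\<lambda>x. \<Sum>i\<in>I. c i * A (f i) x)"
      using insert by auto
    have fj: "f j \<in> V" using insert by simp
    have e: "(\<lambda>x. \<Sum>i\<in>insert j I. c i * f i x) = (\<lambda>x. c j * f j x + (\<Sum>i\<in>I. c i * f i x))"
      using insert by simp
    show ?case unfolding e
      using V_add[OF V_scale[OF fj] IH(1)] ip_add[OF V_scale[OF fj] IH(1)] ip_scale[OF fj] IH
        A_add[OF V_scale[OF fj] IH(1)] A_scale[OF fj] insert by simp
  qed
  then show "(\<lambda>x. \<Sum>i\<in>I. c i * f i x) \<in> V"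
    "w \<in> V \<Longrightarrow> ip (\<lambda>x. \<Sum>i\<in>I. c i * f i x) w = (\<Sum>i\<in>I. c i * ip (f i) w)"
    "A (\<lambda>x. \<Sum>i\<in>I. c i * f i x) = (\<lambda>x. \<Sum>i\<in>I. c i * A (f i) x)" by auto
qed

text \<open>An eigenvector is found in the Krylov space of f: factor a linear polynomial off the minimal
  relation between the iterates of f; symmetry forces the corresponding root to be real.\<close>
lemma eigenvector_exists:
  assumes W: "W \<subseteq> V" "\<And>u. u \<in> W \<Longrightarrow> A u \<in> W"
      "\<And>n c (f::nat \<Rightarrow> _). (\<And>i. i < n \<Longrightarrow> f i \<in> W) \<Longrightarrow> (\<lambda>x. \<Sum>i<n. c i * f i x) \<in> W"
    and f: "f \<in> W" "f \<noteq> (\<lambda>x. 0)"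
  shows "\<exists>e\<in>W. \<exists>a. e \<noteq> (\<lambda>x. 0) \<and> A e = (\<lambda>x. a * e x)"
proof -
  define g where "g i = (A ^^ i) f" for i
  have gW: "g i \<in> W" for i unfolding g_def by (induction i) (auto simp: f W)
  then have gV: "g i \<in> V" for i using W by blast
  have Ag: "A (g i) = g (Suc i)" for i by (simp add: g_def)
  \<comment> \<open>\<open>?P d\<close> is a relation among the iterates of f with nonzero top
    coefficient; the least such d is the degree of the minimal polynomial of f.\<close>
  let ?P = "\<lambda>d. \<exists>c. c d \<noteq> 0 \<and> (\<forall>x. (\<Sum>i\<le>d. c i * g i x) = (0::real))"
  obtain N c where c: "\<exists>i\<le>N. c i \<noteq> 0" "(\<lambda>x. \<Sum>i\<le>N. c i * g i x) = (\<lambda>x. 0)"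
    using fin gV by metis
  have "\<exists>d. ?P d"
  proof -
    define d where "d = Max {i. i \<le> N \<and> c i \<noteq> 0}"
    have fi: "finite {i. i \<le> N \<and> c i \<noteq> 0}" "{i. i \<le> N \<and> c i \<noteq> 0} \<noteq> {}" using c(1) by auto
    have d: "d \<le> N" "c d \<noteq> 0" using Max_in[OF fi] by (auto simp: d_def)
    have z: "c i = 0" if "i \<le> N" "d < i" for i
      using that Max_ge[OF fi(1), of i] unfolding d_def by fastforce
    have "(\<Sum>i\<le>d. c i * g i x) = (\<Sum>i\<le>N. c i * g i x)" for x
      by (rule sum.mono_neutral_left) (use d z in auto)
    then have "(\<Sum>i\<le>d. c i * g i x) = 0" for x using fun_cong[OF c(2), of x] by simp
    with d show ?thesis by blast
  qed
  then obtain d where d: "?P d" "\<And>d'. d' < d \<Longrightarrow> \<not> ?P d'"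
    using exists_least_iff[of ?P] by blast
  then obtain c where c: "c d \<noteq> 0" "\<And>x. (\<Sum>i\<le>d. c i * g i x) = 0" by blast
  have "d \<noteq> 0"
  proof
    assume "d = 0"
    with c have "f = (\<lambda>x. 0)" by (auto simp: g_def)
    with f show False by simp
  qed
  then obtain d' where d': "d = Suc d'" by (cases d) auto
  define p where "p = (\<Sum>i\<le>d. Polynomial.monom (complex_of_real (c i)) i)"
  have cp: "coeff p i = (if i \<le> d then of_real (c i) else 0)" for i
    by (simp add: p_def coeff_sum if_distrib[of of_real] cong: if_cong)
  have degp: "degree p = d"
    by (rule antisym[OF degree_le le_degree]) (use c(1) in \<open>auto simp: cp\<close>)
  have "\<exists>z. poly p z = 0"
  proof (rule fundamental_theorem_of_algebra)
    show "\<not> constant (poly p)" using degp d' by (simp add: constant_degree)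
  qed
  then obtain z where "poly p z = 0" by blast
  \<comment> \<open>Then (A - z) s(A) f = 0. Since s has complex coefficients, the real and
    imaginary parts \<open>g1\<close> and \<open>g2\<close> of s(A) f are followed as a
    pair.\<close>
  then obtain s where s: "p = [:- z, 1:] * s" using poly_eq_0_iff_dvd dvdE by metis
  have cs: "coeff p i = (case i of 0 \<Rightarrow> 0 | Suc j \<Rightarrow> coeff s j) - z * coeff s i" for i
    unfolding s by (cases i) (simp_all add: algebra_simps)
  have "s \<noteq> 0" using s degp d' by auto
  then have degs: "degree s = d'"
    using degp d' unfolding s by (subst (asm) degree_mult_eq) auto
  then have sd: "coeff s d = 0" using d' by (intro coeff_eq_0) simp
  have lead: "coeff s d' = of_real (c d)"
    using cs[of d] sd d' by (simp add: cp)
  \<comment> \<open>The factorisation read coefficientwise on the iterates; \<open>h\<close> stands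
    for \<open>Re\<close> or \<open>Im\<close>, so one computation serves both parts.\<close>
  have part: "(\<Sum>j<d. h (coeff s j) * g (Suc j) x) = (\<Sum>j<d. h (z * coeff s j) * g j x)"
    if h: "\<And>u v. h (u - v) = h u - h v" "\<And>i. (\<Sum>i\<le>d. h (of_real (c i)) * g i x) = (0::real)" for h x
  proof -
    have h0: "h 0 = 0" using h(1)[of 0 0] by simp
    have "0 = (\<Sum>i\<le>d. h (coeff p i) * g i x)"
      using h(2) by (simp add: cp)
    also have "\<dots> = (\<Sum>i\<le>d. h (case i of 0 \<Rightarrow> 0 | Suc j \<Rightarrow> coeff s j) * g i x) - (\<Sum>i\<le>d. h (z * coeff s i) * g i x)"
      unfolding sum_subtractf[symmetric] by (intro sum.cong refl) (simp add: cs h(1) left_diff_distrib)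
    also have "(\<Sum>i\<le>d. h (case i of 0 \<Rightarrow> 0 | Suc j \<Rightarrow> coeff s j) * g i x) = (\<Sum>j<d. h (coeff s j) * g (Suc j) x)"
      unfolding d' by (subst sum.atMost_Suc_shift) (simp add: h0 lessThan_Suc_atMost)
    also have "(\<Sum>i\<le>d. h (z * coeff s i) * g i x) = (\<Sum>i<d. h (z * coeff s i) * g i x)"
      unfolding d' using sd d' by (simp add: h0 lessThan_Suc_atMost)
    finally show ?thesis by simp
  qed
  define g1 where "g1 x = (\<Sum>j<d. Re (coeff s j) * g j x)" for x
  define g2 where "g2 x = (\<Sum>j<d. Im (coeff s j) * g j x)" for x
  have gW12: "g1 \<in> W" "g2 \<in> W"
    using W(3)[of d g] gW unfolding g1_def[abs_def] g2_def[abs_def] by auto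
  then have gV12: "g1 \<in> V" "g2 \<in> V" using W by auto
  have A1: "A g1 = (\<lambda>x. Re z * g1 x + (- Im z) * g2 x)"
  proof
    fix x
    have "A g1 x = (\<Sum>j<d. Re (coeff s j) * g (Suc j) x)"
      unfolding g1_def[abs_def] by (subst A_lincomb) (auto simp: gV Ag)
    also have "\<dots> = (\<Sum>j<d. Re (z * coeff s j) * g j x)"
      by (rule part) (use c(2)[of x] in auto)
    finally show "A g1 x = Re z * g1 x + (- Im z) * g2 x"
      by (simp add: g1_def g2_def sum_distrib_left sum_subtractf sum_negf algebra_simps)
  qed
  have A2: "A g2 = (\<lambda>x. Im z * g1 x + Re z * g2 x)"
  proof
    fix x
    have "A g2 x = (\<Sum>j<d. Im (coeff s j) * g (Suc j) x)"
      unfolding g2_def[abs_def] by (subst A_lincomb) (auto simp: gV Ag)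
    also have "\<dots> = (\<Sum>j<d. Im (z * coeff s j) * g j x)"
      by (rule part) auto
    finally show "A g2 x = Im z * g1 x + Re z * g2 x"
      by (simp add: g1_def g2_def sum_distrib_left sum.distrib algebra_simps)
  qed
  \<comment> \<open>The leading coefficient of s is the nonzero real number \<open>c d\<close>, so
    vanishing of \<open>g1\<close> would be a relation of smaller degree.\<close>
  have g1: "g1 \<noteq> (\<lambda>x. 0)"
  proof
    assume "g1 = (\<lambda>x. 0)"
    then have "\<forall>x. (\<Sum>i\<le>d'. Re (coeff s i) * g i x) = 0"
      unfolding g1_def[abs_def] d' lessThan_Suc_atMost by metis
    moreover have "Re (coeff s d') \<noteq> 0" using lead c(1) by simp
    ultimately have "?P d'" by (intro exI[of _ "\<lambda>i. Re (coeff s i)"]) simp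
    with d(2)[of d'] d' show False by blast
  qed
  \<comment> \<open>Equating (A g1, g2) and (A g2, g1) leaves Im z times the sum of the squared
    norms of \<open>g1\<close> and \<open>g2\<close>.\<close>
  have "Im z = 0"
  proof -
    have "ip (A g1) g2 = Re z * ip g1 g2 - Im z * ip g2 g2"
      unfolding A1 using gV12 by (simp only: ip_add V_scale ip_scale)
    moreover have "ip (A g2) g1 = Im z * ip g1 g1 + Re z * ip g1 g2"
      unfolding A2 using gV12 ip_sym[of g2 g1] by (simp only: ip_add V_scale ip_scale)
    ultimately have "Im z * (ip g1 g1 + ip g2 g2) = 0"
      using A_sym[OF gV12] by (simp add: algebra_simps)
    moreover have "0 < ip g1 g1" using ip_nonneg[OF gV12(1)] ip_zero[OF gV12(1)] g1 by fastforce
    ultimately show ?thesis using ip_nonneg[OF gV12(2)] by auto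
  qed
  then have "A g1 = (\<lambda>x. Re z * g1 x)" using A1 by simp
  with g1 gW12 show ?thesis by blast
qed

definition "eigensystem (n::nat) e lam \<longleftrightarrow>
   (\<forall>i<n. e i \<in> V \<and> A (e i) = (\<lambda>x. lam i * e i x) \<and> (0::real) \<le> lam i) \<and>
   (\<forall>i<n. \<forall>j<n. ip (e i) (e j) = (if i = j then 1 else (0::real)))"

text \<open>A longest orthonormal family of eigenvectors exists, orthonormal vectors being
  independent. If it failed to expand some v, the residual would lie in its orthogonal complement,
  which A leaves invariant by symmetry and which would therefore contain one more
  eigenvector.\<close>

theorem eigenbasis_exists:
  "\<exists>n e lam. eigensystem (n::nat) e lam \<and> (\<forall>v\<in>V. v = (\<lambda>x. \<Sum>i<n. ip v (e i) * e i x))"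
proof -
  obtain N where N: "\<And>f::nat \<Rightarrow> 'x \<Rightarrow> real. (\<forall>i\<le>N. f i \<in> V) \<Longrightarrow>
      \<exists>c. (\<exists>i\<le>N. c i \<noteq> 0) \<and> (\<lambda>x. \<Sum>i\<le>N. c i * f i x) = (\<lambda>x. 0)"
    using fin by auto
  let ?P = "\<lambda>n. \<exists>e lam. eigensystem n e lam"
  have bound: "n \<le> N" if "?P n" for n
  proof (rule ccontr)
    assume n: "\<not> n \<le> N"
    from that obtain e lam where e: "eigensystem n e lam" by blast
    then have eV: "\<forall>i\<le>N. e i \<in> V" using n by (auto simp: eigensystem_def)
    from N[OF this] obtain c where c: "\<exists>i\<le>N. c i \<noteq> 0" "(\<lambda>x. \<Sum>i\<le>N. c i * e i x) = (\<lambda>x. 0)" by blast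
    then obtain j where j: "j \<le> N" "c j \<noteq> 0" by blast
    have "0 = ip (\<lambda>x. \<Sum>i\<le>N. c i * e i x) (e j)"
      unfolding c(2) using ip_scale[OF V_zero, of "e j" 0] eV j by simp
    also have "\<dots> = (\<Sum>i\<le>N. c i * ip (e i) (e j))"
      using eV j by (intro ip_lincomb) auto
    also have "\<dots> = (\<Sum>i\<le>N. if i = j then c i else 0)"
      using e j n by (intro sum.cong) (auto simp: eigensystem_def)
    also have "\<dots> = c j" using j by simp
    finally show False using j by simp
  qed
  have "?P 0" by (simp add: eigensystem_def)
  then obtain n where n: "?P n" "\<And>m. ?P m \<Longrightarrow> m \<le> n"
    using Nat.ex_has_greatest_nat[of ?P 0 N] bound by blast
  then obtain e lam where e: "eigensystem n e lam" by blast
  have eV: "e i \<in> V" if "i < n" for i using e that by (simp add: eigensystem_def)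
  have on: "ip (e i) (e j) = (if i = j then 1 else 0)" if "i < n" "j < n" for i j
    using e that by (simp add: eigensystem_def)
  have eA: "A (e i) = (\<lambda>x. lam i * e i x)" if "i < n" for i using e that by (simp add: eigensystem_def)
  have "v = (\<lambda>x. \<Sum>i<n. ip v (e i) * e i x)" if v: "v \<in> V" for v
  proof (rule ccontr)
    assume ne: "v \<noteq> (\<lambda>x. \<Sum>i<n. ip v (e i) * e i x)"
    let ?s = "\<lambda>x. \<Sum>i<n. ip v (e i) * e i x"
    define w where "w x = v x + (-1) * ?s x" for x
    have sV: "?s \<in> V" by (rule lincomb_V) (auto simp: eV)
    have wV: "w \<in> V" unfolding w_def[abs_def] by (intro V_add V_scale v sV)
    let ?W = "{u \<in> V. \<forall>i<n. ip u (e i) = 0}"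
    have "ip w (e j) = 0" if j: "j < n" for j
    proof -
      have "ip ?s (e j) = (\<Sum>i<n. ip v (e i) * ip (e i) (e j))" by (rule ip_lincomb) (auto simp: eV j)
      also have "\<dots> = (\<Sum>i<n. if i = j then ip v (e i) else 0)" by (intro sum.cong) (auto simp: on j)
      finally have "ip ?s (e j) = ip v (e j)" using j by simp
      moreover have "ip w (e j) = ip v (e j) + (-1) * ip ?s (e j)"
        unfolding w_def[abs_def] using ip_add[OF v V_scale[OF sV] eV[OF j]] ip_scale[OF sV eV[OF j]] by metis
      ultimately show ?thesis by simp
    qed
    then have wW: "w \<in> ?W" using wV by simp
    have w0: "w \<noteq> (\<lambda>x. 0)"
    proof
      assume "w = (\<lambda>x. 0)"
      then have "w x = 0" for x by simp
      then have "v x = ?s x" for x unfolding w_def by (simp add: eq_iff)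
      with ne show False by blast
    qed
    have inv: "A u \<in> ?W" if "u \<in> ?W" for u
    proof -
      have "ip (A u) (e i) = 0" if "i < n" for i
        using A_sym[of u "e i"] eA[OF that] eV[OF that] \<open>u \<in> ?W\<close> ip_scale[of "e i" u] ip_sym[of u "e i"] that by simp
      with that A_V show ?thesis by simp
    qed
    have lin: "(\<lambda>x. \<Sum>i<m. c i * f i x) \<in> ?W" if f: "\<And>i. i < m \<Longrightarrow> f i \<in> ?W" for m c and f :: "nat \<Rightarrow> 'x \<Rightarrow> real"
    proof -
      have fV: "\<And>i. i \<in> {..<m} \<Longrightarrow> f i \<in> V" using f by auto
      have "ip (\<lambda>x. \<Sum>i<m. c i * f i x) (e j) = 0" if "j < n" for j
        using f that by (subst ip_lincomb[OF _ fV eV[OF that]]) auto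
      then show ?thesis using lincomb_V[of "{..<m}" f c] fV by simp
    qed
    from eigenvector_exists[OF _ inv lin wW w0] obtain h a where
      h: "h \<in> ?W" "h \<noteq> (\<lambda>x. 0)" "A h = (\<lambda>x. a * h x)" by blast
    have hV: "h \<in> V" using h by simp
    have hp: "0 < ip h h" using ip_nonneg[OF hV] ip_zero[OF hV] h(2) by fastforce
    define h' where "h' = (\<lambda>x. (1 / sqrt (ip h h)) * h x)"
    have h'V: "h' \<in> V" unfolding h'_def by (rule V_scale[OF hV])
    have h'1: "ip h' h' = 1"
    proof -
      have "ip h' h' = (1 / sqrt (ip h h)) * ip h h'"
        unfolding h'_def by (rule ip_scale[OF hV V_scale[OF hV]])
      also have "ip h h' = ip h' h" by (rule ip_sym[OF hV h'V])
      also have "ip h' h = (1 / sqrt (ip h h)) * ip h h" unfolding h'_def by (rule ip_scale[OF hV hV])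
      finally show ?thesis using hp by (simp add: divide_simps)
    qed
    have h'e: "ip h' (e i) = 0" if "i < n" for i
      unfolding h'_def by (subst ip_scale[OF hV eV[OF that]]) (use h(1) that in auto)
    have h'A: "A h' = (\<lambda>x. a * h' x)"
      unfolding h'_def by (subst A_scale[OF hV]) (simp add: h(3) mult_ac)
    have a: "0 \<le> a" using A_nonneg[OF h'V] ip_scale[OF h'V h'V, of a] h'1 by (simp add: h'A)
    have "eigensystem (Suc n) (e(n := h')) (lam(n := a))"
      using e h'V h'1 h'e h'A a ip_sym[OF h'V eV] unfolding eigensystem_def
      by (auto simp: less_Suc_eq)
    then have "Suc n \<le> n" using n(2) by blast
    then show False by simp
  qed
  with e show ?thesis by blast
qed

end

section \<open>Testing the discrete equation\<close>

lemma set_integral_Ioc: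
  fixes g :: "real \<Rightarrow> real"
  assumes "a < b"
  shows "(LINT t:{a<..b}|lborel. g t) = (LINT t:{a<..<b}|lborel. g t)"
proof -
  let ?f = "\<lambda>t. indicator {a<..<b} t * g t" and ?d = "\<lambda>t. indicator {b} t * g b"
  have split: "(\<lambda>t. indicator {a<..b} t * g t) = (\<lambda>t. ?f t + ?d t)"
    using assms by (auto simp: indicator_def fun_eq_iff)
  have d: "integrable lborel ?d" "(\<integral>t. ?d t \<partial>lborel) = 0" by auto
  have "(\<integral>t. ?f t + ?d t \<partial>lborel) = (\<integral>t. ?f t \<partial>lborel)"
  proof (cases "integrable lborel ?f")
    case True
    then show ?thesis using d by (subst Bochner_Integration.integral_add) auto
  next
    case False
    have "\<not> integrable lborel (\<lambda>t. ?f t + ?d t)"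
    proof
      assume "integrable lborel (\<lambda>t. ?f t + ?d t)"
      then have "integrable lborel (\<lambda>t. (?f t + ?d t) - ?d t)" using d(1) by (rule Bochner_Integration.integrable_diff)
      with False show False by simp
    qed
    with False show ?thesis by (metis not_integrable_integral_eq)
  qed
  then show ?thesis using split by (simp add: set_lebesgue_integral_def)
qed

lemma Lim_at_right_eq:
  fixes g h :: "real \<Rightarrow> real"
  assumes "a < b" "\<And>t. t \<in> {a<..<b} \<Longrightarrow> g t = h t" "isCont h a"
  shows "Lim (at_right a) g = h a"
proof (rule tendsto_Lim)
  have "\<forall>\<^sub>F t in at_right a. g t = h t"
    using assms(1,2) by (intro eventually_at_rightI[of a b]) auto
  moreover have "(h \<longlongrightarrow> h a) (at_right a)" using assms(3) by (auto simp: isCont_def intro: filterlim_at_split[THEN iffD1, THEN conjunct2])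
  ultimately show "(g \<longlongrightarrow> h a) (at_right a)" by (simp add: tendsto_cong)
qed simp

lemma Lim_at_left_eq:
  fixes g h :: "real \<Rightarrow> real"
  assumes "a < b" "\<And>t. t \<in> {a<..<b} \<Longrightarrow> g t = h t" "isCont h b"
  shows "Lim (at_left b) g = h b"
proof (rule tendsto_Lim)
  have "\<forall>\<^sub>F t in at_left b. g t = h t"
    using assms(1,2) by (intro eventually_at_leftI[of a b]) auto
  moreover have "(h \<longlongrightarrow> h b) (at_left b)" using assms(3) by (auto simp: isCont_def intro: filterlim_at_split[THEN iffD1, THEN conjunct1])
  ultimately show "(g \<longlongrightarrow> h b) (at_left b)" by (simp add: tendsto_cong)
qed simp

section \<open>The negative discrete Laplacian as a symmetric operator\<close>

locale dg_setup = fem \<Omega> simp r Th + mesh T M tt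
  for \<Omega> :: "'a::euclidean_space set" and simp r Th T M tt +
  fixes q :: nat and L :: "('a \<Rightarrow> real) \<Rightarrow> 'a \<Rightarrow> real" and u f :: "real \<Rightarrow> 'a \<Rightarrow> real" and Pf :: "real \<Rightarrow> 'a \<Rightarrow> real"
  assumes lap: "is_discrete_laplacian \<Omega> (fe_space simp r \<Omega> Th) L"
    and proj: "t \<in> {0<..<T} \<Longrightarrow> is_L2_projection \<Omega> (fe_space simp r \<Omega> Th) (f t) (Pf t)"
    and fint: "\<phi> \<in> dG_space q (fe_space simp r \<Omega> Th) M tt \<Longrightarrow> set_integrable lborel {0<..<T} (\<lambda>t. L2ip \<Omega> (f t) (\<phi> t))"
    and uX: "u \<in> dG_space q (fe_space simp r \<Omega> Th) M tt"
    and dg_eq: "\<phi> \<in> dG_space q (fe_space simp r \<Omega> Th) M tt \<Longrightarrow> bilinB \<Omega> M tt u \<phi> = rhsF \<Omega> T f \<phi>"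
begin

abbreviation "X \<equiv> dG_space q V M tt"
abbreviation "ip \<equiv> L2ip \<Omega>"

lemma L_V: "v \<in> V \<Longrightarrow> L v \<in> V" using lap by (simp add: is_discrete_laplacian_def)

lemma fe_uminus: "v \<in> V \<Longrightarrow> (\<lambda>x. - v x) \<in> V" using fe_scale[of v "-1"] by simp

lemma weak: "v \<in> V \<Longrightarrow> \<psi> \<in> V \<Longrightarrow> ip (\<lambda>x. - L v x) \<psi> = grad_ip \<Omega> v \<psi>"
  using lap by (simp add: is_discrete_laplacian_def)

lemma ip_unique:
  assumes "v \<in> V" "w \<in> V" "\<And>\<psi>. \<psi> \<in> V \<Longrightarrow> ip v \<psi> = ip w \<psi>"
  shows "v = w"
proof -
  let ?d = "\<lambda>x. v x + (-1) * w x"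
  have d: "?d \<in> V" by (intro fe_add fe_scale assms)
  have "ip ?d ?d = ip v ?d + ip (\<lambda>x. (-1) * w x) ?d" by (rule L2ip_add[OF assms(1) fe_scale[OF assms(2)] d])
  also have "ip (\<lambda>x. (-1) * w x) ?d = (-1) * ip w ?d" by (rule L2ip_scale)
  finally have "ip ?d ?d = 0" using assms(3)[OF d] by simp
  from L2ip_zero[OF d this] have "?d x = 0" for x by metis
  then show ?thesis by (simp add: fun_eq_iff)
qed

text \<open>The discrete Laplacian is known only through its weak formulation; linearity comes from
  that of \<open>grad_ip\<close> by uniqueness of the representing function, symmetry and sign
  directly from \<open>grad_ip\<close>.\<close>

sublocale sym_operator V ip "\<lambda>v x. - L v x"
proof
  show "(\<lambda>x. 0) \<in> V" by (rule fe_zero)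
  fix v w :: "'a \<Rightarrow> real" and c :: real
  assume v: "v \<in> V"
  show "(\<lambda>x. c * v x) \<in> V" by (rule fe_scale[OF v])
  show "0 \<le> ip v v" by (rule L2ip_nonneg)
  show "(\<lambda>x. - L v x) \<in> V" by (intro fe_uminus L_V v)
  show "0 \<le> ip (\<lambda>x. - L v x) v" unfolding weak[OF v v] by (rule grad_ip_nonneg)
  show "ip v v = 0 \<Longrightarrow> v = (\<lambda>x. 0)" by (rule L2ip_zero[OF v])
  show "(\<lambda>x. - L (\<lambda>x. c * v x) x) = (\<lambda>x. c * - L v x)"
  proof (rule ip_unique)
    fix \<psi> assume \<psi>: "\<psi> \<in> V"
    show "ip (\<lambda>x. - L (\<lambda>x. c * v x) x) \<psi> = ip (\<lambda>x. c * - L v x) \<psi>"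
      unfolding weak[OF fe_scale[OF v] \<psi>] L2ip_scale weak[OF v \<psi>] by (rule grad_ip_scale[OF v \<psi>])
  qed (intro fe_uminus L_V fe_scale v)+
  assume w: "w \<in> V"
  show "(\<lambda>x. v x + w x) \<in> V" by (rule fe_add[OF v w])
  show "ip v w = ip w v" by (rule L2ip_sym)
  show "ip (\<lambda>x. c * v x) w = c * ip v w" by (rule L2ip_scale)
  show "ip (\<lambda>x. - L v x) w = ip (\<lambda>x. - L w x) v"
    unfolding weak[OF v w] weak[OF w v] by (rule grad_ip_sym)
  show "(\<lambda>x. - L (\<lambda>x. v x + w x) x) = (\<lambda>x. - L v x + - L w x)"
  proof (rule ip_unique)
    fix \<psi> assume \<psi>: "\<psi> \<in> V"
    have "ip (\<lambda>x. - L v x + - L w x) \<psi> = ip (\<lambda>x. - L v x) \<psi> + ip (\<lambda>x. - L w x) \<psi>"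
      by (intro L2ip_add fe_uminus L_V v w \<psi>)
    then show "ip (\<lambda>x. - L (\<lambda>x. v x + w x) x) \<psi> = ip (\<lambda>x. - L v x + - L w x) \<psi>"
      unfolding weak[OF fe_add[OF v w] \<psi>] weak[OF v \<psi>] weak[OF w \<psi>] using grad_ip_add[OF v w \<psi>] by simp
  qed (intro fe_uminus fe_add L_V v w)+
next
  fix v w z :: "'a \<Rightarrow> real"
  assume "v \<in> V" "w \<in> V" "z \<in> V"
  then show "ip (\<lambda>x. v x + w x) z = ip v z + ip w z" by (rule L2ip_add)
qed (rule fe_finite_dim)

text \<open>Change of time variable for polynomials with coefficients in V, used from global to
  local time for the solution and back for the test functions.\<close>

lemma affine_reexpand:
  assumes "\<And>j. j \<le> q \<Longrightarrow> h j \<in> V"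
  shows "\<exists>g. (\<forall>j\<le>q. g j \<in> V) \<and> (\<forall>t x. (\<Sum>j\<le>q. (\<alpha> + \<beta> * t) ^ j * h j x) = (\<Sum>j\<le>q. t ^ j * g j x))"
proof (intro exI conjI allI impI)
  let ?c = "\<lambda>i j. real (j choose i) * \<beta> ^ i * \<alpha> ^ (j - i)"
  let ?g = "\<lambda>i x. \<Sum>j\<le>q. ?c i j * h j x"
  show "?g i \<in> V" for i by (rule lincomb_V) (use assms in auto)
  fix t x
  have "(\<alpha> + \<beta> * t) ^ j = (\<Sum>i\<le>q. t ^ i * ?c i j)" if "j \<le> q" for j
  proof -
    have "(\<alpha> + \<beta> * t) ^ j = (\<beta> * t + \<alpha>) ^ j" by (simp add: add.commute)
    also have "\<dots> = (\<Sum>i\<le>j. real (j choose i) * (\<beta> * t) ^ i * \<alpha> ^ (j - i))" by (rule binomial_ring)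
    also have "\<dots> = (\<Sum>i\<le>j. t ^ i * ?c i j)" by (intro sum.cong refl) (simp add: power_mult_distrib mult_ac)
    also have "\<dots> = (\<Sum>i\<le>q. t ^ i * ?c i j)"
      by (rule sum.mono_neutral_left) (use that in auto)
    finally show ?thesis .
  qed
  then have "(\<Sum>j\<le>q. (\<alpha> + \<beta> * t) ^ j * h j x) = (\<Sum>j\<le>q. \<Sum>i\<le>q. t ^ i * ?c i j * h j x)"
    by (intro sum.cong refl) (simp add: sum_distrib_right)
  also have "\<dots> = (\<Sum>i\<le>q. t ^ i * ?g i x)"
    by (subst sum.swap) (simp add: sum_distrib_left mult_ac)
  finally show "(\<Sum>j\<le>q. (\<alpha> + \<beta> * t) ^ j * h j x) = (\<Sum>i\<le>q. t ^ i * ?g i x)" .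
qed

section \<open>Local expansion of the solution and test functions on one cell\<close>

definition "tau m t = (t - tt (m - 1)) / k m"

definition "chi m = (SOME ch. (\<forall>j\<le>q. ch j \<in> V) \<and>
   (\<forall>t\<in>{tt (m - 1)<..tt m}. u t = (\<lambda>x. \<Sum>j\<le>q. tau m t ^ j * ch j x)))"

lemma chi_props:
  assumes m: "1 \<le> m" "m \<le> M"
  shows chi_V: "j \<le> q \<Longrightarrow> chi m j \<in> V"
    and chi_u: "t \<in> {tt (m - 1)<..tt m} \<Longrightarrow> u t = (\<lambda>x. \<Sum>j\<le>q. tau m t ^ j * chi m j x)"
proof -
  have km: "0 < k m" using k_pos m by simp
  obtain \<psi> where \<psi>: "\<forall>j\<le>q. \<psi> j \<in> V" "\<forall>t\<in>{tt (m - 1)<..tt m}. u t = (\<lambda>x. \<Sum>j\<le>q. t ^ j * \<psi> j x)"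
    using uX m unfolding dG_space_def by fastforce
  obtain g where g: "\<forall>j\<le>q. g j \<in> V" "\<And>t x. (\<Sum>j\<le>q. (tt (m - 1) + k m * t) ^ j * \<psi> j x) = (\<Sum>j\<le>q. t ^ j * g j x)"
    using affine_reexpand[of \<psi> "tt (m - 1)" "k m"] \<psi>(1) by blast
  have "u t = (\<lambda>x. \<Sum>j\<le>q. tau m t ^ j * g j x)" if "t \<in> {tt (m - 1)<..tt m}" for t
  proof -
    have "t = tt (m - 1) + k m * tau m t" using km by (simp add: tau_def)
    then have "(\<Sum>j\<le>q. t ^ j * \<psi> j x) = (\<Sum>j\<le>q. tau m t ^ j * g j x)" for x
      using g(2)[where t="tau m t" and x=x] by simp
    with \<psi>(2) that show ?thesis by simp
  qed
  with g(1) have "\<exists>ch. (\<forall>j\<le>q. ch j \<in> V) \<and> (\<forall>t\<in>{tt (m - 1)<..tt m}. u t = (\<lambda>x. \<Sum>j\<le>q. tau m t ^ j * ch j x))"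
    by blast
  then have "(\<forall>j\<le>q. chi m j \<in> V) \<and> (\<forall>t\<in>{tt (m - 1)<..tt m}. u t = (\<lambda>x. \<Sum>j\<le>q. tau m t ^ j * chi m j x))"
    unfolding chi_def by (rule someI_ex)
  then show "j \<le> q \<Longrightarrow> chi m j \<in> V"
    "t \<in> {tt (m - 1)<..tt m} \<Longrightarrow> u t = (\<lambda>x. \<Sum>j\<le>q. tau m t ^ j * chi m j x)" by blast+
qed

text \<open>Supported in one cell and one spatial direction; for an eigenfunction \<open>e\<close>
  it picks out row i of a scalar step.\<close>

definition "test m i e t = (if t \<in> {tt (m - 1)<..tt m} then (\<lambda>x. tau m t ^ i * e x) else (\<lambda>x. 0::real))"

lemma test_in: "t \<in> {tt (m - 1)<..tt m} \<Longrightarrow> test m i e t = (\<lambda>x. tau m t ^ i * e x)"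
  and test_out: "t \<notin> {tt (m - 1)<..tt m} \<Longrightarrow> test m i e t = (\<lambda>x. 0)"
  by (simp_all only: test_def if_True if_False)

lemma cells_disjoint:
  assumes "1 \<le> m" "m \<le> M" "1 \<le> m'" "m' \<le> M" "t \<in> {tt (m - 1)<..tt m}" "t \<in> {tt (m' - 1)<..tt m'}"
  shows "m = m'"
proof (rule ccontr)
  assume "m \<noteq> m'"
  then consider "m \<le> m' - 1" | "m' \<le> m - 1" by linarith
  then show False
  proof cases
    case 1
    then have "tt m \<le> tt (m' - 1)" using assms(4) by (intro tt_mono) auto
    with assms(5,6) show False by simp
  next
    case 2
    then have "tt m' \<le> tt (m - 1)" using assms(2) by (intro tt_mono) auto
    with assms(5,6) show False by simp
  qed
qed

lemma test_X:
  assumes m: "1 \<le> m" "m \<le> M" and i: "i \<le> q" and e: "e \<in> V"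
  shows "test m i e \<in> X"
  unfolding dG_space_def
proof (intro CollectI ballI)
  fix m' assume m': "m' \<in> {1..M}"
  show "\<exists>\<psi>. (\<forall>j\<le>q. \<psi> j \<in> V) \<and> (\<forall>t\<in>{tt (m' - 1)<..tt m'}. test m i e t = (\<lambda>x. \<Sum>j\<le>q. t ^ j * \<psi> j x))"
  proof (cases "m' = m")
    case True
    have km: "0 < k m" using k_pos m by simp
    let ?h = "\<lambda>j x. if j = i then e x else 0"
    have "?h j \<in> V" for j using e fe_zero by (cases "j = i") auto
    then obtain g where g: "\<forall>j\<le>q. g j \<in> V"
      "\<And>t x. (\<Sum>j\<le>q. (- tt (m - 1) / k m + (1 / k m) * t) ^ j * ?h j x) = (\<Sum>j\<le>q. t ^ j * g j x)"
      using affine_reexpand[of ?h "- tt (m - 1) / k m" "1 / k m"] by blast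
    have "tau m t ^ i * e x = (\<Sum>j\<le>q. t ^ j * g j x)" for t x
    proof -
      have "- tt (m - 1) / k m + (1 / k m) * t = tau m t" using km by (simp add: tau_def field_simps)
      then have "(\<Sum>j\<le>q. t ^ j * g j x) = (\<Sum>j\<le>q. if j = i then tau m t ^ j * e x else 0)"
        unfolding g(2)[symmetric] by (intro sum.cong) auto
      with i show ?thesis by simp
    qed
    with True g(1) show ?thesis by (intro exI[of _ g]) (auto simp: test_def)
  next
    case False
    then have "t \<notin> {tt (m - 1)<..tt m}" if "t \<in> {tt (m' - 1)<..tt m'}" for t
      using cells_disjoint[OF m, of m' t] m' that by auto
    then show ?thesis using fe_zero by (intro exI[of _ "\<lambda>_ _. 0"]) (auto simp: test_def)
  qed
qed

abbreviation "cell m \<equiv> {tt (m - 1)<..<tt m}"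

lemma tau_integral:
  assumes m: "1 \<le> m" "m \<le> M"
  shows "set_integrable lborel (cell m) (\<lambda>t. tau m t ^ a)"
    "(LINT t:cell m|lborel. tau m t ^ a) = k m / real (a + 1)"
proof -
  have km: "0 < k m" using k_pos m by simp
  have lt: "tt (m - 1) < tt m" using step m by simp
  have cont: "continuous_on S (\<lambda>t. tau m t ^ a)" for S
    unfolding tau_def by (intro continuous_intros) (use km in auto)
  have "set_integrable lborel {tt (m - 1)..tt m} (\<lambda>t. tau m t ^ a)"
    by (rule borel_integrable_atLeastAtMost'[OF cont])
  then show si: "set_integrable lborel (cell m) (\<lambda>t. tau m t ^ a)"
    by (rule set_integrable_subset) auto
  let ?G = "\<lambda>t. k m * tau m t ^ (a + 1) / real (a + 1)"
  have "((\<lambda>t. tau m t ^ a) has_integral (?G (tt m) - ?G (tt (m - 1)))) {tt (m - 1)..tt m}"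
  proof (rule fundamental_theorem_of_calculus)
    fix t
    have "((\<lambda>t. tau m t) has_real_derivative 1 / k m) (at t within {tt (m - 1)..tt m})"
      unfolding tau_def using km by (auto intro!: derivative_eq_intros)
    then have "((\<lambda>t. tau m t ^ (a + 1)) has_real_derivative real (a + 1) * (tau m t ^ a * (1 / k m))) (at t within {tt (m - 1)..tt m})"
      using DERIV_power[of "tau m" "1 / k m" t "{tt (m - 1)..tt m}" "a + 1"] by (simp add: mult_ac)
    then have "(?G has_real_derivative k m * (real (a + 1) * (tau m t ^ a * (1 / k m))) / real (a + 1)) (at t within {tt (m - 1)..tt m})"
      by (intro DERIV_cdivide DERIV_cmult)
    then show "(?G has_vector_derivative tau m t ^ a) (at t within {tt (m - 1)..tt m})"
      using km by (simp add: has_real_derivative_iff_has_vector_derivative del: of_nat_add of_nat_Suc)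
  qed (use lt in auto)
  then have "((\<lambda>t. tau m t ^ a) has_integral (?G (tt m) - ?G (tt (m - 1)))) (cell m)"
    using has_integral_Icc_iff_Ioo by blast
  moreover have "?G (tt m) - ?G (tt (m - 1)) = k m / real (a + 1)"
    using km by (simp add: tau_def kstep_def)
  ultimately have "integral (cell m) (\<lambda>t. tau m t ^ a) = k m / real (a + 1)" by (simp add: integral_unique)
  then show "(LINT t:cell m|lborel. tau m t ^ a) = k m / real (a + 1)"
    using set_borel_integral_eq_integral(2)[OF si] by simp
qed

lemma tau_poly_integral:
  assumes m: "1 \<le> m" "m \<le> M"
  shows "(LINT t:cell m|lborel. \<Sum>j\<le>q. c j * tau m t ^ a j) = (\<Sum>j\<le>q. c j * (k m / real (a j + 1)))"
proof -
  have "(LINT t:cell m|lborel. \<Sum>j\<le>q. c j * tau m t ^ a j) = (\<Sum>j\<le>q. LINT t:cell m|lborel. c j * tau m t ^ a j)"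
    unfolding set_lebesgue_integral_def scaleR_sum_right
    using tau_integral(1)[OF m] by (intro Bochner_Integration.integral_sum) (auto simp: set_integrable_def mult.left_commute)
  then show ?thesis using tau_integral(2)[OF m] by simp
qed

text \<open>Cells are closed on the right while (0,T) is open: the last cell contains T, so m = M is
  a separate case.\<close>

lemma localize_integral:
  fixes g :: "real \<Rightarrow> real"
  assumes m: "1 \<le> m" "m \<le> M" and g: "\<And>t. t \<in> {0<..<T} \<Longrightarrow> t \<notin> {tt (m - 1)<..tt m} \<Longrightarrow> g t = 0"
  shows "(LINT t:{0<..<T}|lborel. g t) = (LINT t:cell m|lborel. g t)"
proof (cases "m = M")
  case True
  have sub: "cell m \<subseteq> {0<..<T}" using ivl_sub m by simp
  have eq: "indicator {0<..<T} t *\<^sub>R g t = indicator (cell m) t *\<^sub>R g t" for t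
    using g[of t] sub tM True by (auto simp: indicator_def)
  show ?thesis unfolding set_lebesgue_integral_def eq ..
next
  case False
  then have "tt m < T" using tt_less[of m M] m tM by simp
  moreover have "0 \<le> tt (m - 1)" using tt_mono[of 0 "m - 1"] m t0 by simp
  ultimately have eq: "indicator {0<..<T} t *\<^sub>R g t = indicator {tt (m - 1)<..tt m} t *\<^sub>R g t" for t
    using g[of t] by (auto simp: indicator_def)
  have "(LINT t:{0<..<T}|lborel. g t) = (LINT t:{tt (m - 1)<..tt m}|lborel. g t)"
    unfolding set_lebesgue_integral_def eq ..
  then show ?thesis using set_integral_Ioc step m by simp
qed

lemma in_some_cell: "t \<in> {0<..<T} \<Longrightarrow> \<exists>m. 1 \<le> m \<and> m \<le> M \<and> t \<in> {tt (m - 1)<..tt m}"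
proof -
  assume t: "t \<in> {0<..<T}"
  define m where "m = (LEAST m. t \<le> tt m)"
  have ex: "t \<le> tt M" using t tM by simp
  have le: "t \<le> tt m" "m \<le> M" unfolding m_def using ex by (auto intro: LeastI Least_le)
  have "m \<noteq> 0" using le(1) t t0 by (intro notI) simp
  moreover have "\<not> t \<le> tt (m - 1)" unfolding m_def using \<open>m \<noteq> 0\<close> by (intro not_less_Least) (simp add: m_def)
  ultimately show ?thesis using le by (intro exI[of _ m]) auto
qed

lemma u_V: "t \<in> {0<..<T} \<Longrightarrow> u t \<in> V"
proof -
  assume "t \<in> {0<..<T}"
  then obtain m where m: "1 \<le> m" "m \<le> M" "t \<in> {tt (m - 1)<..tt m}" using in_some_cell by blast
  show ?thesis unfolding chi_u[OF m] by (rule lincomb_V) (use chi_V m in auto)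
qed

text \<open>Stated on the open cell because at t_m \<open>deriv\<close> would see the jump to the
  next cell.\<close>

lemma dt_u:
  assumes m: "1 \<le> m" "m \<le> M" and t: "t \<in> cell m"
  shows "dt u t = (\<lambda>x. \<Sum>j\<le>q. (real j * tau m t ^ (j - 1) / k m) * chi m j x)"
proof
  fix x
  have km: "0 < k m" using k_pos m by simp
  have D: "((\<lambda>s. \<Sum>j\<le>q. tau m s ^ j * chi m j x) has_real_derivative
      (\<Sum>j\<le>q. (real j * tau m t ^ (j - 1) / k m) * chi m j x)) (at t)"
  proof (rule DERIV_sum)
    fix j
    have "(tau m has_real_derivative 1 / k m) (at t)"
      unfolding tau_def[abs_def] using km by (auto intro!: derivative_eq_intros)
    from DERIV_power[OF this, of j] show "((\<lambda>s. tau m s ^ j * chi m j x) has_real_derivative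
        (real j * tau m t ^ (j - 1) / k m) * chi m j x) (at t)"
      by (intro DERIV_cmult_right) simp
  qed
  have "((\<lambda>s. u s x) has_real_derivative (\<Sum>j\<le>q. (real j * tau m t ^ (j - 1) / k m) * chi m j x)) (at t)"
    by (rule has_field_derivative_transform_within_open[OF D, of "cell m"])
       (use t chi_u[OF m] in auto)
  then show "dt u t x = (\<Sum>j\<le>q. (real j * tau m t ^ (j - 1) / k m) * chi m j x)"
    unfolding dt_def by (rule DERIV_imp_deriv)
qed

lemma tau_isCont: "1 \<le> m \<Longrightarrow> m \<le> M \<Longrightarrow> isCont (tau m) t"
  using k_pos[of m] unfolding tau_def[abs_def] by (auto intro!: continuous_intros)

lemma tau_ends: "tau m (tt (m - 1)) = 0" "1 \<le> m \<Longrightarrow> m \<le> M \<Longrightarrow> tau m (tt m) = 1"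
  using k_pos[of m] by (auto simp: tau_def kstep_def)

lemma sum_zero_power: "(\<Sum>j\<le>q. (0::real) ^ j * h j) = h 0"
proof -
  have "(\<Sum>j\<le>q. (0::real) ^ j * h j) = (\<Sum>j\<le>q. if j = 0 then h j else 0)"
    by (intro sum.cong) auto
  then show ?thesis by simp
qed

lemma tplus_u: "1 \<le> m \<Longrightarrow> m \<le> M \<Longrightarrow> tplus tt (m - 1) u = chi m 0"
proof
  fix x assume m: "1 \<le> m" "m \<le> M"
  have "Lim (at_right (tt (m - 1))) (\<lambda>t. u t x) = (\<Sum>j\<le>q. tau m (tt (m - 1)) ^ j * chi m j x)"
    by (rule Lim_at_right_eq[OF step[OF m]])
       (use chi_u[OF m] tau_isCont[OF m] in \<open>auto intro!: continuous_intros\<close>)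
  then show "tplus tt (m - 1) u x = chi m 0 x"
    by (simp only: tplus_def tau_ends(1) sum_zero_power)
qed

lemma tminus_u: "1 \<le> m \<Longrightarrow> m \<le> M \<Longrightarrow> tminus tt m u = (\<lambda>x. \<Sum>j\<le>q. chi m j x)"
proof
  fix x assume m: "1 \<le> m" "m \<le> M"
  have "Lim (at_left (tt m)) (\<lambda>t. u t x) = (\<Sum>j\<le>q. tau m (tt m) ^ j * chi m j x)"
    by (rule Lim_at_left_eq[OF step[OF m]])
       (use chi_u[OF m] tau_isCont[OF m] in \<open>auto intro!: continuous_intros\<close>)
  then show "tminus tt m u x = (\<Sum>j\<le>q. chi m j x)"
    by (simp add: tminus_def tau_ends(2)[OF m])
qed

lemma tplus_test:
  assumes m: "1 \<le> m" "m \<le> M" and m': "1 \<le> m'" "m' \<le> M"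
  shows "tplus tt (m' - 1) (test m i e) = (if m' = m then (\<lambda>x. 0 ^ i * e x) else (\<lambda>x. 0))"
proof
  fix x
  show "tplus tt (m' - 1) (test m i e) x = (if m' = m then (\<lambda>x. 0 ^ i * e x) else (\<lambda>x. 0)) x"
  proof (cases "m' = m")
    case True
    have "Lim (at_right (tt (m - 1))) (\<lambda>t. test m i e t x) = tau m (tt (m - 1)) ^ i * e x"
      by (rule Lim_at_right_eq[OF step[OF m]])
         (use tau_isCont[OF m] in \<open>auto simp: test_in intro!: continuous_intros\<close>)
    with True show ?thesis by (simp add: tplus_def tau_ends(1) del: One_nat_def)
  next
    case False
    have "Lim (at_right (tt (m' - 1))) (\<lambda>t. test m i e t x) = (\<lambda>t. 0) (tt (m' - 1))"
    proof (rule Lim_at_right_eq[OF step[OF m']])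
      fix t assume "t \<in> cell m'"
      then have "t \<notin> {tt (m - 1)<..tt m}" using cells_disjoint[OF m m', of t] False by auto
      then show "test m i e t x = 0" by (simp only: test_out not_False_eq_True)
    qed simp
    with False show ?thesis by (simp add: tplus_def)
  qed
qed

lemma ip_zero_right: "ip v (\<lambda>x. 0) = 0" by (simp add: L2ip_def)

lemma ip_scale_right: "ip v (\<lambda>x. c * w x) = c * ip v w"
  using L2ip_scale[of c w v] L2ip_sym[of v "\<lambda>x. c * w x"] L2ip_sym[of w v] by simp

lemma ip_lin:
  assumes "\<And>j. j \<le> q \<Longrightarrow> h j \<in> V" "w \<in> V"
  shows "ip (\<lambda>x. \<Sum>j\<le>q. c j * h j x) w = (\<Sum>j\<le>q. c j * ip (h j) w)"
  using assms by (intro ip_lincomb) auto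

section \<open>Evaluation of the bilinear form and the scalar step equation\<close>

lemma time_derivative_term:
  assumes m: "1 \<le> m" "m \<le> M" and i: "i \<le> q" and e: "e \<in> V"
  shows "(\<Sum>m'=1..M. LINT t:{tt (m' - 1)<..tt m'}|lborel. ip (dt u t) (test m i e t))
    = (\<Sum>j\<le>q. refD i j * ip (chi m j) e) - (if i = 0 then ip (chi m 0) e else 0)"
proof -
  have km: "0 < k m" using k_pos m by simp
  have off: "(LINT t:{tt (m' - 1)<..tt m'}|lborel. ip (dt u t) (test m i e t)) = 0"
    if "m' \<in> {1..M}" "m' \<noteq> m" for m'
  proof -
    have "t \<notin> {tt (m - 1)<..tt m}" if "t \<in> {tt (m' - 1)<..tt m'}" for t
      using cells_disjoint[OF m, of m' t] that \<open>m' \<in> _\<close> \<open>m' \<noteq> m\<close> by auto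
    then have eq: "indicator {tt (m' - 1)<..tt m'} t *\<^sub>R ip (dt u t) (test m i e t) = 0" for t
    proof (cases "t \<in> {tt (m' - 1)<..tt m'}")
      case True
      have "test m i e t = (\<lambda>x. 0)"
        using \<open>\<And>t. t \<in> {tt (m' - 1)<..tt m'} \<Longrightarrow> t \<notin> {tt (m - 1)<..tt m}\<close>[OF True] by (rule test_out)
      then show ?thesis by (simp only: ip_zero_right scaleR_zero_right)
    qed (simp only: indicator_simps scaleR_zero_left not_False_eq_True)
    show ?thesis unfolding set_lebesgue_integral_def eq by simp
  qed
  have pt: "ip (dt u t) (test m i e t) = (\<Sum>j\<le>q. (real j / k m * ip (chi m j) e) * tau m t ^ ((j - 1) + i))"
    if t: "t \<in> cell m" for t
  proof -
    have "ip (dt u t) (test m i e t) = tau m t ^ i * ip (dt u t) e"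
      using t by (auto simp: test_in ip_scale_right)
    also have "ip (dt u t) e = (\<Sum>j\<le>q. (real j * tau m t ^ (j - 1) / k m) * ip (chi m j) e)"
      unfolding dt_u[OF m t] using chi_V[OF m] e by (rule ip_lin)
    finally show ?thesis by (simp add: sum_distrib_left power_add mult_ac)
  qed
  have "(\<Sum>m'=1..M. LINT t:{tt (m' - 1)<..tt m'}|lborel. ip (dt u t) (test m i e t))
      = (LINT t:{tt (m - 1)<..tt m}|lborel. ip (dt u t) (test m i e t))"
    using m off by (subst sum.remove[of _ m]) (auto intro!: sum.neutral)
  also have "\<dots> = (LINT t:cell m|lborel. ip (dt u t) (test m i e t))"
    by (rule set_integral_Ioc[OF step[OF m]])
  also have "\<dots> = (LINT t:cell m|lborel. \<Sum>j\<le>q. (real j / k m * ip (chi m j) e) * tau m t ^ ((j - 1) + i))"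
    by (rule set_lebesgue_integral_cong) (use pt in auto)
  also have "\<dots> = (\<Sum>j\<le>q. (real j / k m * ip (chi m j) e) * (k m / real ((j - 1) + i + 1)))"
    by (rule tau_poly_integral[OF m])
  \<comment> \<open>The entry (0, 0) of \<open>refD\<close> stems from the jump, which the pure time
    derivative lacks. For j = 0 the truncated exponent \<open>j - 1\<close> is harmless because the
    factor j vanishes.\<close>
  also have "\<dots> = (\<Sum>j\<le>q. refD i j * ip (chi m j) e - (if j = 0 then (if i = 0 then ip (chi m 0) e else 0) else 0))"
  proof (intro sum.cong refl)
    fix j
    show "(real j / k m * ip (chi m j) e) * (k m / real ((j - 1) + i + 1))
      = refD i j * ip (chi m j) e - (if j = 0 then (if i = 0 then ip (chi m 0) e else 0) else 0)"
      using km by (cases j) (auto simp: refD_def add_ac)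
  qed
  also have "\<dots> = (\<Sum>j\<le>q. refD i j * ip (chi m j) e) - (if i = 0 then ip (chi m 0) e else 0)"
    by (simp add: sum_subtractf)
  finally show ?thesis .
qed

text \<open>Against an eigenfunction the gradient form is its eigenvalue times the L2 product, which
  leaves the mass matrix in time.\<close>

lemma stiffness_term:
  assumes m: "1 \<le> m" "m \<le> M" and i: "i \<le> q" and e: "e \<in> V" and ev: "(\<lambda>x. - L e x) = (\<lambda>x. l * e x)"
  shows "(LINT t:{tt 0<..<tt M}|lborel. grad_ip \<Omega> (u t) (test m i e t))
    = l * k m * (\<Sum>j\<le>q. refH i j * ip (chi m j) e)"
proof -
  have g: "grad_ip \<Omega> v e = l * ip v e" if "v \<in> V" for v
  proof -
    have "grad_ip \<Omega> v e = ip (\<lambda>x. - L e x) v"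
      using weak[OF e that] grad_ip_sym by simp
    then show ?thesis unfolding ev L2ip_scale by (simp add: L2ip_sym)
  qed
  have "(LINT t:{tt 0<..<tt M}|lborel. grad_ip \<Omega> (u t) (test m i e t)) = (LINT t:cell m|lborel. grad_ip \<Omega> (u t) (test m i e t))"
    unfolding t0 tM
  proof (rule localize_integral[OF m])
    fix t assume "t \<in> {0<..<T}" "t \<notin> {tt (m - 1)<..tt m}"
    then have "grad_ip \<Omega> (u t) (test m i e t) = grad_ip \<Omega> (\<lambda>x. 0 * e x) (u t)"
      by (subst grad_ip_sym) (simp only: test_out mult_zero_left not_False_eq_True)
    also have "\<dots> = 0 * grad_ip \<Omega> e (u t)" using \<open>t \<in> {0<..<T}\<close> by (intro grad_ip_scale e u_V)
    finally show "grad_ip \<Omega> (u t) (test m i e t) = 0" by simp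
  qed
  also have "\<dots> = (LINT t:cell m|lborel. \<Sum>j\<le>q. (l * ip (chi m j) e) * tau m t ^ (j + i))"
  proof (rule set_lebesgue_integral_cong, simp, intro allI impI)
    fix t assume t: "t \<in> cell m"
    then have tT: "t \<in> {0<..<T}" using ivl_sub[OF m] by blast
    have "grad_ip \<Omega> (u t) (test m i e t) = grad_ip \<Omega> (\<lambda>x. tau m t ^ i * e x) (u t)"
      using t by (auto simp: test_in grad_ip_sym)
    also have "\<dots> = tau m t ^ i * grad_ip \<Omega> (u t) e"
      using grad_ip_scale[OF e u_V[OF tT]] by (simp add: grad_ip_sym)
    also have "grad_ip \<Omega> (u t) e = l * ip (u t) e" by (rule g[OF u_V[OF tT]])
    also have "ip (u t) e = (\<Sum>j\<le>q. tau m t ^ j * ip (chi m j) e)"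
    proof -
      have "t \<in> {tt (m - 1)<..tt m}" using t by auto
      from chi_u[OF m this] show ?thesis using ip_lin[OF chi_V[OF m] e] by simp
    qed
    finally show "grad_ip \<Omega> (u t) (test m i e t) = (\<Sum>j\<le>q. (l * ip (chi m j) e) * tau m t ^ (j + i))"
      by (simp add: sum_distrib_left power_add mult_ac)
  qed
  also have "\<dots> = (\<Sum>j\<le>q. (l * ip (chi m j) e) * (k m / real (j + i + 1)))"
    by (rule tau_poly_integral[OF m])
  also have "\<dots> = l * k m * (\<Sum>j\<le>q. refH i j * ip (chi m j) e)"
    unfolding sum_distrib_left by (intro sum.cong refl) (simp add: refH_def add_ac mult_ac)
  finally show ?thesis .
qed

text \<open>Left limit of \<open>u\<close> at t_(m-1), and 0 on the first step, so that the initial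
  term has the same form as a jump.\<close>

definition "prev m x = (if 1 < m then \<Sum>j\<le>q. chi (m - 1) j x else 0)"

lemma prev_V: "m \<le> M \<Longrightarrow> prev m \<in> V"
proof (cases "1 < m")
  case True
  assume "m \<le> M"
  then have "(\<lambda>x. \<Sum>j\<le>q. 1 * chi (m - 1) j x) \<in> V" using True by (intro lincomb_V chi_V) auto
  with True show ?thesis by (simp add: prev_def[abs_def])
qed (simp add: prev_def[abs_def] fe_zero)

lemma jump_eq:
  assumes m: "1 \<le> m" "m \<le> M"
  shows "jump_prev tt m u = (\<lambda>x. chi m 0 x - prev m x)"
proof (cases "m = 1")
  case True
  then show ?thesis using tplus_u[OF m] by (simp add: jump_prev_def prev_def)
next
  case False
  then have "tminus tt (m - 1) u = (\<lambda>x. \<Sum>j\<le>q. chi (m - 1) j x)" using m by (intro tminus_u) auto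
  then show ?thesis using False m tplus_u[OF m] by (simp add: jump_prev_def tjump_def prev_def)
qed

text \<open>Only the left end of cell m is seen by the test function, and only for i = 0, because
  higher powers of local time vanish there.\<close>

lemma jump_terms:
  assumes m: "1 \<le> m" "m \<le> M" and i: "i \<le> q" and e: "e \<in> V"
  shows "(\<Sum>m'=2..M. ip (tjump tt (m' - 1) u) (tplus tt (m' - 1) (test m i e))) + ip (tplus tt 0 u) (tplus tt 0 (test m i e))
    = (if i = 0 then ip (chi m 0) e - ip (prev m) e else 0)"
proof -
  have jm: "ip (jump_prev tt m u) e = ip (chi m 0) e - ip (prev m) e"
  proof -
    have "jump_prev tt m u = (\<lambda>x. chi m 0 x + (-1) * prev m x)" using jump_eq[OF m] by simp
    moreover have "ip (\<lambda>x. chi m 0 x + (-1) * prev m x) e = ip (chi m 0) e + ip (\<lambda>x. (-1) * prev m x) e"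
      by (rule L2ip_add[OF chi_V[OF m] fe_scale[OF prev_V[OF m(2)]] e]) simp
    ultimately show ?thesis using L2ip_scale[of "-1" "prev m" e] by simp
  qed
  have z: "ip v (\<lambda>x. 0 ^ i * e x) = (if i = 0 then ip v e else 0)" for v
    unfolding ip_scale_right by simp
  have term': "ip v (tplus tt (m' - 1) (test m i e)) = (if m' = m then (if i = 0 then ip v e else 0) else 0)"
    if "1 \<le> m'" "m' \<le> M" for v m'
    unfolding tplus_test[OF m that] using z ip_zero_right by simp
  have "ip (tplus tt 0 u) (tplus tt 0 (test m i e)) = (if 1 = m then (if i = 0 then ip (tplus tt 0 u) e else 0) else 0)"
    using term'[of 1] M1 by simp
  moreover have "(\<Sum>m'=2..M. ip (tjump tt (m' - 1) u) (tplus tt (m' - 1) (test m i e)))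
     = (\<Sum>m'=2..M. if m' = m then (if i = 0 then ip (tjump tt (m - 1) u) e else 0) else 0)"
    by (intro sum.cong refl) (subst term', auto)
  ultimately have "(\<Sum>m'=2..M. ip (tjump tt (m' - 1) u) (tplus tt (m' - 1) (test m i e))) + ip (tplus tt 0 u) (tplus tt 0 (test m i e))
    = (if i = 0 then ip (jump_prev tt m u) e else 0)"
    using m by (auto simp: jump_prev_def)
  then show ?thesis unfolding jm .
qed

text \<open>The jump restores the entry (0, 0) of \<open>refD\<close> and moves the previous end
  value to the right side; what remains is row i of \<open>refB\<close> at z = k\<lambda>.\<close>

theorem cell_equation:
  assumes m: "1 \<le> m" "m \<le> M" and i: "i \<le> q" and e: "e \<in> V" and ev: "(\<lambda>x. - L e x) = (\<lambda>x. l * e x)"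
  shows "(\<Sum>j\<le>q. (refD i j + k m * l * refH i j) * ip (chi m j) e)
    = (if i = 0 \<and> 1 < m then \<Sum>j\<le>q. ip (chi (m - 1) j) e else 0)
      + (LINT t:cell m|lborel. tau m t ^ i * ip (Pf t) e)"
proof -
  have "rhsF \<Omega> T f (test m i e) = (LINT t:cell m|lborel. ip (f t) (test m i e t))"
    unfolding rhsF_def by (rule localize_integral[OF m]) (simp only: test_out ip_zero_right not_False_eq_True)
  also have "\<dots> = (LINT t:cell m|lborel. tau m t ^ i * ip (Pf t) e)"
  proof (rule set_lebesgue_integral_cong, simp, intro allI impI)
    fix t assume t: "t \<in> cell m"
    then have "t \<in> {0<..<T}" using ivl_sub[OF m] by blast
    then have "ip (f t) e = ip (Pf t) e" using proj e by (simp add: is_L2_projection_def)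
    then show "ip (f t) (test m i e t) = tau m t ^ i * ip (Pf t) e"
      using t by (auto simp: test_in ip_scale_right)
  qed
  finally have rhs: "rhsF \<Omega> T f (test m i e) = (LINT t:cell m|lborel. tau m t ^ i * ip (Pf t) e)" .
  have "bilinB \<Omega> M tt u (test m i e)
     = (\<Sum>j\<le>q. refD i j * ip (chi m j) e) + l * k m * (\<Sum>j\<le>q. refH i j * ip (chi m j) e)
       - (if i = 0 then ip (prev m) e else 0)"
    unfolding bilinB_def time_derivative_term[OF m i e] stiffness_term[OF m i e ev]
    using jump_terms[OF m i e] by (simp split: if_splits)
  moreover have "ip (prev m) e = (if 1 < m then \<Sum>j\<le>q. ip (chi (m - 1) j) e else 0)"
  proof (cases "1 < m")
    case True
    then have "ip (\<lambda>x. \<Sum>j\<le>q. 1 * chi (m - 1) j x) e = (\<Sum>j\<le>q. 1 * ip (chi (m - 1) j) e)"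
      using m e by (intro ip_lin chi_V) auto
    with True show ?thesis by (simp add: prev_def[abs_def])
  qed (simp add: prev_def[abs_def] L2ip_def)
  moreover have "(\<Sum>j\<le>q. (refD i j + k m * l * refH i j) * ip (chi m j) e)
     = (\<Sum>j\<le>q. refD i j * ip (chi m j) e) + l * k m * (\<Sum>j\<le>q. refH i j * ip (chi m j) e)"
    unfolding sum_distrib_left sum.distrib[symmetric] by (intro sum.cong refl) (simp add: algebra_simps)
  ultimately show ?thesis using dg_eq[OF test_X[OF m i e]] unfolding rhs by (auto split: if_splits)
qed

end

section \<open>Maximal parabolic regularity\<close>

context coord_norm
begin

lemma nr_continuous: "continuous_on UNIV nr"
  unfolding continuous_on_def
proof (intro ballI tendsto_nr)
  fix x :: "nat \<Rightarrow> complex" and i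
  show "((\<lambda>y. y i) \<longlongrightarrow> x i) (at x within UNIV)"
    using continuous_on_product_coordinates[of i] unfolding continuous_on_def by blast
qed

text \<open>Coordinates from n on are replaced by 0, which makes the whole sequence measurable in
  the product topology and leaves \<open>nr\<close> unchanged.\<close>

lemma nr_measurable:
  assumes "\<And>p. p < n \<Longrightarrow> (\<lambda>t. c t p) \<in> borel_measurable M"
  shows "(\<lambda>t. nr (c t)) \<in> borel_measurable M"
proof -
  let ?c = "\<lambda>t p. if p < n then c t p else 0"
  have "(\<lambda>t. ?c t p) \<in> borel_measurable M" for p using assms[of p] by (cases "p < n") auto
  then have "?c \<in> borel_measurable M" by (rule measurable_coordinatewise_then_product)
  then have "(\<lambda>t. nr (?c t)) \<in> borel_measurable M"
    using borel_measurable_continuous_onI[OF nr_continuous] by (rule measurable_compose)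
  moreover have "nr (?c t) = nr (c t)" for t by (rule nr_cong) simp
  ultimately show ?thesis by simp
qed

lemma nr_comb:
  assumes "\<And>j. j \<le> q \<Longrightarrow> cmod (a j) \<le> A" "\<And>j. j \<le> q \<Longrightarrow> nr (h j) \<le> B" "0 \<le> A"
  shows "nr (\<lambda>p. \<Sum>j\<le>(q::nat). a j * h j p) \<le> real (q + 1) * (A * B)"
proof -
  have "nr (\<lambda>p. \<Sum>j\<le>q. a j * h j p) \<le> (\<Sum>j\<le>q. nr (\<lambda>p. a j * h j p))" by (rule nr_sum) simp
  also have "\<dots> \<le> (\<Sum>j\<le>q. A * B)"
    unfolding nr_scale using assms nr_nonneg by (intro sum_mono mult_mono) auto
  finally show ?thesis by simp
qed

end

section \<open>Transfer of the given norm to eigen-coordinates\<close>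

locale dg_coords = dg_setup \<Omega> simp r Th T M tt q L u f Pf
  for \<Omega> :: "'a::euclidean_space set" and simp r Th T M tt q L u f Pf +
  fixes n :: nat and e :: "nat \<Rightarrow> 'a \<Rightarrow> real" and lam :: "nat \<Rightarrow> real"
    and N :: "('a \<Rightarrow> complex) \<Rightarrow> real" and Mh \<gamma> :: real
  assumes eig: "eigensystem n e lam"
    and expand: "v \<in> fe_space simp r \<Omega> Th \<Longrightarrow> v = (\<lambda>x. \<Sum>i<n. L2ip \<Omega> v (e i) * e i x)"
    and N: "is_cnorm_on (cfe_space (fe_space simp r \<Omega> Th)) N"
    and res: "z \<notin> sector \<gamma> \<Longrightarrow> w \<in> cfe_space (fe_space simp r \<Omega> Th) \<Longrightarrow> \<psi> \<in> cfe_space (fe_space simp r \<Omega> Th) \<Longrightarrow>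
            (\<lambda>x. z * w x + cext L w x) = \<psi> \<Longrightarrow> N w \<le> Mh / cmod z * N \<psi>"
    and \<gamma>: "0 < \<gamma>" "\<gamma> < pi / 2"
begin

definition "csyn c = (\<lambda>x. \<Sum>i<n. c i * complex_of_real (e i x))"
definition "nr c = N (csyn c)"

lemma e_V: "i < n \<Longrightarrow> e i \<in> V" and e_lam: "i < n \<Longrightarrow> (\<lambda>x. - L (e i) x) = (\<lambda>x. lam i * e i x)"
  and lam0: "i < n \<Longrightarrow> 0 \<le> lam i"
  and orth: "i < n \<Longrightarrow> j < n \<Longrightarrow> ip (e i) (e j) = (if i = j then 1 else 0)"
  using eig by (auto simp: eigensystem_def)

lemma Re_csyn: "(\<lambda>x. Re (csyn c x)) = (\<lambda>x. \<Sum>i<n. Re (c i) * e i x)"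
  and Im_csyn: "(\<lambda>x. Im (csyn c x)) = (\<lambda>x. \<Sum>i<n. Im (c i) * e i x)"
  by (auto simp: csyn_def)

lemma csyn_V: "csyn c \<in> cfe_space V"
  unfolding cfe_space_def mem_Collect_eq Re_csyn Im_csyn using e_V by (intro conjI lincomb_V) auto

lemma cplx_csyn: "v \<in> V \<Longrightarrow> cplx v = csyn (\<lambda>p. of_real (ip v (e p)))"
proof
  fix x assume v: "v \<in> V"
  have "v x = (\<Sum>i<n. ip v (e i) * e i x)" using fun_cong[OF expand[OF v], of x] .
  then show "cplx v x = csyn (\<lambda>p. of_real (ip v (e p))) x" by (simp add: cplx_def csyn_def)
qed

lemma N_cplx: "v \<in> V \<Longrightarrow> N (cplx v) = nr (\<lambda>p. of_real (ip v (e p)))"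
  by (simp add: nr_def cplx_csyn)

sublocale coord_norm n nr
proof
  fix a c d
  show "0 \<le> nr c" using N csyn_V unfolding nr_def is_cnorm_on_def by blast
  have "csyn (\<lambda>i. a * c i) = (\<lambda>x. a * csyn c x)" by (simp add: csyn_def sum_distrib_left mult_ac)
  then show "nr (\<lambda>i. a * c i) = cmod a * nr c" using N csyn_V unfolding nr_def is_cnorm_on_def by simp
  have "csyn (\<lambda>i. c i + d i) = (\<lambda>x. csyn c x + csyn d x)" by (simp add: csyn_def sum.distrib distrib_right)
  then show "nr (\<lambda>i. c i + d i) \<le> nr c + nr d" using N csyn_V unfolding nr_def is_cnorm_on_def by simp
  assume "\<And>i. i < n \<Longrightarrow> c i = d i"
  then have "csyn c = csyn d" by (simp add: csyn_def)
  then show "nr c = nr d" by (simp add: nr_def)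
qed

lemma L_lin: "L (\<lambda>x. \<Sum>i<n. a i * e i x) = (\<lambda>x. \<Sum>i<n. - (lam i * a i) * e i x)"
proof
  fix x
  have "- L (\<lambda>x. \<Sum>i<n. a i * e i x) x = (\<Sum>i<n. a i * - L (e i) x)"
    using fun_cong[OF A_lincomb[of "{..<n}" e a], of x] e_V by simp
  also have "\<dots> = (\<Sum>i<n. a i * (lam i * e i x))"
    by (intro sum.cong refl) (use fun_cong[OF e_lam, of _ x] in auto)
  finally have "L (\<lambda>x. \<Sum>i<n. a i * e i x) x = - (\<Sum>i<n. a i * (lam i * e i x))" by simp
  then show "L (\<lambda>x. \<Sum>i<n. a i * e i x) x = (\<Sum>i<n. - (lam i * a i) * e i x)"
    unfolding sum_negf[symmetric] by (simp add: mult_ac)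
qed

lemma cext_csyn: "cext L (csyn c) = csyn (\<lambda>i. - (of_real (lam i) * c i))"
proof
  fix x
  have "cext L (csyn c) x = complex_of_real (\<Sum>i<n. - (lam i * Re (c i)) * e i x)
      + \<i> * complex_of_real (\<Sum>i<n. - (lam i * Im (c i)) * e i x)"
    unfolding cext_def Re_csyn Im_csyn L_lin ..
  also have "\<dots> = (\<Sum>i<n. complex_of_real (- (lam i * Re (c i)) * e i x) + \<i> * complex_of_real (- (lam i * Im (c i)) * e i x))"
    unfolding of_real_sum sum_distrib_left sum.distrib ..
  also have "\<dots> = csyn (\<lambda>i. - (of_real (lam i) * c i)) x"
    unfolding csyn_def by (intro sum.cong refl) (simp add: complex_eq_iff)
  finally show "cext L (csyn c) x = csyn (\<lambda>i. - (of_real (lam i) * c i)) x" .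
qed

lemma nonneg_in_sector: "0 \<le> x \<Longrightarrow> complex_of_real x \<in> sector \<gamma>"
  using \<gamma> Arg_of_real[of x] by (simp add: sector_def)

text \<open>The equation (z + Delta_h) w = \<psi> is solved coordinatewise by dividing by z -
  \<open>lam i\<close>, which is nonzero because nonnegative reals lie in the sector.\<close>

lemma nr_resolvent:
  assumes z: "z \<notin> sector \<gamma>"
  shows "nr (\<lambda>i. c i / (z - of_real (lam i))) \<le> Mh / cmod z * nr c"
  unfolding nr_def
proof (rule res[OF z csyn_V csyn_V])
  let ?d = "\<lambda>i. c i / (z - of_real (lam i))"
  show "(\<lambda>x. z * csyn ?d x + cext L (csyn ?d) x) = csyn c"
  proof
    fix x
    have "z * csyn ?d x + cext L (csyn ?d) x
        = (\<Sum>i<n. (z * ?d i + - (of_real (lam i) * ?d i)) * complex_of_real (e i x))"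
      unfolding cext_csyn unfolding csyn_def sum_distrib_left sum.distrib[symmetric]
      by (intro sum.cong refl) (simp only: distrib_right mult.assoc mult_minus_left)
    also have "\<dots> = csyn c x"
      unfolding csyn_def
    proof (intro sum.cong refl)
      fix i assume "i \<in> {..<n}"
      then have "z \<noteq> of_real (lam i)" using z nonneg_in_sector lam0 by auto
      then have "(z - of_real (lam i)) * ?d i = c i" by simp
      then show "(z * ?d i + - (of_real (lam i) * ?d i)) * complex_of_real (e i x) = c i * complex_of_real (e i x)"
        by (simp only: left_diff_distrib add_uminus_conv_diff)
    qed
    finally show "z * csyn ?d x + cext L (csyn ?d) x = csyn c x" .
  qed
qed

text \<open>For an eigenfunction and z = -(\<lambda> + 1) the resolvent estimate reads 1/(2\<lambda>
  + 1) <= Mh/(\<lambda> + 1), and (\<lambda> + 1)/(2\<lambda> + 1) >= 1/2.\<close>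

lemma Mh_half: assumes "0 < n" shows "1 / 2 \<le> Mh"
proof -
  let ?c = "\<lambda>i. if i = 0 then 1 else (0::complex)" and ?z = "complex_of_real (- (lam 0 + 1))"
  have l: "0 \<le> lam 0" using lam0 assms by simp
  have "csyn ?c = cplx (e 0)"
  proof
    fix x
    have "csyn ?c x = (\<Sum>i<n. if i = 0 then complex_of_real (e i x) else 0)"
      unfolding csyn_def by (intro sum.cong) auto
    then show "csyn ?c x = cplx (e 0) x" using assms by (simp add: cplx_def)
  qed
  moreover have "cplx (e 0) \<noteq> (\<lambda>x. 0)"
  proof
    assume *: "cplx (e 0) = (\<lambda>x. 0)"
    have "e 0 x = 0" for x using fun_cong[OF *, of x] by (simp add: cplx_def)
    then have "e 0 = (\<lambda>x. 0)" by blast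
    then have "ip (e 0) (e 0) = 0" using ip_zero_right by simp
    then show False using orth assms by simp
  qed
  ultimately have "nr ?c \<noteq> 0" using N csyn_V[of ?c] unfolding nr_def is_cnorm_on_def by metis
  then have c: "0 < nr ?c" using nr_nonneg[of ?c] by linarith
  have z: "?z \<notin> sector \<gamma>"
    using l \<gamma> Arg_of_real[of "- (lam 0 + 1)"] pi_gt_zero unfolding sector_def by (auto simp del: pi_gt_zero)
  have "nr (\<lambda>i. ?c i / (?z - of_real (lam i))) = nr (\<lambda>i. (1 / (?z - of_real (lam 0))) * ?c i)"
    by (rule nr_cong) simp
  also have "\<dots> = nr ?c / (2 * lam 0 + 1)"
  proof -
    have "?z - of_real (lam 0) = of_real (- (2 * lam 0 + 1))" by simp
    then have "cmod (?z - of_real (lam 0)) = 2 * lam 0 + 1" using l by (simp only: norm_of_real)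
    then show ?thesis unfolding nr_scale by (simp only: norm_divide norm_one) simp
  qed
  finally have "nr ?c / (2 * lam 0 + 1) \<le> Mh / cmod ?z * nr ?c" using nr_resolvent[OF z, of ?c] by simp
  moreover have "cmod ?z = lam 0 + 1" using l by (simp only: norm_of_real)
  ultimately have "nr ?c * (1 / (2 * lam 0 + 1)) \<le> nr ?c * (Mh / (lam 0 + 1))" by (simp only: mult.commute) simp
  then have "1 / (2 * lam 0 + 1) \<le> Mh / (lam 0 + 1)" using c by (simp only: mult_le_cancel_left_pos)
  then have "(lam 0 + 1) / (2 * lam 0 + 1) \<le> Mh" using l by (simp add: field_simps)
  moreover have "1 / 2 \<le> (lam 0 + 1) / (2 * lam 0 + 1)" using l by (simp add: field_simps)
  ultimately show ?thesis by linarith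
qed

lemma sectorial: "0 < n \<Longrightarrow> sectorial n nr lam Mh \<gamma>"
  by unfold_locales (use lam0 Mh_half nr_resolvent in auto)

definition "g t = N (cplx (Pf t))"

lemma Pf_V: "t \<in> {0<..<T} \<Longrightarrow> Pf t \<in> V" using proj by (simp add: is_L2_projection_def)

lemma f_Pf: "t \<in> {0<..<T} \<Longrightarrow> v \<in> V \<Longrightarrow> ip (f t) v = ip (Pf t) v"
  using proj by (simp add: is_L2_projection_def)

lemma g_eq: "t \<in> {0<..<T} \<Longrightarrow> g t = nr (\<lambda>p. of_real (ip (Pf t) (e p)))"
  by (simp add: g_def N_cplx Pf_V)

lemma g_nonneg: "t \<in> {0<..<T} \<Longrightarrow> 0 \<le> g t"
  by (simp add: g_eq nr_nonneg)

text \<open>The eigenfunction, constant in time, belongs to the trial space, so its integrability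
  against f is part of the assumption.\<close>

lemma Pf_int:
  assumes p: "p < n"
  shows "set_integrable lborel {0<..<T} (\<lambda>t. ip (Pf t) (e p))"
proof -
  have "(\<lambda>t. e p) \<in> X"
    unfolding dG_space_def
  proof (intro CollectI ballI exI[of _ "\<lambda>j. if j = 0 then e p else (\<lambda>x. 0)"] conjI allI impI ext)
    fix j
    show "(if j = 0 then e p else (\<lambda>x. 0)) \<in> V" using e_V[OF p] fe_zero by simp
  next
    fix m t x
    have "(\<Sum>j\<le>q. t ^ j * (if j = 0 then e p else (\<lambda>x. 0)) x) = (\<Sum>j\<le>q. if j = 0 then e p x else 0)"
      by (intro sum.cong) auto
    then show "e p x = (\<Sum>j\<le>q. t ^ j * (if j = 0 then e p else (\<lambda>x. 0)) x)" by simp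
  qed
  from fint[OF this] show ?thesis
    by (subst set_integrable_cong[where f'="\<lambda>t. ip (f t) (e p)"]) (auto simp: f_Pf e_V p)
qed

lemma Pf_moment_int:
  assumes m: "1 \<le> m" "m \<le> M" and i: "i \<le> q" and p: "p < n"
  shows "set_integrable lborel (cell m) (\<lambda>t. tau m t ^ i * ip (Pf t) (e p))"
proof -
  have "set_integrable lborel (cell m) (\<lambda>t. ip (f t) (test m i (e p) t))"
    by (rule set_integrable_subset[OF fint[OF test_X[OF m i e_V[OF p]]] _ ivl_sub[OF m]]) simp
  moreover have "ip (f t) (test m i (e p) t) = tau m t ^ i * ip (Pf t) (e p)" if "t \<in> cell m" for t
  proof -
    have "t \<in> {0<..<T}" "t \<in> {tt (m - 1)<..tt m}" using that ivl_sub[OF m] by auto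
    then show ?thesis using f_Pf[OF _ e_V[OF p], of t] by (simp only: test_in ip_scale_right)
  qed
  ultimately show ?thesis by (subst set_integrable_cong[where f'="\<lambda>t. ip (f t) (test m i (e p) t)"]) auto
qed

lemma g_int: "set_integrable lborel {0<..<T} g"
proof -
  let ?c = "\<lambda>t p. complex_of_real (indicator {0<..<T} t * ip (Pf t) (e p))"
  have int: "integrable lborel (\<lambda>t. indicator {0<..<T} t * ip (Pf t) (e p))" if "p < n" for p
    using Pf_int[OF that] by (simp add: set_integrable_def)
  have eq: "indicator {0<..<T} t *\<^sub>R g t = nr (?c t)" for t
    by (cases "t \<in> {0<..<T}") (simp_all add: g_eq)
  have "integrable lborel (\<lambda>t. nr (?c t))"
  proof (rule Bochner_Integration.integrable_bound)
    show "integrable lborel (\<lambda>t. \<Sum>p<n. \<bar>indicator {0<..<T} t * ip (Pf t) (e p)\<bar> * nr (\<lambda>i. if i = p then 1 else 0))"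
      using int by (intro Bochner_Integration.integrable_sum integrable_mult_left integrable_abs) auto
    show "(\<lambda>t. nr (?c t)) \<in> borel_measurable lborel"
      using int by (intro nr_measurable) (auto intro!: borel_measurable_of_real[THEN measurable_compose[rotated]] simp del: of_real_mult)
    show "AE t in lborel. norm (nr (?c t)) \<le> norm (\<Sum>p<n. \<bar>indicator {0<..<T} t * ip (Pf t) (e p)\<bar> * nr (\<lambda>i. if i = p then 1 else 0))"
    proof (rule AE_I2)
      fix t
      have "nr (?c t) \<le> (\<Sum>p<n. \<bar>indicator {0<..<T} t * ip (Pf t) (e p)\<bar> * nr (\<lambda>i. if i = p then 1 else 0))"
        using nr_coord_le[of "?c t"] unfolding norm_of_real .
      then show "norm (nr (?c t)) \<le> norm (\<Sum>p<n. \<bar>indicator {0<..<T} t * ip (Pf t) (e p)\<bar> * nr (\<lambda>i. if i = p then 1 else 0))"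
        using nr_nonneg[of "?c t"] by simp
    qed
  qed
  then show ?thesis unfolding set_integrable_def eq .
qed

definition "Yc m j p = complex_of_real (ip (chi m j) (e p))"
definition "Fc m i p = complex_of_real ((LINT t:cell m|lborel. tau m t ^ i * ip (Pf t) (e p)) / k m)"

lemma scheme_eq:
  assumes m: "1 \<le> m" "m \<le> M" and i: "i \<le> q" and p: "p < n"
  shows "(\<Sum>j\<le>q. refB (of_real (k m * lam p)) i j * Yc m j p)
          = (if i = 0 \<and> 1 < m then \<Sum>j\<le>q. Yc (m - 1) j p else 0) + of_real (k m) * Fc m i p"
proof -
  have km: "k m \<noteq> 0" using k_pos[OF m] by simp
  have "(\<Sum>j\<le>q. refB (of_real (k m * lam p)) i j * Yc m j p)
      = of_real (\<Sum>j\<le>q. (refD i j + k m * lam p * refH i j) * ip (chi m j) (e p))"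
    by (simp add: refB_def Yc_def)
  also have "\<dots> = of_real ((if i = 0 \<and> 1 < m then \<Sum>j\<le>q. ip (chi (m - 1) j) (e p) else 0)
      + (LINT t:cell m|lborel. tau m t ^ i * ip (Pf t) (e p)))"
    unfolding cell_equation[OF m i e_V[OF p] e_lam[OF p]] ..
  also have "\<dots> = (if i = 0 \<and> 1 < m then \<Sum>j\<le>q. Yc (m - 1) j p else 0) + of_real (k m) * Fc m i p"
    using km by (simp add: Yc_def Fc_def)
  finally show ?thesis .
qed

text \<open>Powers of local time lie between 0 and 1, so the triangle inequality for integrals
  bounds every moment by the mean of the norm.\<close>

lemma Fc_bound:
  assumes m: "1 \<le> m" "m \<le> M" and i: "i \<le> q"
  shows "nr (Fc m i) \<le> avg g m"
proof -
  have km: "0 < k m" using k_pos[OF m] .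
  let ?a = "tt (m - 1)" and ?b = "tt m"
  let ?c = "\<lambda>t p. if t \<in> cell m then complex_of_real ((tau m t ^ i * ip (Pf t) (e p)) / k m) else 0"
  let ?g = "\<lambda>t. if t \<in> cell m then g t / k m else 0"
  have hi: "((\<lambda>t. if t \<in> cell m then h t / k m else 0) has_integral (LINT t:cell m|lborel. h t) / k m) (cbox ?a ?b)"
    if h: "set_integrable lborel (cell m) h" for h :: "real \<Rightarrow> real"
  proof -
    have "(h has_integral (LINT t:cell m|lborel. h t)) (cell m)"
      using set_borel_integral_eq_integral[OF h] by (simp add: has_integral_integral)
    then have "((\<lambda>t. h t / k m) has_integral (LINT t:cell m|lborel. h t) / k m) (cell m)"
      by (rule has_integral_divide)
    then have "((\<lambda>t. if t \<in> cell m then h t / k m else 0) has_integral (LINT t:cell m|lborel. h t) / k m) (cell m)"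
      by (rule has_integral_eq[rotated]) simp
    then show ?thesis unfolding box_real has_integral_Icc_iff_Ioo .
  qed
  show ?thesis
  proof (rule nr_integral_le[of ?c _ ?a ?b ?g])
    fix p assume p: "p < n"
    have "((\<lambda>t. complex_of_real (if t \<in> cell m then (tau m t ^ i * ip (Pf t) (e p)) / k m else 0)) has_integral Fc m i p) (cbox ?a ?b)"
      using has_integral_linear[OF hi[OF Pf_moment_int[OF m i p]] bounded_linear_of_real] by (simp only: o_def Fc_def)
    then show "((\<lambda>t. ?c t p) has_integral Fc m i p) (cbox ?a ?b)"
      by (rule has_integral_eq[rotated]) simp
  next
    show "(?g has_integral avg g m) (cbox ?a ?b)"
      unfolding avg_def by (rule hi[OF set_integrable_subset[OF g_int _ ivl_sub[OF m]]]) simp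
  next
    fix t
    show "nr (?c t) \<le> ?g t"
    proof (cases "t \<in> cell m")
      case True
      then have tT: "t \<in> {0<..<T}" using ivl_sub[OF m] by blast
      have "0 \<le> tau m t" "tau m t \<le> 1" using True km by (auto simp: tau_def kstep_def)
      then have tau: "0 \<le> tau m t ^ i" "tau m t ^ i \<le> 1" by (auto intro: power_le_one)
      have "nr (?c t) = nr (\<lambda>p. of_real (tau m t ^ i / k m) * of_real (ip (Pf t) (e p)))"
        using True by (intro nr_cong) simp
      also have "\<dots> = (tau m t ^ i / k m) * g t"
        unfolding nr_scale g_eq[OF tT] norm_of_real using tau km by simp
      also have "\<dots> \<le> (1 / k m) * g t"
        using tau km g_nonneg[OF tT] by (intro mult_right_mono divide_right_mono) auto
      finally show ?thesis using True by simp
    next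
      case False
      then have "nr (?c t) = nr (\<lambda>p. 0)" by (intro nr_cong) (simp only: if_False)
      with False show ?thesis by (simp only: if_False nr_zero)
    qed
  qed
qed

lemma ip_L: "v \<in> V \<Longrightarrow> p < n \<Longrightarrow> ip (L v) (e p) = - (lam p * ip v (e p))"
proof -
  assume v: "v \<in> V" and p: "p < n"
  have "ip (\<lambda>x. - L v x) (e p) = ip (\<lambda>x. - L (e p) x) v" by (rule A_sym[OF v e_V[OF p]])
  also have "\<dots> = lam p * ip (e p) v" unfolding e_lam[OF p] by (rule L2ip_scale)
  also have "ip (e p) v = ip v (e p)" by (rule L2ip_sym)
  finally show ?thesis using L2ip_scale[of "-1" "L v" "e p"] by simp
qed

section \<open>Norms of the three quantities and summation over the steps\<close>

lemma N_Lu: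
  assumes m: "1 \<le> m" "m \<le> M" and t: "t \<in> cell m"
  shows "N (cplx (L (u t))) = nr (\<lambda>p. \<Sum>j\<le>q. - of_real (tau m t ^ j) * (of_real (lam p) * Yc m j p))"
proof -
  have tT: "t \<in> {0<..<T}" using t ivl_sub[OF m] by blast
  have tI: "t \<in> {tt (m - 1)<..tt m}" using t by simp
  have "N (cplx (L (u t))) = nr (\<lambda>p. of_real (ip (L (u t)) (e p)))" by (rule N_cplx[OF L_V[OF u_V[OF tT]]])
  also have "\<dots> = nr (\<lambda>p. \<Sum>j\<le>q. - of_real (tau m t ^ j) * (of_real (lam p) * Yc m j p))"
  proof (rule nr_cong)
    fix p assume p: "p < n"
    have "ip (u t) (e p) = (\<Sum>j\<le>q. tau m t ^ j * ip (chi m j) (e p))"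
      unfolding chi_u[OF m tI] by (rule ip_lin[OF chi_V[OF m] e_V[OF p]])
    then have "ip (L (u t)) (e p) = (\<Sum>j\<le>q. - (tau m t ^ j) * (lam p * ip (chi m j) (e p)))"
      unfolding ip_L[OF u_V[OF tT] p] by (simp add: sum_distrib_left sum_negf mult_ac)
    then show "of_real (ip (L (u t)) (e p)) = (\<Sum>j\<le>q. - of_real (tau m t ^ j) * (of_real (lam p) * Yc m j p))"
      by (simp add: Yc_def)
  qed
  finally show ?thesis .
qed

lemma dt_V: "1 \<le> m \<Longrightarrow> m \<le> M \<Longrightarrow> t \<in> cell m \<Longrightarrow> dt u t \<in> V"
  unfolding dt_u by (rule lincomb_V) (use chi_V in auto)

text \<open>The term j = 0 carries the factor 0, which leaves \<open>w\<close> free; inserting the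
  previous end value matches the form bounded in \<open>dY_bound\<close>.\<close>

lemma N_dt:
  assumes m: "1 \<le> m" "m \<le> M" and t: "t \<in> cell m"
  shows "N (cplx (dt u t)) = nr (\<lambda>p. \<Sum>j\<le>q. of_real (real j * tau m t ^ (j - 1)) *
            ((Yc m j p - (if j = 0 then w p else 0)) / of_real (k m)))"
proof -
  have "N (cplx (dt u t)) = nr (\<lambda>p. of_real (ip (dt u t) (e p)))" by (rule N_cplx[OF dt_V[OF m t]])
  also have "\<dots> = nr (\<lambda>p. \<Sum>j\<le>q. of_real (real j * tau m t ^ (j - 1)) *
            ((Yc m j p - (if j = 0 then w p else 0)) / of_real (k m)))"
  proof (rule nr_cong)
    fix p assume p: "p < n"
    have "ip (dt u t) (e p) = (\<Sum>j\<le>q. (real j * tau m t ^ (j - 1) / k m) * ip (chi m j) (e p))"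
      unfolding dt_u[OF m t] by (rule ip_lin[OF chi_V[OF m] e_V[OF p]])
    then show "complex_of_real (ip (dt u t) (e p)) = (\<Sum>j\<le>q. of_real (real j * tau m t ^ (j - 1)) *
            ((Yc m j p - (if j = 0 then w p else 0)) / of_real (k m)))"
      by (simp only: of_real_sum) (intro sum.cong refl, auto simp: Yc_def)
  qed
  finally show ?thesis .
qed

definition "uprev m p = (if m = 0 then 0 else \<Sum>j\<le>q. Yc m j p)"

lemma jump_V:
  assumes m: "1 \<le> m" "m \<le> M"
  shows "(\<lambda>x. jump_prev tt m u x / k m) \<in> V"
    and "p < n \<Longrightarrow> complex_of_real (ip (\<lambda>x. jump_prev tt m u x / k m) (e p)) = (Yc m 0 p - uprev (m - 1) p) / of_real (k m)"
proof -
  have eq: "(\<lambda>x. jump_prev tt m u x / k m) = (\<lambda>x. (1 / k m) * (chi m 0 x + (-1) * prev m x))"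
    unfolding jump_eq[OF m] by simp
  have c: "chi m 0 \<in> V" using chi_V[OF m, of 0] by simp
  have pv: "(\<lambda>x. (-1) * prev m x) \<in> V" by (rule fe_scale[OF prev_V[OF m(2)]])
  show "(\<lambda>x. jump_prev tt m u x / k m) \<in> V" unfolding eq by (intro fe_scale fe_add c pv)
  assume p: "p < n"
  have prv: "complex_of_real (ip (prev m) (e p)) = uprev (m - 1) p"
  proof (cases "1 < m")
    case True
    have "ip (\<lambda>x. \<Sum>j\<le>q. 1 * chi (m - 1) j x) (e p) = (\<Sum>j\<le>q. 1 * ip (chi (m - 1) j) (e p))"
      using m True by (intro ip_lin chi_V e_V p) auto
    with True show ?thesis by (simp add: prev_def[abs_def] uprev_def Yc_def)
  next
    case False
    then have "prev m = (\<lambda>x. 0)" "m - 1 = 0" by (auto simp: prev_def)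
    then show ?thesis by (simp add: uprev_def L2ip_def)
  qed
  have "ip (\<lambda>x. jump_prev tt m u x / k m) (e p) = (1 / k m) * (ip (chi m 0) (e p) + (-1) * ip (prev m) (e p))"
    unfolding eq by (subst L2ip_scale, subst L2ip_add[OF c pv e_V[OF p]], subst L2ip_scale) simp
  then show "complex_of_real (ip (\<lambda>x. jump_prev tt m u x / k m) (e p)) = (Yc m 0 p - uprev (m - 1) p) / of_real (k m)"
    unfolding prv[symmetric] Yc_def by simp
qed

lemma N_jump:
  assumes m: "1 \<le> m" "m \<le> M"
  shows "N (cplx (\<lambda>x. jump_prev tt m u x / k m)) = nr (\<lambda>p. (Yc m 0 p - uprev (m - 1) p) / of_real (k m))"
  unfolding N_cplx[OF jump_V(1)[OF m]] by (rule nr_cong) (rule jump_V(2)[OF m])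

abbreviation "LHS s \<equiv> piece_norm s M (\<lambda>m. {tt (m - 1)<..tt m}) (\<lambda>t. N (cplx (dt u t)))
       + piece_norm s M (\<lambda>m. {tt (m - 1)<..tt m}) (\<lambda>t. N (cplx (L (u t))))
       + disc_norm s M (kstep tt) (\<lambda>m. N (cplx (\<lambda>x. jump_prev tt m u x / kstep tt m)))"

lemma N_cplx_nonneg: "v \<in> V \<Longrightarrow> 0 \<le> N (cplx v)"
  by (simp add: N_cplx nr_nonneg)

lemma N_nonneg:
  assumes m: "1 \<le> m" "m \<le> M"
  shows "t \<in> cell m \<Longrightarrow> 0 \<le> N (cplx (dt u t))" "t \<in> cell m \<Longrightarrow> 0 \<le> N (cplx (L (u t)))"
    "0 \<le> N (cplx (\<lambda>x. jump_prev tt m u x / k m))"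
proof -
  show "0 \<le> N (cplx (\<lambda>x. jump_prev tt m u x / k m))" by (rule N_cplx_nonneg[OF jump_V(1)[OF m]])
  assume t: "t \<in> cell m"
  then have "t \<in> {0<..<T}" using ivl_sub[OF m] by blast
  then show "0 \<le> N (cplx (L (u t)))" by (intro N_cplx_nonneg L_V u_V)
  show "0 \<le> N (cplx (dt u t))" by (rule N_cplx_nonneg[OF dt_V[OF m t]])
qed

lemma LHS_le:
  assumes s: "1 \<le> s" and B: "0 \<le> B"
    and dtb: "\<And>m t. 1 \<le> m \<Longrightarrow> m \<le> M \<Longrightarrow> t \<in> cell m \<Longrightarrow> N (cplx (dt u t)) \<le> B * conv (avg g) m"
    and Lb: "\<And>m t. 1 \<le> m \<Longrightarrow> m \<le> M \<Longrightarrow> t \<in> cell m \<Longrightarrow> N (cplx (L (u t))) \<le> B * conv (avg g) m"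
    and jb: "\<And>m. 1 \<le> m \<Longrightarrow> m \<le> M \<Longrightarrow> N (cplx (\<lambda>x. jump_prev tt m u x / k m)) \<le> B * conv (avg g) m"
  shows "LHS s \<le> ennreal (3 * B * Lam) * time_norm s {0<..<T} g"
proof -
  let ?y = "ennreal (B * Lam) * time_norm s {0<..<T} g"
  have "LHS s \<le> ?y + ?y + ?y"
  proof (intro add_mono)
    show "piece_norm s M (\<lambda>m. {tt (m - 1)<..tt m}) (\<lambda>t. N (cplx (dt u t))) \<le> ?y"
      by (rule piece_norm_le[OF g_int g_nonneg s B], assumption) (intro conjI N_nonneg dtb; assumption)+
    show "piece_norm s M (\<lambda>m. {tt (m - 1)<..tt m}) (\<lambda>t. N (cplx (L (u t)))) \<le> ?y"
      by (rule piece_norm_le[OF g_int g_nonneg s B], assumption) (intro conjI N_nonneg Lb; assumption)+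
    show "disc_norm s M (kstep tt) (\<lambda>m. N (cplx (\<lambda>x. jump_prev tt m u x / kstep tt m))) \<le> ?y"
      by (rule disc_norm_le[OF g_int g_nonneg s B], assumption) (intro conjI N_nonneg jb; assumption)+
  qed
  also have "\<dots> = (ennreal (B * Lam) + ennreal (B * Lam) + ennreal (B * Lam)) * time_norm s {0<..<T} g"
    by (simp only: distrib_right)
  also have "ennreal (B * Lam) + ennreal (B * Lam) + ennreal (B * Lam) = ennreal (3 * B * Lam)"
    using B Lam_ge1 by (simp add: ennreal_plus[symmetric] del: ennreal_plus)
  finally show ?thesis .
qed

text \<open>On the zero space \<open>Mh\<close> has no lower bound, but every norm on the left
  vanishes.\<close>

lemma trivial_bound:
  assumes s: "1 \<le> s" and n: "n = 0"
  shows "LHS s \<le> 0"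
proof -
  have 0: "N (cplx v) = 0" if "v \<in> V" for v
  proof -
    have "nr (\<lambda>p. of_real (ip v (e p))) = nr (\<lambda>p. 0)" by (rule nr_cong) (simp add: n)
    then show ?thesis using N_cplx[OF that] by simp
  qed
  have "LHS s \<le> ennreal (3 * 0 * Lam) * time_norm s {0<..<T} g"
  proof (rule LHS_le[OF s])
    fix m t assume m: "1 \<le> m" "m \<le> M" and t: "t \<in> cell m"
    then have "t \<in> {0<..<T}" using ivl_sub[OF m] by blast
    then show "N (cplx (L (u t))) \<le> 0 * conv (avg g) m" using 0[OF L_V[OF u_V]] by simp
    show "N (cplx (dt u t)) \<le> 0 * conv (avg g) m" using 0[OF dt_V[OF m t]] by simp
  next
    fix m assume m: "1 \<le> m" "m \<le> M"
    show "N (cplx (\<lambda>x. jump_prev tt m u x / k m)) \<le> 0 * conv (avg g) m" using 0[OF jump_V(1)[OF m]] by simp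
  qed simp
  then show ?thesis by simp
qed

lemma main_bound:
  assumes s: "1 \<le> s" and n: "0 < n"
    and rb: "ref_bounds q \<theta> CS cr KS R" and \<gamma>\<theta>: "\<gamma> < \<theta>" and \<kappa>: "1 \<le> \<kappa>"
    and nb: "\<And>m. 1 \<le> m \<Longrightarrow> m < M \<Longrightarrow> k m \<le> \<kappa> * k (Suc m) \<and> k (Suc m) \<le> \<kappa> * k m"
  defines "A1 \<equiv> dg_scheme.C1 q CS cr KS R \<kappa>" and "A2 \<equiv> dg_scheme.C2 q CS cr KS R \<kappa>"
  defines "B \<equiv> real (q + 1) * A1 + real (q + 1) * (real (q + 1) * A2)"
  shows "0 \<le> B" "LHS s \<le> ennreal (3 * (B * Mh) * Lam) * time_norm s {0<..<T} g"
proof -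
  have ds: "dg_scheme n nr lam Mh \<gamma> q \<theta> CS cr KS R \<kappa> M k Fc Yc (avg g)"
    by (intro dg_scheme.intro sectorial n rb dg_scheme_axioms.intro)
       (use \<gamma>\<theta> \<gamma> \<kappa> nb k_pos scheme_eq Fc_bound in blast)+
  have A: "0 \<le> A1" "0 \<le> A2"
    unfolding A1_def A2_def using dg_scheme.C1_nonneg[OF ds] dg_scheme.C2_nonneg[OF ds] by auto
  then show B: "0 \<le> B" by (simp add: B_def)
  have Mh: "0 \<le> Mh" using Mh_half[OF n] by simp
  have bs: "dg_scheme.bsum k (avg g) m = conv (avg g) m" if "m \<le> M" for m
    unfolding dg_scheme.bsum_def[OF ds] dg_scheme.len_def[OF ds] conv_def
    by (intro sum.cong refl) (simp add: sum_k)
  have um: "dg_scheme.um q Yc = uprev"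
    by (intro ext) (simp add: dg_scheme.um_def[OF ds] uprev_def)
  have conv0: "0 \<le> conv (avg g) m" if "m \<le> M" for m
    by (rule conv_nonneg[OF that avg_nonneg[OF g_int g_nonneg]])
  have Yl: "nr (\<lambda>p. of_real (lam p) * Yc m j p) \<le> A1 * Mh * conv (avg g) m" if "1 \<le> m" "m \<le> M" "j \<le> q" for m j
    using dg_scheme.lamY_bound[OF ds that] unfolding bs[OF that(2)] A1_def .
  have Yd: "nr (\<lambda>p. (Yc m j p - (if j = 0 then uprev (m - 1) p else 0)) / of_real (k m)) \<le> A2 * Mh * conv (avg g) m"
    if "1 \<le> m" "m \<le> M" "j \<le> q" for m j
    using dg_scheme.dY_bound[OF ds that] unfolding bs[OF that(2)] A2_def um .
  have tau01: "0 \<le> tau m t \<and> tau m t \<le> 1" if "1 \<le> m" "m \<le> M" "t \<in> cell m" for m t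
    using that k_pos[of m] by (auto simp: tau_def kstep_def)
  \<comment> \<open>One summand serves the discrete Laplacian, the other the time derivative and the
    jump; the remaining one is nonnegative. The additional \<open>real (q + 1)\<close> pays for the
    factor j of differentiation.\<close>
  have split: "B * Mh * conv (avg g) m = real (q + 1) * (1 * (A1 * Mh * conv (avg g) m))
      + real (q + 1) * (real (q + 1) * (A2 * Mh * conv (avg g) m))" for m
    by (simp add: B_def algebra_simps)
  have p1: "0 \<le> real (q + 1) * (1 * (A1 * Mh * conv (avg g) m))"
    and p2: "0 \<le> A2 * Mh * conv (avg g) m" if "m \<le> M" for m
    using A Mh conv0[OF that] by (auto intro!: mult_nonneg_nonneg)
  have p3: "0 \<le> real (q + 1) * (real (q + 1) * (A2 * Mh * conv (avg g) m))" if "m \<le> M" for m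
    by (intro mult_nonneg_nonneg[OF of_nat_0_le_iff] p2 that)
  show "LHS s \<le> ennreal (3 * (B * Mh) * Lam) * time_norm s {0<..<T} g"
  proof (rule LHS_le[OF s])
    show "0 \<le> B * Mh" using B Mh by simp
    fix m assume m: "1 \<le> m" "m \<le> M"
    have "N (cplx (\<lambda>x. jump_prev tt m u x / k m)) \<le> A2 * Mh * conv (avg g) m"
      unfolding N_jump[OF m] using Yd[OF m, of 0] by simp
    also have "\<dots> \<le> real (q + 1) * (real (q + 1) * (A2 * Mh * conv (avg g) m))"
    proof -
      have "1 * (A2 * Mh * conv (avg g) m) \<le> (real (q + 1) * real (q + 1)) * (A2 * Mh * conv (avg g) m)"
        by (intro mult_right_mono p2 m) (auto simp: algebra_simps)
      then show ?thesis by (simp only: mult_1_left mult.assoc)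
    qed
    finally show "N (cplx (\<lambda>x. jump_prev tt m u x / k m)) \<le> B * Mh * conv (avg g) m"
      unfolding split using p1[OF m(2)] by linarith
    fix t assume t: "t \<in> cell m"
    note tau = tau01[OF m t]
    have "N (cplx (L (u t))) \<le> real (q + 1) * (1 * (A1 * Mh * conv (avg g) m))"
      unfolding N_Lu[OF m t]
      by (rule nr_comb[OF _ Yl[OF m]]) (use tau in \<open>auto simp: norm_power power_le_one\<close>)
    then show "N (cplx (L (u t))) \<le> B * Mh * conv (avg g) m"
      unfolding split using p3[OF m(2)] by linarith
    have "N (cplx (dt u t)) \<le> real (q + 1) * (real (q + 1) * (A2 * Mh * conv (avg g) m))"
      unfolding N_dt[OF m t, of "uprev (m - 1)"]
    proof (rule nr_comb[OF _ Yd[OF m]])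
      fix j assume "j \<le> q"
      have "real j * tau m t ^ (j - 1) \<le> real (q + 1) * 1"
        using \<open>j \<le> q\<close> tau by (intro mult_mono power_le_one) auto
      moreover have "0 \<le> real j * tau m t ^ (j - 1)" using tau by simp
      ultimately show "cmod (of_real (real j * tau m t ^ (j - 1))) \<le> real (q + 1)"
        unfolding norm_of_real by simp
    qed auto
    then show "N (cplx (dt u t)) \<le> B * Mh * conv (avg g) m"
      unfolding split using p1[OF m(2)] by linarith
  qed
qed

end

theorem theorem14:
  fixes \<Omega> :: "'a::euclidean_space set" and simp :: bool and q r :: nat and s :: ennreal
    and T \<gamma> c \<beta> \<kappa> :: real
  assumes "DIM('a) = 2 \<or> DIM('a) = 3" and "lipschitz_domain \<Omega>"
    and "1 \<le> r" and "1 \<le> s" and "0 < T"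
    and "0 < \<gamma>" and "\<gamma> < pi / 2" and "0 < c" and "0 < \<beta>"
  shows "\<exists>C. \<forall>Th L N Mh M tt u f Pf.
     (let V = fe_space simp r \<Omega> Th; X = dG_space q V M tt in
       cell_mesh simp \<Omega> Th \<and>
       is_discrete_laplacian \<Omega> V L \<and>
       is_cnorm_on (cfe_space V) N \<and>
       (\<forall>z. z \<notin> sector \<gamma> \<longrightarrow> (\<forall>w\<in>cfe_space V. \<forall>\<psi>\<in>cfe_space V.
            (\<lambda>x. z * w x + cext L w x) = \<psi> \<longrightarrow> N w \<le> Mh / cmod z * N \<psi>)) \<and>
       time_mesh T c \<beta> \<kappa> M tt \<and>
       (\<forall>t\<in>{0<..<T}. L2_fun \<Omega> (f t) \<and> is_L2_projection \<Omega> V (f t) (Pf t)) \<and>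
       (\<forall>\<phi>\<in>X. set_integrable lborel {0<..<T} (\<lambda>t. L2ip \<Omega> (f t) (\<phi> t))) \<and>
       u \<in> X \<and> (\<forall>\<phi>\<in>X. bilinB \<Omega> M tt u \<phi> = rhsF \<Omega> T f \<phi>)
     \<longrightarrow>
       piece_norm s M (\<lambda>m. {tt (m - 1)<..tt m}) (\<lambda>t. N (cplx (dt u t)))
       + piece_norm s M (\<lambda>m. {tt (m - 1)<..tt m}) (\<lambda>t. N (cplx (L (u t))))
       + disc_norm s M (kstep tt) (\<lambda>m. N (cplx (\<lambda>x. jump_prev tt m u x / kstep tt m)))
       \<le> ennreal (C * Mh * ln (T / kmax tt M)) * time_norm s {0<..<T} (\<lambda>t. N (cplx (Pf t))))"
proof -
  \<comment> \<open>The midpoint, to be strictly between \<gamma> and \<pi>/2; with q it determines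
    the constants of \<open>ref_bounds\<close>.\<close>
  define \<theta> where "\<theta> = (\<gamma> + pi / 2) / 2"
  have \<theta>: "0 < \<theta>" "\<theta> < pi / 2" "\<gamma> < \<theta>" using assms by (auto simp: \<theta>_def)
  obtain CS cr KS R where rb: "ref_bounds q \<theta> CS cr KS R" using ref_bounds_exist[OF \<theta>(1,2)] by blast
  define B where "B = real (q + 1) * dg_scheme.C1 q CS cr KS R \<kappa> + real (q + 1) * (real (q + 1) * dg_scheme.C2 q CS cr KS R \<kappa>)"
  define G where "G = 1 + \<beta> + \<bar>(1 - \<beta>) * ln T - ln c\<bar>"
  show ?thesis
    unfolding Let_def
  \<comment> \<open>The 3 counts the terms on the left, \<open>B\<close> comes from the scheme (q,
    \<theta>, \<kappa>) and \<open>G\<close> from comparing the logarithms (T, c, \<beta>).\<close>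
  proof (intro exI[of _ "3 * B * G"] allI impI, elim conjE)
    fix Th :: "('a \<Rightarrow> 'a) set" and L :: "('a \<Rightarrow> real) \<Rightarrow> 'a \<Rightarrow> real" and N :: "('a \<Rightarrow> complex) \<Rightarrow> real"
      and Mh :: real and M :: nat and tt :: "nat \<Rightarrow> real" and u f Pf :: "real \<Rightarrow> 'a \<Rightarrow> real"
    assume cm: "cell_mesh simp \<Omega> Th" and lap: "is_discrete_laplacian \<Omega> (fe_space simp r \<Omega> Th) L"
      and N: "is_cnorm_on (cfe_space (fe_space simp r \<Omega> Th)) N"
      and res: "\<forall>z. z \<notin> sector \<gamma> \<longrightarrow> (\<forall>w\<in>cfe_space (fe_space simp r \<Omega> Th). \<forall>\<psi>\<in>cfe_space (fe_space simp r \<Omega> Th).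
            (\<lambda>x. z * w x + cext L w x) = \<psi> \<longrightarrow> N w \<le> Mh / cmod z * N \<psi>)"
      and tm: "time_mesh T c \<beta> \<kappa> M tt"
      and f: "\<forall>t\<in>{0<..<T}. L2_fun \<Omega> (f t) \<and> is_L2_projection \<Omega> (fe_space simp r \<Omega> Th) (f t) (Pf t)"
      and fint: "\<forall>\<phi>\<in>dG_space q (fe_space simp r \<Omega> Th) M tt. set_integrable lborel {0<..<T} (\<lambda>t. L2ip \<Omega> (f t) (\<phi> t))"
      and u: "u \<in> dG_space q (fe_space simp r \<Omega> Th) M tt"
      and eq: "\<forall>\<phi>\<in>dG_space q (fe_space simp r \<Omega> Th) M tt. bilinB \<Omega> M tt u \<phi> = rhsF \<Omega> T f \<phi>"
    note mc = mesh_constants[OF tm \<open>0 < c\<close> \<open>0 < \<beta>\<close> \<open>0 < T\<close>]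
    have fem: "fem \<Omega> simp Th" using assms(2) cm by unfold_locales
    have dgs: "dg_setup \<Omega> simp r Th T M tt q L u f Pf"
      by (intro dg_setup.intro fem mc(1) dg_setup_axioms.intro) (use lap f fint u eq in blast)+
    interpret S: dg_setup \<Omega> simp r Th T M tt q L u f Pf by (rule dgs)
    obtain n e lam where eb: "S.eigensystem n e lam"
      "\<forall>v\<in>fe_space simp r \<Omega> Th. v = (\<lambda>x. \<Sum>i<n. L2ip \<Omega> v (e i) * e i x)"
      using S.eigenbasis_exists by blast
    interpret D: dg_coords \<Omega> simp r Th T M tt q L u f Pf n e lam N Mh \<gamma>
      by (intro dg_coords.intro dgs dg_coords_axioms.intro)
         (use eb N res assms in blast)+
    let ?X = "time_norm s {0<..<T} (\<lambda>t. N (cplx (Pf t)))"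
    have g: "D.g = (\<lambda>t. N (cplx (Pf t)))" by (simp add: D.g_def[abs_def])
    show "D.LHS s \<le> ennreal (3 * B * G * Mh * ln (T / kmax tt M)) * ?X"
    \<comment> \<open>For n = 0 the number \<open>Mh\<close> may be negative; \<open>ennreal\<close>
      then truncates to a nonnegative right side, and the left side is 0.\<close>
    proof (cases "n = 0")
      case True
      have "D.LHS s \<le> 0" by (rule D.trivial_bound[OF assms(4) True])
      also have "\<dots> \<le> ennreal (3 * B * G * Mh * ln (T / kmax tt M)) * ?X" by simp
      finally show ?thesis .
    next
      case False
      then have n: "0 < n" by simp
      note mb = D.main_bound[OF assms(4) n rb \<theta>(3) mc(2) mc(4)]
      have "0 \<le> B" "0 \<le> Mh" using mb(1) D.Mh_half[OF n] by (auto simp: B_def)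
      then have "(3 * (B * Mh)) * mesh.Lam T M tt \<le> (3 * (B * Mh)) * (G * ln (T / kmax tt M))"
        using mc(5) by (intro mult_left_mono) (auto simp: G_def)
      also have "\<dots> = 3 * B * G * Mh * ln (T / kmax tt M)" by (simp add: mult_ac)
      finally have "ennreal (3 * (B * Mh) * mesh.Lam T M tt) * ?X \<le> ennreal (3 * B * G * Mh * ln (T / kmax tt M)) * ?X"
        by (intro mult_right_mono ennreal_leI) auto
      with mb(2) show ?thesis unfolding g B_def by (rule order_trans)
    qed
  qed
qed

end
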